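(* (a) For any $2\le m\le n$, the assignments $$T'_1\mapsto (T_mT_{m+1}\cdots T_{n-1}T_nT_{n-1}\cdots T_m)(T_{m-2}T_{m-4}\cdots),\qquad T'_2\mapsto T_{m-1}T_{m-3}\cdots$$ define a strict parabolic homomorphism $\mathrm{Br}^+(I_2(2m))\to\mathrm{Br}^+(B_n)$. (b) For any $2\le m\le n$, the assignments $$T'_i\mapsto T_i,\quad i\in[1,m-1],\qquad T'_m\mapsto T_mT_{m+1}\cdots T_{n-1}T_nT_{n-1}\cdots T_m$$ define a strict parabolic homomorphism $\mathrm{Br}^+(B_m)\to\mathrm{Br}^+(B_n)$. (c) For all $m,n\in\mathbb Z_{\ge 2}$, the assignments $$T'_i\mapsto T_{w_{[(i-1)m+1,im-1]\cup[im+1,(i+1)m-1];\,[(i-1)m+1,(i+1)m-1]}},\quad i\in[1,n-1],\qquad T'_n\mapsto T_{w_{[(n-1)m+1,nm-1];\,[(n-1)m+1,nm]}}$$ define a strict parabolic homomorphism $\mathrm{Br}^+(B_n)\to\mathrm{Br}^+(B_{mn})$. In (a) the products $T_{m-2}T_{m-4}\cdots$ and $T_{m-1}T_{m-3}\cdots$ run over all positive indices of the respective parity; in all parts $T'_i$ (respectively $T_i$) are the generators of the domain (respectively codomain).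
   Context: A Coxeter matrix over a finite set $I$ is a symmetric matrix $M=(m_{ij})_{i,j\in I}$ with $m_{ii}=1$, $m_{ij}\in\mathbb Z_{\ge2}\cup\{\infty\}$ for $i\neq j$. The Artin monoid $\mathrm{Br}^+(M)$ is generated by $T_i$, $i\in I$, subject to $T_iT_jT_i\cdots=T_jT_iT_j\cdots$ ($m_{ij}$ factors on each side) for $i\ne j$, $m_{ij}<\infty$. $W(M)$ is the Coxeter group with simple generators $s_i$. For $w\in W(M)$, $T_w:=T_{i_1}\cdots T_{i_k}$ for any reduced expression $w=s_{i_1}\cdots s_{i_k}$ (independent of the choice). $B_n$ ($n\ge2$) is the Coxeter matrix over $[1,n]=\{1,\dots,n\}$ with $m_{i,i+1}=3$ for $1\le i\le n-2$, $m_{n-1,n}=4$ and all other off-diagonal entries $2$. $I_2(r)$ is the Coxeter matrix over $\{1,2\}$ with $m_{12}=r$. $[a,b]=\{i\in\mathbb Z:a\le i\le b\}$. For $K\subset I$ with $W_K(M)=\langle s_k:k\in K\rangle$ finite, $w_\circ^K$ is the longest element of $W_K(M)$, and for $J\subset K$, $w_{J;K}=w_\circ^Jw_\circ^K$. Strict parabolic: let $\widehat M$, $M$ be Coxeter matrices of finite type (finite Coxeter groups) over $\widehat I$, $I$, and let $\Phi:\mathrm{Br}^+(\widehat M)\to\mathrm{Br}^+(M)$ be a homomorphism of monoids. Let $K\subset I$ be the set of all $i\in I$ such that $T_i$ occurs in an expression of some $\Phi(\widehat T_j)$, $j\in\widehat I$, as a product of generators. $\Phi$ is strict parabolic if for every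 $\widehat J\subset\widehat I$ there is $J\subset K$ with $\Phi(\widehat T_{w_{\widehat J;\widehat I}})=T_{w_{J;K}}$. *)

theory Defs
  imports "HOL-Algebra.Generated_Groups" "HOL-Library.Extended_Nat"
begin

section \<open>Monoids given by generators and relations\<close>

text \<open>The smallest congruence on the free monoid of words over \<open>A\<close> containing \<open>R\<close>.\<close>

inductive_set word_cong :: "'a set \<Rightarrow> ('a list \<times> 'a list) set \<Rightarrow> ('a list \<times> 'a list) set"
  for A :: "'a set" and R :: "('a list \<times> 'a list) set"
where
  base: "(u, v) \<in> R \<Longrightarrow> u \<in> lists A \<Longrightarrow> v \<in> lists A \<Longrightarrow> (u, v) \<in> word_cong A R"
| refl: "u \<in> lists A \<Longrightarrow> (u, u) \<in> word_cong A R"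
| sym: "(u, v) \<in> word_cong A R \<Longrightarrow> (v, u) \<in> word_cong A R"
| trans: "(u, v) \<in> word_cong A R \<Longrightarrow> (v, w) \<in> word_cong A R \<Longrightarrow> (u, w) \<in> word_cong A R"
| append: "(u, v) \<in> word_cong A R \<Longrightarrow> (x, y) \<in> word_cong A R \<Longrightarrow> (u @ x, v @ y) \<in> word_cong A R"

definition presented_monoid :: "'a set \<Rightarrow> ('a list \<times> 'a list) set \<Rightarrow> 'a list set monoid" where
  "presented_monoid A R =
     \<lparr>carrier = lists A // word_cong A R,
      mult = (\<lambda>X Y. \<Union>x\<in>X. \<Union>y\<in>Y. word_cong A R `` {x @ y}),
      one = word_cong A R `` {[]}\<rparr>"

definition monoid_hom :: "('a, 'c) monoid_scheme \<Rightarrow> ('b, 'd) monoid_scheme \<Rightarrow> ('a \<Rightarrow> 'b) set" where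
  "monoid_hom G H = {f \<in> hom G H. f \<one>\<^bsub>G\<^esub> = \<one>\<^bsub>H\<^esub>}"

section \<open>Coxeter matrices, Artin monoids and Coxeter groups\<close>

text \<open>A Coxeter matrix is a pair of an index set \<open>I\<close> and a function \<open>M\<close>, of which only the
  values on \<open>I\<close> matter.\<close>

definition coxeter_matrix :: "'i set \<Rightarrow> ('i \<Rightarrow> 'i \<Rightarrow> enat) \<Rightarrow> bool" where
  "coxeter_matrix I M \<longleftrightarrow> finite I \<and>
     (\<forall>i\<in>I. M i i = 1) \<and>
     (\<forall>i\<in>I. \<forall>j\<in>I. M i j = M j i) \<and>
     (\<forall>i\<in>I. \<forall>j\<in>I. i \<noteq> j \<longrightarrow> 2 \<le> M i j)"

text \<open>The word \<open>i j i \<dots>\<close> with the given number of letters.\<close>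

fun alt_word :: "nat \<Rightarrow> 'i \<Rightarrow> 'i \<Rightarrow> 'i list" where
  "alt_word 0 i j = []"
| "alt_word (Suc k) i j = i # alt_word k j i"

definition artin_rels :: "'i set \<Rightarrow> ('i \<Rightarrow> 'i \<Rightarrow> enat) \<Rightarrow> ('i list \<times> 'i list) set" where
  "artin_rels I M =
     {(alt_word k i j, alt_word k j i) |i j k. i \<in> I \<and> j \<in> I \<and> i \<noteq> j \<and> M i j = enat k}"

definition artin_monoid :: "'i set \<Rightarrow> ('i \<Rightarrow> 'i \<Rightarrow> enat) \<Rightarrow> 'i list set monoid" where
  "artin_monoid I M = presented_monoid I (artin_rels I M)"

text \<open>The element \<open>T_{i_1} \<cdots> T_{i_k}\<close> of the Artin monoid given by the word \<open>[i_1, \<dots>, i_k]\<close>.\<close>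

definition T_word :: "'i set \<Rightarrow> ('i \<Rightarrow> 'i \<Rightarrow> enat) \<Rightarrow> 'i list \<Rightarrow> 'i list set" where
  "T_word I M u = word_cong I (artin_rels I M) `` {u}"

text \<open>The relations \<open>(s_i s_j)^{m_ij} = 1\<close>. As \<open>m_ii = 1\<close>, they include \<open>s_i s_i = 1\<close>, so the
  monoid presented by them is already a group.\<close>

definition coxeter_rels :: "'i set \<Rightarrow> ('i \<Rightarrow> 'i \<Rightarrow> enat) \<Rightarrow> ('i list \<times> 'i list) set" where
  "coxeter_rels I M =
     {(concat (replicate k [i, j]), []) |i j k. i \<in> I \<and> j \<in> I \<and> M i j = enat k}"

definition coxeter_group :: "'i set \<Rightarrow> ('i \<Rightarrow> 'i \<Rightarrow> enat) \<Rightarrow> 'i list set monoid" where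
  "coxeter_group I M = presented_monoid I (coxeter_rels I M)"

definition s_word :: "'i set \<Rightarrow> ('i \<Rightarrow> 'i \<Rightarrow> enat) \<Rightarrow> 'i list \<Rightarrow> 'i list set" where
  "s_word I M u = word_cong I (coxeter_rels I M) `` {u}"

definition finite_type :: "'i set \<Rightarrow> ('i \<Rightarrow> 'i \<Rightarrow> enat) \<Rightarrow> bool" where
  "finite_type I M \<longleftrightarrow> finite (carrier (coxeter_group I M))"

definition cox_length :: "'i set \<Rightarrow> ('i \<Rightarrow> 'i \<Rightarrow> enat) \<Rightarrow> 'i list set \<Rightarrow> nat" where
  "cox_length I M w = (LEAST k. \<exists>u\<in>lists I. s_word I M u = w \<and> length u = k)"

definition reduced_expression ::
  "'i set \<Rightarrow> ('i \<Rightarrow> 'i \<Rightarrow> enat) \<Rightarrow> 'i list \<Rightarrow> 'i list set \<Rightarrow> bool" where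
  "reduced_expression I M u w \<longleftrightarrow>
     u \<in> lists I \<and> s_word I M u = w \<and> length u = cox_length I M w"

text \<open>By Matsumoto's theorem the choice of the reduced expression is immaterial.\<close>

definition T_elem :: "'i set \<Rightarrow> ('i \<Rightarrow> 'i \<Rightarrow> enat) \<Rightarrow> 'i list set \<Rightarrow> 'i list set" where
  "T_elem I M w = T_word I M (SOME u. reduced_expression I M u w)"

definition parabolic_subgroup ::
  "'i set \<Rightarrow> ('i \<Rightarrow> 'i \<Rightarrow> enat) \<Rightarrow> 'i set \<Rightarrow> 'i list set set" where
  "parabolic_subgroup I M K = generate (coxeter_group I M) ((\<lambda>k. s_word I M [k]) ` K)"

text \<open>Meaningful only if the parabolic subgroup is finite.\<close>

definition longest_element ::
  "'i set \<Rightarrow> ('i \<Rightarrow> 'i \<Rightarrow> enat) \<Rightarrow> 'i set \<Rightarrow> 'i list set" where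
  "longest_element I M K =
     (THE w. w \<in> parabolic_subgroup I M K \<and>
        (\<forall>v\<in>parabolic_subgroup I M K. cox_length I M v \<le> cox_length I M w))"

definition w_rel ::
  "'i set \<Rightarrow> ('i \<Rightarrow> 'i \<Rightarrow> enat) \<Rightarrow> 'i set \<Rightarrow> 'i set \<Rightarrow> 'i list set" where
  "w_rel I M J K =
     longest_element I M J \<otimes>\<^bsub>coxeter_group I M\<^esub> longest_element I M K"

section \<open>Strict parabolic homomorphisms\<close>

text \<open>The indices of all generators occurring in some expression of the image of some generator.\<close>

definition hom_support ::
  "'j set \<Rightarrow> ('j \<Rightarrow> 'j \<Rightarrow> enat) \<Rightarrow> 'i set \<Rightarrow> ('i \<Rightarrow> 'i \<Rightarrow> enat) \<Rightarrow>
   ('j list set \<Rightarrow> 'i list set) \<Rightarrow> 'i set" where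
  "hom_support I' M' I M \<Phi> =
     {i \<in> I. \<exists>j\<in>I'. \<exists>u\<in>lists I. T_word I M u = \<Phi> (T_word I' M' [j]) \<and> i \<in> set u}"

definition strict_parabolic ::
  "'j set \<Rightarrow> ('j \<Rightarrow> 'j \<Rightarrow> enat) \<Rightarrow> 'i set \<Rightarrow> ('i \<Rightarrow> 'i \<Rightarrow> enat) \<Rightarrow>
   ('j list set \<Rightarrow> 'i list set) \<Rightarrow> bool" where
  "strict_parabolic I' M' I M \<Phi> \<longleftrightarrow>
     coxeter_matrix I' M' \<and> finite_type I' M' \<and>
     coxeter_matrix I M \<and> finite_type I M \<and>
     \<Phi> \<in> monoid_hom (artin_monoid I' M') (artin_monoid I M) \<and>
     (\<forall>J'\<subseteq>I'. \<exists>J\<subseteq>hom_support I' M' I M \<Phi>.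
        \<Phi> (T_elem I' M' (w_rel I' M' J' I')) =
        T_elem I M (w_rel I M J (hom_support I' M' I M \<Phi>)))"

section \<open>The matrices and words of the theorem\<close>

text \<open>Type \<open>B_n\<close> lives on the index set \<open>{1..n}\<close>, where the bond between \<open>n - 1\<close> and \<open>n\<close> is the
  one labelled 4; \<open>I_2(r)\<close> lives on \<open>{1, 2}\<close>.\<close>

definition cox_B :: "nat \<Rightarrow> nat \<Rightarrow> nat \<Rightarrow> enat" where
  "cox_B n i j =
     (if i = j then 1
      else if {i, j} = {n - 1, n} then 4
      else if i + 1 = j \<or> j + 1 = i then 3
      else 2)"

definition cox_I2 :: "enat \<Rightarrow> nat \<Rightarrow> nat \<Rightarrow> enat" where
  "cox_I2 r i j = (if i = j then 1 else r)"

text \<open>The word \<open>m, m + 1, \<dots>, n - 1, n, n - 1, \<dots>, m\<close>.\<close>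

definition palindrome_word :: "nat \<Rightarrow> nat \<Rightarrow> nat list" where
  "palindrome_word m n = [m..<n] @ [n] @ rev [m..<n]"

text \<open>The word \<open>k, k - 2, k - 4, \<dots>\<close> of positive letters.\<close>

fun down2_word :: "nat \<Rightarrow> nat list" where
  "down2_word 0 = []"
| "down2_word (Suc 0) = [1]"
| "down2_word (Suc (Suc k)) = Suc (Suc k) # down2_word k"

end

theory Submission
  imports Defs "HOL-Combinatorics.Permutations"
begin

text \<open>
  The Coxeter groups are realised by permutations of a set of roots with a notion of positivity.
  Such a realisation yields the exchange condition, hence Matsumoto's theorem and the
  identification of the presented group with the permutation group.

  A map \<open>T'_i \<mapsto> f i\<close> to words that respects the braid relations in the Coxeter group defines a
  strict parabolic homomorphism as soon as there is a reduced word \<open>u_0\<close> such that \<open>u_0\<close> and each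
  \<open>u_0 (f i)\<close> are longest in the parabolic subgroup generated by their letters, \<open>u_0 f(w_0)\<close>
  represents the longest element of the whole group, and \<open>f(w_0)\<close> is reduced. Indeed, let \<open>u v\<close> be a
  reduced word of \<open>w_0\<close> whose prefix \<open>u\<close> represents the longest element of a parabolic subgroup. Then
  every letter of \<open>u_0 f(u)\<close> is a descent of it, so it is longest in its parabolic subgroup, and \<open>f(v)\<close>
  represents the product of the two longest elements.

  For type \<open>B\<close> the roots are pairs of integers, on which signed permutations act. In this
  picture (b) inserts a fixed block in the middle, (a) folds a \<open>4m\<close>-gon onto a path with \<open>2m\<close>
  vertices, and (c) blows up every point to a block of \<open>m\<close> points.
\<close>

section \<open>Monoids given by generators and relations\<close>

text \<open>The origin of \<open>u0\<close>: for empty \<open>J'\<close> the definition demands that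
  \<open>T_{w_0}\<close> be sent to some \<open>T_{w_{J;K}}\<close>, so a parabolic longest element
  must complete \<open>f(w_0)\<close> to the longest element of the codomain. In (a) and (b) it is
  the longest element of the letters above \<open>m\<close>; in (c) it reverses every block.

  The obstacle is that the braid relations have to hold in the Artin monoid, where a relation of
  length \<open>2 * m\<close> between long words is unwieldy. They are therefore checked for
  permutations only; both sides are shown to be reduced, and Matsumoto's theorem lifts the equality.
  Reducedness in turn comes from one word: every reduced word is a prefix of a reduced word of
  \<open>w_0\<close>, and prefixes of reduced words are reduced. To change the word of
  \<open>w_0\<close> before the map is known to be well defined, it suffices that braid moves
  preserve the length and the permutation of the image. What remains in each family is a length,
  obtained by counting inversions with weights.\<close>

declare in_lists_conv_set [simp] ball_Un [simp]

lemma rev_in_lists: "rev u \<in> lists A \<longleftrightarrow> u \<in> lists A"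
  by simp

lemma word_cong_lists: "(u, v) \<in> word_cong A R \<Longrightarrow> u \<in> lists A \<and> v \<in> lists A"
  by (induction rule: word_cong.induct) auto

lemma equiv_word_cong: "equiv (lists A) (word_cong A R)"
proof (rule equivI)
  show "word_cong A R \<subseteq> lists A \<times> lists A"
    by (auto dest: word_cong_lists)
  show "refl_on (lists A) (word_cong A R)"
    by (auto intro!: refl_onI word_cong.refl)
  show "Relation.sym (word_cong A R)"
    by (auto intro!: symI word_cong.sym)
  show "Relation.trans (word_cong A R)"
    by (auto intro!: transI elim: word_cong.trans)
qed

lemma word_class_eq_iff:
  assumes "u \<in> lists A" "v \<in> lists A"
  shows "word_cong A R `` {u} = word_cong A R `` {v} \<longleftrightarrow> (u, v) \<in> word_cong A R"
  using eq_equiv_class_iff[OF equiv_word_cong assms] .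

lemma word_class_mult:
  assumes "u \<in> lists A" "v \<in> lists A"
  shows "word_cong A R `` {u} \<otimes>\<^bsub>presented_monoid A R\<^esub> word_cong A R `` {v}
    = word_cong A R `` {u @ v}"
proof -
  have "word_cong A R `` {x @ y} = word_cong A R `` {u @ v}"
    if "x \<in> word_cong A R `` {u}" "y \<in> word_cong A R `` {v}" for x y
  proof -
    have "(u, x) \<in> word_cong A R" "(v, y) \<in> word_cong A R" using that by auto
    then have "(u @ v, x @ y) \<in> word_cong A R" by (rule word_cong.append)
    then show ?thesis
      by (metis equiv_class_eq[OF equiv_word_cong])
  qed
  moreover have "u \<in> word_cong A R `` {u}" "v \<in> word_cong A R `` {v}"
    using assms by (auto intro: word_cong.refl)
  ultimately have "(\<Union>x\<in>word_cong A R `` {u}. \<Union>y\<in>word_cong A R `` {v}. word_cong A R `` {x @ y})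
      = word_cong A R `` {u @ v}"
    by blast
  then show ?thesis by (simp add: presented_monoid_def)
qed

lemma presented_monoid_carrierE:
  assumes "X \<in> carrier (presented_monoid A R)"
  obtains u where "u \<in> lists A" "X = word_cong A R `` {u}"
  using assms by (auto simp: presented_monoid_def quotient_def)

lemma word_class_closed:
  "u \<in> lists A \<Longrightarrow> word_cong A R `` {u} \<in> carrier (presented_monoid A R)"
  by (auto simp: presented_monoid_def quotient_def)

lemma presented_monoid_one: "\<one>\<^bsub>presented_monoid A R\<^esub> = word_cong A R `` {[]}"
  by (simp add: presented_monoid_def)

lemma presented_monoid_monoid: "monoid (presented_monoid A R)"
proof
  fix X Y Z
  assume "X \<in> carrier (presented_monoid A R)" "Y \<in> carrier (presented_monoid A R)"
    "Z \<in> carrier (presented_monoid A R)"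
  then obtain x y z where xyz: "x \<in> lists A" "X = word_cong A R `` {x}"
    "y \<in> lists A" "Y = word_cong A R `` {y}" "z \<in> lists A" "Z = word_cong A R `` {z}"
    by (meson presented_monoid_carrierE)
  show "X \<otimes>\<^bsub>presented_monoid A R\<^esub> Y \<in> carrier (presented_monoid A R)"
    using xyz word_class_closed[of "x @ y" A R] by (simp add: word_class_mult)
  show "X \<otimes>\<^bsub>presented_monoid A R\<^esub> Y \<otimes>\<^bsub>presented_monoid A R\<^esub> Z =
      X \<otimes>\<^bsub>presented_monoid A R\<^esub> (Y \<otimes>\<^bsub>presented_monoid A R\<^esub> Z)"
    using xyz word_class_mult[of "x @ y" A z R] word_class_mult[of x A "y @ z" R]
    by (simp add: word_class_mult)
  show "\<one>\<^bsub>presented_monoid A R\<^esub> \<otimes>\<^bsub>presented_monoid A R\<^esub> X = X"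
    using xyz by (simp add: presented_monoid_one word_class_mult)
  show "X \<otimes>\<^bsub>presented_monoid A R\<^esub> \<one>\<^bsub>presented_monoid A R\<^esub> = X"
    using xyz by (simp add: presented_monoid_one word_class_mult)
next
  show "\<one>\<^bsub>presented_monoid A R\<^esub> \<in> carrier (presented_monoid A R)"
    by (simp add: presented_monoid_one word_class_closed)
qed

lemma alt_word_lists: "i \<in> A \<Longrightarrow> j \<in> A \<Longrightarrow> alt_word k i j \<in> lists A"
  by (induction k arbitrary: i j) (simp_all del: in_lists_conv_set)

lemma length_alt_word [simp]: "length (alt_word k i j) = k"
  by (induction k arbitrary: i j) auto

lemma alt_word_snoc: "alt_word (Suc k) i j = alt_word k i j @ [if even k then i else j]"
proof (induction k arbitrary: i j)
  case (Suc k)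
  have "alt_word (Suc (Suc k)) i j = i # alt_word (Suc k) j i" by simp
  also have "\<dots> = i # alt_word k j i @ [if even k then j else i]" using Suc.IH by metis
  finally show ?case by simp
qed simp

text \<open>Cut the word of length \<open>2 * k\<close> in the middle: its second half read
  backwards alternates starting from \<open>j\<close>. This converts the relation
  \<open>(s_i s_j)^k = 1\<close> into the braid relation in \<open>cox_cong_braid\<close>.\<close>

lemma replicate_pair_alt_word:
  "concat (replicate k [i, j]) = alt_word k i j @ rev (alt_word k j i)"
proof (induction k)
  case (Suc k)
  have "concat (replicate (Suc k) [i, j]) = concat (replicate k [i, j]) @ [i, j]"
    by (metis append_Nil2 concat.simps concat_append replicate_Suc replicate_append_same)
  then have *: "concat (replicate (Suc k) [i, j]) = alt_word k i j @ rev (alt_word k j i) @ [i, j]"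
    using Suc by simp
  have "rev (alt_word k j i) @ [i, j] = rev (j # i # alt_word k j i)" by simp
  also have "\<dots> = rev (alt_word (Suc (Suc k)) j i)" by simp
  also have "\<dots> = rev (alt_word (Suc k) j i @ [if even (Suc k) then j else i])"
    by (metis alt_word_snoc)
  finally have "rev (alt_word k j i) @ [i, j] = (if even k then i else j) # rev (alt_word (Suc k) j i)"
    by simp
  then show ?case
    using * by (simp del: alt_word.simps add: alt_word_snoc[of k i j])
qed simp

section \<open>Coxeter groups acting on roots\<close>

fun ev :: "('i \<Rightarrow> 'p \<Rightarrow> 'p) \<Rightarrow> 'i list \<Rightarrow> 'p \<Rightarrow> 'p" where
  "ev s [] = id"
| "ev s (i # u) = s i \<circ> ev s u"

lemma ev_append: "ev s (u @ v) = ev s u \<circ> ev s v"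
  by (induction u) (auto simp: comp_assoc)

lemma ev_replicate_pair: "ev s (concat (replicate k [i, j])) = (s i \<circ> s j) ^^ k"
  by (induction k) (auto simp: ev_append comp_assoc)

text \<open>\<open>D i\<close> is the set of positive roots made negative by \<open>s i\<close>; it may have several elements, since
  one geometric root may be represented by several points of \<open>'p\<close>. The assumption \<open>conj\<close> says that a
  root determines its reflection, and \<open>alt_pos\<close> that the order of \<open>s i \<circ> s j\<close> is not a proper
  divisor of \<open>M i j\<close>.\<close>

locale coxeter_roots =
  fixes I :: "'i set" and M :: "'i \<Rightarrow> 'i \<Rightarrow> enat" and s :: "'i \<Rightarrow> 'p \<Rightarrow> 'p"
    and pos :: "'p set" and D :: "'i \<Rightarrow> 'p set" and \<alpha> :: "'i \<Rightarrow> 'p"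
  assumes cox: "coxeter_matrix I M"
    and M_fin: "\<And>i j. i \<in> I \<Longrightarrow> j \<in> I \<Longrightarrow> M i j \<noteq> \<infinity>"
    and rel: "\<And>i j k. i \<in> I \<Longrightarrow> j \<in> I \<Longrightarrow> M i j = enat k \<Longrightarrow> (s i \<circ> s j) ^^ k = id"
    and root_D: "\<And>i. i \<in> I \<Longrightarrow> \<alpha> i \<in> D i"
    and D_pos: "\<And>i p. i \<in> I \<Longrightarrow> p \<in> D i \<Longrightarrow> p \<in> pos"
    and D_neg: "\<And>i p. i \<in> I \<Longrightarrow> p \<in> D i \<Longrightarrow> s i p \<notin> pos"
    and pos_D: "\<And>i p. i \<in> I \<Longrightarrow> p \<in> pos \<Longrightarrow> p \<notin> D i \<Longrightarrow> s i p \<in> pos"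
    and opp: "\<And>i p u. i \<in> I \<Longrightarrow> p \<in> D i \<Longrightarrow> u \<in> lists I \<Longrightarrow> ev s u p \<in> pos
      \<Longrightarrow> ev s u (s i p) \<notin> pos"
    and conj: "\<And>i j p u. i \<in> I \<Longrightarrow> j \<in> I \<Longrightarrow> u \<in> lists I \<Longrightarrow> p \<in> D i \<Longrightarrow> ev s u p \<in> D j
      \<Longrightarrow> ev s u \<circ> s i = s j \<circ> ev s u"
    and alt_pos: "\<And>i j k. i \<in> I \<Longrightarrow> j \<in> I \<Longrightarrow> i \<noteq> j \<Longrightarrow> enat k < M i j
      \<Longrightarrow> ev s (alt_word k i j) (\<alpha> (if even k then i else j)) \<in> pos"
    and fin: "finite (ev s ` lists I)"
begin

section \<open>Words, reduced words and the exchange condition\<close>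

abbreviation "E \<equiv> ev s"

lemma invol: "i \<in> I \<Longrightarrow> s i \<circ> s i = id"
  using rel[of i i 1] cox by (auto simp: coxeter_matrix_def one_enat_def)

lemma ev_rev: "u \<in> lists I \<Longrightarrow> E u \<circ> E (rev u) = id"
proof (induction u)
  case (Cons i u)
  have "E (i # u) \<circ> E (rev (i # u)) = s i \<circ> (E u \<circ> E (rev u)) \<circ> s i"
    by (simp add: ev_append comp_assoc)
  also have "\<dots> = s i \<circ> s i" using Cons by (simp del: comp_apply id_apply)
  also have "\<dots> = id" using Cons invol by simp
  finally show ?case .
qed simp

lemma ev_rev': "u \<in> lists I \<Longrightarrow> E (rev u) \<circ> E u = id"
  using ev_rev[of "rev u"] by simp

lemma ev_left_cancel: "u \<in> lists I \<Longrightarrow> E u \<circ> f = E u \<circ> g \<longleftrightarrow> f = g"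
  by (metis comp_assoc ev_rev' id_comp)

lemma ev_right_cancel: "u \<in> lists I \<Longrightarrow> f \<circ> E u = g \<circ> E u \<longleftrightarrow> f = g"
  by (metis comp_assoc ev_rev comp_id)

lemma ev_append_left_cancel: "u \<in> lists I \<Longrightarrow> E (u @ v) = E (u @ w) \<longleftrightarrow> E v = E w"
  by (simp add: ev_append ev_left_cancel)

lemma ev_append_right_cancel: "u \<in> lists I \<Longrightarrow> E (v @ u) = E (w @ u) \<longleftrightarrow> E v = E w"
  by (simp add: ev_append ev_right_cancel)

lemma ev_Cons_Cons: "i \<in> I \<Longrightarrow> E (i # i # u) = E u"
  using invol[of i] by (simp add: comp_assoc[symmetric])

lemma ev_rev_eq_iff:
  assumes "u \<in> lists I" "v \<in> lists I"
  shows "E (rev u) = E (rev v) \<longleftrightarrow> E u = E v"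
proof -
  have *: "E (rev x) = E (rev y)" if "E x = E y" "x \<in> lists I" "y \<in> lists I" for x y
  proof -
    have "E x \<circ> E (rev x) = E x \<circ> E (rev y)" using ev_rev[of x] ev_rev[of y] that by metis
    then show ?thesis using that ev_left_cancel by blast
  qed
  then show ?thesis
    using assms *[of "rev u" "rev v"] *[of u v] by (metis rev_in_lists rev_rev_ident)
qed

text \<open>Minimality refers to the permutation group, since the presented group is not yet known
  to act faithfully. \<open>reduced_expression_iff\<close> reconciles the two notions.\<close>

definition reduced :: "'i list \<Rightarrow> bool" where
  "reduced u \<longleftrightarrow> u \<in> lists I \<and> (\<forall>v\<in>lists I. E v = E u \<longrightarrow> length u \<le> length v)"

lemma reduced_lists: "reduced u \<Longrightarrow> u \<in> lists I"
  by (simp add: reduced_def)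

lemma reduced_le: "reduced u \<Longrightarrow> v \<in> lists I \<Longrightarrow> E v = E u \<Longrightarrow> length u \<le> length v"
  by (simp add: reduced_def)

lemma reduced_Nil [simp]: "reduced []"
  by (simp add: reduced_def)

lemma reduced_length_eq: "reduced u \<Longrightarrow> reduced v \<Longrightarrow> E u = E v \<Longrightarrow> length u = length v"
  by (metis le_antisym reduced_def)

lemma reduced_transfer:
  "reduced u \<Longrightarrow> v \<in> lists I \<Longrightarrow> E v = E u \<Longrightarrow> length v \<le> length u \<Longrightarrow> reduced v"
  by (metis le_trans reduced_def)

lemma reduced_rev: "reduced (rev u) \<longleftrightarrow> reduced u"
proof -
  have *: "reduced (rev u)" if "reduced u" for u
    unfolding reduced_def
  proof (intro conjI ballI impI)
    show "rev u \<in> lists I" using that by (simp add: reduced_def)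
    fix v assume v: "v \<in> lists I" "E v = E (rev u)"
    then have "E (rev v) = E u"
      using ev_rev_eq_iff[of v "rev u"] reduced_lists[OF that] by simp
    then show "length (rev u) \<le> length v"
      using that v reduced_le[of u "rev v"] by simp
  qed
  then show ?thesis using *[of "rev u"] by (metis rev_rev_ident)
qed

lemma reduced_appendD:
  assumes "reduced (u @ v)"
  shows "reduced u" "reduced v"
proof -
  have uv: "u \<in> lists I" "v \<in> lists I" using reduced_lists[OF assms] by auto
  have "length u \<le> length w" if "w \<in> lists I" "E w = E u" for w
    using uv that reduced_le[OF assms, of "w @ v"] by (simp add: ev_append)
  then show "reduced u" unfolding reduced_def using uv by blast
  have "length v \<le> length w" if "w \<in> lists I" "E w = E v" for w
    using uv that reduced_le[OF assms, of "u @ w"] by (simp add: ev_append)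
  then show "reduced v" unfolding reduced_def using uv by blast
qed

lemma reduced_ConsD: "reduced (i # u) \<Longrightarrow> reduced u"
  using reduced_appendD[of "[i]" u] by simp

lemma exists_reduced: "u \<in> lists I \<Longrightarrow> \<exists>v. reduced v \<and> E v = E u"
proof -
  assume u: "u \<in> lists I"
  then obtain v where "v \<in> lists I \<and> E v = E u"
    "\<forall>w. w \<in> lists I \<and> E w = E u \<longrightarrow> length v \<le> length w"
    using ex_has_least_nat[of "\<lambda>v. v \<in> lists I \<and> E v = E u" u length] by blast
  then show ?thesis unfolding reduced_def by metis
qed

text \<open>Follow \<open>p\<close> through the letters of \<open>u\<close> from the right. It
  starts positive and ends non-positive, so some letter \<open>j\<close> meets it inside
  \<open>D j\<close>; there \<open>conj\<close> turns \<open>s i\<close> into \<open>s j\<close>,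
  which cancels that letter.\<close>

lemma exchange_right:
  assumes "u \<in> lists I" "i \<in> I" "p \<in> D i" "E u p \<notin> pos"
  shows "\<exists>a j b. u = a @ j # b \<and> E (u @ [i]) = E (a @ b)"
  using assms
proof (induction u rule: list.induct)
  case Nil
  then show ?case using D_pos by fastforce
next
  case (Cons j u)
  have ju: "j \<in> I" "u \<in> lists I" using Cons.prems(1) by simp_all
  show ?case
  proof (cases "E u p \<in> pos")
    case False
    then obtain a k b where "u = a @ k # b" "E (u @ [i]) = E (a @ b)"
      using Cons.IH ju Cons.prems(2,3) by blast
    then have "j # u = (j # a) @ k # b" "E ((j # u) @ [i]) = E ((j # a) @ b)" by auto
    then show ?thesis by blast
  next
    case True
    then have "E u p \<in> D j" using Cons.prems(4) ju pos_D[of j "E u p"] by auto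
    then have "E u \<circ> s i = s j \<circ> E u" using Cons.prems(2,3) ju conj by blast
    then have "E ((j # u) @ [i]) = s j \<circ> (s j \<circ> E u)" by (simp add: ev_append comp_assoc)
    also have "\<dots> = E ([] @ u)" using ev_Cons_Cons[OF ju(1)] by simp
    finally have "E ((j # u) @ [i]) = E ([] @ u)" .
    then show ?thesis by blast
  qed
qed

text \<open>For the direction from positivity, take a reduced word \<open>v\<close> of
  \<open>u @ [i]\<close>. It sends the root to a non-positive point, so exchange shortens
  \<open>v @ [i]\<close>, which represents \<open>u\<close>; hence \<open>v\<close> is longer than
  \<open>u\<close>.\<close>

lemma reduced_snoc_iff:
  assumes "reduced u" "i \<in> I"
  shows "reduced (u @ [i]) \<longleftrightarrow> E u (\<alpha> i) \<in> pos"
proof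
  assume r: "reduced (u @ [i])"
  show "E u (\<alpha> i) \<in> pos"
  proof (rule ccontr)
    assume "E u (\<alpha> i) \<notin> pos"
    then obtain a j b where "u = a @ j # b" "E (u @ [i]) = E (a @ b)"
      using exchange_right[OF reduced_lists[OF assms(1)] assms(2) root_D[OF assms(2)]] by blast
    then show False
      using reduced_le[OF r, of "a @ b"] reduced_lists[OF assms(1)] by auto
  qed
next
  assume p: "E u (\<alpha> i) \<in> pos"
  have u: "u \<in> lists I" using assms reduced_lists by blast
  obtain v where v: "reduced v" "E v = E (u @ [i])" using exists_reduced[of "u @ [i]"] u assms by auto
  have vl: "v \<in> lists I" using v reduced_lists by blast
  have "E v (\<alpha> i) \<notin> pos" using v(2) opp[OF assms(2) root_D[OF assms(2)] u p] by (simp add: ev_append)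
  then obtain a j b where ab: "v = a @ j # b" "E (v @ [i]) = E (a @ b)"
    using exchange_right[OF vl assms(2) root_D[OF assms(2)]] by blast
  have "E (v @ [i]) = E u" using v(2) assms(2) by (simp add: ev_append comp_assoc invol)
  then have "length u \<le> length (a @ b)" using reduced_le[OF assms(1), of "a @ b"] ab vl by auto
  then have "length (u @ [i]) \<le> length v" using ab by simp
  then show "reduced (u @ [i])"
    using reduced_transfer[OF v(1), of "u @ [i]"] v(2) u assms by auto
qed

lemma reduced_singleton: "i \<in> I \<Longrightarrow> reduced [i]"
  using reduced_snoc_iff[of "[]" i] D_pos root_D by fastforce

lemma exchange_left:
  assumes "reduced u" "i \<in> I" "\<not> reduced (i # u)"
  shows "\<exists>a j b. u = a @ j # b \<and> E (i # u) = E (a @ b)"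
proof -
  have u: "u \<in> lists I" using assms reduced_lists by blast
  have "\<not> reduced (rev u @ [i])" using assms(3) reduced_rev[of "i # u"] by simp
  then have "E (rev u) (\<alpha> i) \<notin> pos" using reduced_snoc_iff[of "rev u" i] assms reduced_rev by auto
  then obtain a j b where ab: "rev u = a @ j # b" "E (rev u @ [i]) = E (a @ b)"
    using exchange_right[of "rev u" i "\<alpha> i"] u assms(2) root_D by (metis rev_in_lists)
  have "u = rev (a @ j # b)" using ab(1) by (metis rev_rev_ident)
  then have *: "u = rev b @ j # rev a" by simp
  have "E (rev (i # u)) = E (rev (rev b @ rev a))" using ab(2) by simp
  then have "E (i # u) = E (rev b @ rev a)"
    using ev_rev_eq_iff[of "i # u" "rev b @ rev a"] u assms * by auto
  then show ?thesis using * by blast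
qed

text \<open>Multiplying by \<open>i\<close> once more turns a deletion into a replacement: the
  element acquires a reduced word that starts with \<open>i\<close>.\<close>

lemma exchange_reduced:
  assumes "reduced (a @ j # b)" "i \<in> I" "E (i # a @ j # b) = E (a @ b)"
  shows "reduced (i # a @ b)" "E (i # a @ b) = E (a @ j # b)"
proof -
  have l: "a @ j # b \<in> lists I" using assms reduced_lists by blast
  have "E (i # a @ b) = E (i # i # a @ j # b)" using assms(3) by simp
  then show eq: "E (i # a @ b) = E (a @ j # b)" using ev_Cons_Cons assms(2) by metis
  show "reduced (i # a @ b)"
    using reduced_transfer[OF assms(1) _ eq] l assms(2) by auto
qed

text \<open>Exchange only deletes letters, so reducing a word never leaves \<open>K\<close>.\<close>

lemma exists_reduced_in:
  assumes "K \<subseteq> I" "v \<in> lists K"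
  shows "\<exists>r\<in>lists K. reduced r \<and> E r = E v"
  using assms(2)
proof (induction v rule: list.induct)
  case (Cons i v)
  then obtain r where r: "r \<in> lists K" "reduced r" "E r = E v" by auto
  have i: "i \<in> I" "i \<in> K" using Cons assms by auto
  show ?case
  proof (cases "reduced (i # r)")
    case True
    then show ?thesis using r i by (intro bexI[of _ "i # r"]) auto
  next
    case False
    then obtain a j b where ab: "r = a @ j # b" "E (i # r) = E (a @ b)"
      using exchange_left r i by blast
    have "reduced (i # a @ b)" using exchange_reduced(1) ab r i by metis
    then have "reduced (a @ b)" by (rule reduced_ConsD)
    moreover have "E (a @ b) = E (i # v)" using ab(2) r(3) by simp
    ultimately show ?thesis using ab(1) r(1) by (intro bexI[of _ "a @ b"]) auto
  qed
next
  case Nil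
  show ?case by (intro bexI[of _ "[]"]) (simp_all del: in_lists_conv_set)
qed

section \<open>Longest elements\<close>

text \<open>A local condition: every letter of \<open>K\<close> is a left descent. Maximal length
  and uniqueness of the element follow in \<open>longest_length\<close>.\<close>

definition longest :: "'i set \<Rightarrow> 'i list \<Rightarrow> bool" where
  "longest K u \<longleftrightarrow> u \<in> lists K \<and> reduced u \<and> (\<forall>i\<in>K. \<not> reduced (i # u))"

text \<open>Build up \<open>v\<close> from the right. If \<open>v @ r\<close> represents the element
  and \<open>i\<close> is a left descent, exchange puts \<open>i\<close> in front and deletes one
  letter; that letter lies in \<open>r\<close>, because a deletion inside \<open>v\<close> would
  contradict that \<open>i # v\<close> is reduced.\<close>

lemma longest_prefix:
  assumes "reduced u" "\<And>i. i \<in> K \<Longrightarrow> i \<in> I \<and> \<not> reduced (i # u)" "v \<in> lists K" "reduced v"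
  shows "\<exists>r. reduced (v @ r) \<and> E (v @ r) = E u"
  using assms(3,4)
proof (induction v rule: list.induct)
  case Nil
  then show ?case using assms(1) by auto
next
  case (Cons i v)
  have i: "i \<in> I" "\<not> reduced (i # u)" using Cons.prems assms(2) by auto
  obtain r where r: "reduced (v @ r)" "E (v @ r) = E u"
    using Cons reduced_ConsD by auto
  have "\<not> reduced (i # v @ r)"
  proof
    assume "reduced (i # v @ r)"
    moreover have "length u = length (v @ r)" using r assms(1) reduced_length_eq by metis
    ultimately show False
      using reduced_transfer[of "i # v @ r" "i # u"] r i reduced_lists[OF assms(1)] by auto
  qed
  then obtain a j b where ab: "v @ r = a @ j # b" "E (i # v @ r) = E (a @ b)"
    using exchange_left[OF r(1) i(1)] by blast
  have new: "reduced (i # a @ b)" "E (i # a @ b) = E u"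
    using exchange_reduced[of a j b i] ab r i by auto
  consider (1) c where "a = v @ c" "r = c @ j # b" | (2) c where "v = a @ j # c" "b = c @ r"
    using ab(1) by (auto simp: append_eq_append_conv2 append_eq_Cons_conv)
  then show ?case
  proof cases
    case 1
    then have "reduced ((i # v) @ c @ b) \<and> E ((i # v) @ c @ b) = E u" using new by simp
    then show ?thesis by blast
  next
    case 2
    have rl: "r \<in> lists I" using r(1) reduced_lists by auto
    have "E ((i # v) @ r) = E ((a @ c) @ r)" using ab(2) 2 by simp
    then have "E (i # v) = E (a @ c)" using ev_append_right_cancel rl by blast
    moreover have "a @ c \<in> lists I" using reduced_lists[OF Cons.prems(2)] 2 by auto
    ultimately show ?thesis using reduced_le[OF Cons.prems(2), of "a @ c"] 2 by simp
  qed
qed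

lemma longest_extends:
  assumes "K \<subseteq> I" "longest K u" "v \<in> lists K" "reduced v"
  shows "\<exists>r. reduced (v @ r) \<and> E (v @ r) = E u"
  using longest_prefix[of u K v] assms unfolding longest_def by blast

lemma longest_length:
  assumes "K \<subseteq> I" "longest K u" "v \<in> lists K" "reduced v"
  shows "length v \<le> length u" "length v = length u \<Longrightarrow> E v = E u"
proof -
  obtain r where r: "reduced (v @ r)" "E (v @ r) = E u" using longest_extends[OF assms] by blast
  have l: "length (v @ r) = length u"
    using r assms(2) reduced_length_eq unfolding longest_def by metis
  then show "length v \<le> length u" by simp
  show "E v = E u" if "length v = length u" using r l that by simp
qed

text \<open>The reversed word is again reduced over \<open>K\<close> and equally long, and maximal
  length determines the element.\<close>

lemma longest_rev:
  assumes "K \<subseteq> I" "longest K u"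
  shows "E (rev u) = E u"
  using longest_length(2)[OF assms, of "rev u"] assms(2) reduced_rev
  unfolding longest_def by auto

lemma longest_invol:
  assumes "K \<subseteq> I" "longest K u"
  shows "E u \<circ> E u = id"
proof -
  have "u \<in> lists I" using assms(2) reduced_lists unfolding longest_def by blast
  then show ?thesis using ev_rev[of u] longest_rev[OF assms] by simp
qed

text \<open>Signs of roots detect right descents, whereas \<open>longest\<close> asks for left
  descents. So \<open>rev u\<close> is recognised as longest first, and \<open>longest_rev\<close>
  carries this over to \<open>u\<close>.\<close>

lemma longestI:
  assumes "K \<subseteq> I" "u \<in> lists K" "reduced u" "\<And>k. k \<in> K \<Longrightarrow> E u (\<alpha> k) \<notin> pos"
  shows "longest K u"
proof -
  have "\<not> reduced (k # rev u)" if "k \<in> K" for k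
    using reduced_snoc_iff[OF assms(3), of k] reduced_rev[of "u @ [k]"] assms(1) assms(4)[OF that] that
    by auto
  then have l: "longest K (rev u)" using assms reduced_rev unfolding longest_def by auto
  have "E u = E (rev u)" using longest_rev[OF assms(1) l] by simp
  then have "\<not> reduced (k # u)" if "k \<in> K" for k
  proof -
    have "k # rev u \<in> lists I" using assms(1) reduced_lists[OF assms(3)] that by auto
    then show ?thesis
      using reduced_transfer[of "k # u" "k # rev u"] l \<open>E u = E (rev u)\<close> that
      unfolding longest_def by auto
  qed
  then show ?thesis using assms unfolding longest_def by blast
qed

lemma longestD:
  assumes "K \<subseteq> I" "longest K u" "k \<in> K"
  shows "E u (\<alpha> k) \<notin> pos"
proof
  assume p: "E u (\<alpha> k) \<in> pos"
  have k: "k \<in> I" using assms by auto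
  have u: "reduced u" "u \<in> lists I" using assms(2) reduced_lists unfolding longest_def by blast+
  have "reduced (u @ [k])" using p reduced_snoc_iff[OF u(1) k] by simp
  then have "reduced (k # rev u)" using reduced_rev[of "u @ [k]"] by simp
  then have "reduced (k # u)"
    using reduced_transfer[of "k # rev u" "k # u"] longest_rev[OF assms(1,2)] u k by auto
  then show False using assms unfolding longest_def by blast
qed

text \<open>The length of a reduced word depends only on its permutation (this is \<open>h\<close>),
  so finitely many permutations leave finitely many lengths, and a word of maximal length cannot be
  extended.\<close>

lemma longest_exists:
  assumes "K \<subseteq> I"
  shows "\<exists>u. longest K u"
proof -
  define L where "L = {length u |u. u \<in> lists K \<and> reduced u}"
  define h where "h g = (SOME n. \<exists>u. reduced u \<and> E u = g \<and> length u = n)" for g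
  have h: "h (E u) = length u" if "reduced u" for u
  proof -
    have "\<exists>v. reduced v \<and> E v = E u \<and> length v = h (E u)"
      unfolding h_def by (rule someI_ex) (use that in blast)
    then show ?thesis using reduced_length_eq that by metis
  qed
  have "L \<subseteq> h ` (E ` lists I)"
  proof
    fix n assume "n \<in> L"
    then obtain u where "reduced u" "n = length u" unfolding L_def by blast
    then show "n \<in> h ` (E ` lists I)" using h[of u] reduced_lists[of u] by (metis imageI)
  qed
  then have finL: "finite L" using fin finite_subset by blast
  have "0 \<in> L" unfolding L_def using reduced_Nil by force
  then obtain n where n: "n \<in> L" "n = Max L" using finL Max_in by blast
  obtain u where "u \<in> lists K" "reduced u" "length u = n" using n(1) unfolding L_def by blast
  then have u: "u \<in> lists K" "reduced u" "length u = Max L" using n(2) by blast+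
  have "\<not> reduced (i # u)" if "i \<in> K" for i
  proof
    assume "reduced (i # u)"
    then have "length (i # u) \<in> L"
      unfolding L_def using u(1) that by (intro CollectI exI[of _ "i # u"]) simp
    then have "length (i # u) \<le> Max L" using finL by (rule Max_ge[rotated])
    then show False using u(3) by simp
  qed
  then show ?thesis using u(1,2) unfolding longest_def by blast
qed

section \<open>Matsumoto's theorem\<close>

lemma reduced_alt_word:
  assumes "i \<in> I" "j \<in> I" "i \<noteq> j" "enat k \<le> M i j"
  shows "reduced (alt_word k i j)"
  using assms(4)
proof (induction k)
  case (Suc k)
  then have k: "enat k < M i j" by (metis Suc_ile_eq)
  then have "reduced (alt_word k i j)" using Suc by simp
  then show ?case
    unfolding alt_word_snoc using reduced_snoc_iff[of "alt_word k i j" "if even k then i else j"]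
      alt_pos[OF assms(1-3) k] assms(1,2) by auto
qed simp

lemma M_sym: "i \<in> I \<Longrightarrow> j \<in> I \<Longrightarrow> M i j = M j i"
  using cox by (auto simp: coxeter_matrix_def)

text \<open>Induction on the alternating prefix, with \<open>i\<close> and \<open>j\<close> changing
  roles. Exchanging \<open>i\<close> into a word that starts with the shorter prefix must delete a
  letter behind that prefix, because the alternating word prolonged by \<open>i\<close> is still
  reduced.\<close>

lemma two_descents:
  assumes "i \<in> I" "j \<in> I" "i \<noteq> j" "reduced (i # u)" "reduced (j # v)" "E (i # u) = E (j # v)"
    "enat (Suc k) \<le> M i j"
  shows "\<exists>r. reduced (alt_word (Suc k) i j @ r) \<and> E (alt_word (Suc k) i j @ r) = E (i # u)"
  using assms
proof (induction k arbitrary: i j u v)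
  case 0
  then show ?case by (intro exI[of _ u]) simp
next
  case (Suc k)
  let ?a = "alt_word (Suc k) j i"
  have "enat (Suc k) \<le> M j i" using Suc.prems M_sym by (metis Suc_ile_eq less_imp_le)
  then obtain r where r: "reduced (?a @ r)" "E (?a @ r) = E (j # v)"
    using Suc.IH[of j i v u] Suc.prems by metis
  have uv: "u \<in> lists I" "v \<in> lists I"
    using reduced_lists[OF Suc.prems(4)] reduced_lists[OF Suc.prems(5)] by auto
  have al: "?a \<in> lists I" and rl: "r \<in> lists I" using reduced_lists[OF r(1)] by auto
  have len: "length (?a @ r) = length (i # u)"
    using reduced_length_eq[OF r(1) Suc.prems(4)] r(2) Suc.prems(6) by metis
  have nr: "\<not> reduced (i # ?a @ r)"
  proof
    assume n: "reduced (i # ?a @ r)"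
    have "E (i # ?a @ r) = E (i # i # u)" using r(2) Suc.prems(6) by (metis ev.simps(2))
    also have "\<dots> = E u" using ev_Cons_Cons Suc.prems(1) by blast
    finally show False using reduced_le[OF n uv(1)] len by simp
  qed
  then obtain a l b where ab: "?a @ r = a @ l # b" "E (i # ?a @ r) = E (a @ b)"
    using exchange_left[OF r(1) Suc.prems(1)] by blast
  have new: "reduced (i # a @ b)" "E (i # a @ b) = E (?a @ r)"
    using exchange_reduced[of a l b i] ab r Suc.prems by auto
  consider (1) c where "a = ?a @ c" "r = c @ l # b" | (2) c where "?a = a @ l # c" "b = c @ r"
    using ab(1) by (auto simp: append_eq_append_conv2 append_eq_Cons_conv simp del: alt_word.simps)
  then show ?case
  proof cases
    case 1
    then have "i # a @ b = alt_word (Suc (Suc k)) i j @ c @ b" by simp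
    then show ?thesis using new r(2) Suc.prems(6) by metis
  next
    case 2
    have "E ((i # ?a) @ r) = E ((a @ c) @ r)" using ab(2) unfolding 2(2)
      by (simp only: append_Cons append_assoc)
    then have eq: "E (i # ?a) = E (a @ c)" using ev_append_right_cancel rl by blast
    have "a @ c \<in> lists I" using al 2 by (metis append_in_lists_conv in_lists_conv_set list.set_intros(2))
    moreover have "reduced (i # ?a)"
      using reduced_alt_word[OF Suc.prems(1-3), of "Suc (Suc k)"] Suc.prems(7) by simp
    ultimately have "length (i # ?a) \<le> length (a @ c)" using reduced_le eq by metis
    moreover have "length ?a = length a + Suc (length c)"
      using arg_cong[OF 2(1), of length] by simp
    ultimately show ?thesis by simp
  qed
qed

section \<open>The Artin congruence, the Coxeter congruence and the action\<close>

lemma cox_cong_rev: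
  assumes "u \<in> lists I"
  shows "(u @ rev u, []) \<in> word_cong I (coxeter_rels I M)"
  using assms
proof (induction u rule: list.induct)
  case (Cons i u)
  let ?R = "word_cong I (coxeter_rels I M)"
  have i: "i \<in> I" "u \<in> lists I" using Cons by auto
  have "M i i = enat 1" using cox i by (auto simp: coxeter_matrix_def one_enat_def)
  then have "(concat (replicate 1 [i, i]), []) \<in> coxeter_rels I M"
    unfolding coxeter_rels_def using i by blast
  then have ii: "([i, i], []) \<in> ?R" using i by (intro word_cong.base) auto
  have "([i] @ (u @ rev u) @ [i], [i] @ [] @ [i]) \<in> ?R"
    using i Cons.IH by (intro word_cong.append word_cong.refl) auto
  then show ?case using word_cong.trans[OF _ ii] by simp
qed (auto intro: word_cong.refl)

lemma cox_cong_braid: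
  assumes "i \<in> I" "j \<in> I" "M i j = enat k"
  shows "(alt_word k i j, alt_word k j i) \<in> word_cong I (coxeter_rels I M)"
proof -
  let ?R = "word_cong I (coxeter_rels I M)"
  let ?a = "alt_word k i j" and ?b = "alt_word k j i"
  have ab: "?a \<in> lists I" "?b \<in> lists I"
    using alt_word_lists[OF assms(1,2)] alt_word_lists[OF assms(2,1)] by blast+
  have "(concat (replicate k [i, j]), []) \<in> coxeter_rels I M"
    using assms unfolding coxeter_rels_def by blast
  then have "(?a @ rev ?b, []) \<in> ?R"
    unfolding replicate_pair_alt_word using ab by (intro word_cong.base) auto
  then have 1: "((?a @ rev ?b) @ ?b, [] @ ?b) \<in> ?R"
    using ab by (intro word_cong.append word_cong.refl) auto
  have "(?a @ (rev ?b @ rev (rev ?b)), ?a @ []) \<in> ?R"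
    using ab cox_cong_rev[of "rev ?b"] by (intro word_cong.append word_cong.refl) auto
  then have 2: "(?a, ?a @ rev ?b @ ?b) \<in> ?R" by (simp add: word_cong.sym)
  show ?thesis using word_cong.trans[OF 2] 1 by simp
qed

lemma artin_cong_cox_cong:
  "(u, v) \<in> word_cong I (artin_rels I M) \<Longrightarrow> (u, v) \<in> word_cong I (coxeter_rels I M)"
proof (induction rule: word_cong.induct)
  case (base u v)
  then show ?case using cox_cong_braid unfolding artin_rels_def by auto
qed (auto intro: word_cong.refl word_cong.append dest: word_cong.sym word_cong.trans)

lemma cox_cong_ev:
  "(u, v) \<in> word_cong I (coxeter_rels I M) \<Longrightarrow> E u = E v"
proof (induction rule: word_cong.induct)
  case (base u v)
  then show ?case using rel unfolding coxeter_rels_def by (auto simp: ev_replicate_pair)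
qed (auto simp: ev_append)

lemma artin_cong_ev: "(u, v) \<in> word_cong I (artin_rels I M) \<Longrightarrow> E u = E v"
  using artin_cong_cox_cong cox_cong_ev by blast

text \<open>Words with equal first letter are handled by induction. If the first letters
  \<open>i\<close> and \<open>j\<close> differ, \<open>two_descents\<close> gives reduced words that
  begin with the two sides of the braid relation: \<open>u\<close> shares its first letter with one
  of them, \<open>v\<close> with the other, and one braid move joins them.\<close>

theorem matsumoto:
  assumes "reduced u" "reduced v" "E u = E v"
  shows "(u, v) \<in> word_cong I (artin_rels I M)"
  using assms
proof (induction "length u" arbitrary: u v)
  case 0
  then have "u = []" "v = []" using reduced_length_eq[OF 0(2,3,4)] by simp_all
  then show ?case by (simp add: word_cong.refl)
next
  case (Suc n)
  let ?R = "word_cong I (artin_rels I M)"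
  have same: "(i # x, i # y) \<in> ?R"
    if "reduced (i # x)" "reduced (i # y)" "E (i # x) = E (i # y)" "length x = n" for i x y
  proof -
    have i: "[i] \<in> lists I" using reduced_lists[OF that(1)] by simp
    then have "E x = E y" using that(3) ev_append_left_cancel[of "[i]" x y] by simp
    then have "(x, y) \<in> ?R" using Suc.hyps(1)[of x y] that reduced_ConsD by auto
    then have "([i] @ x, [i] @ y) \<in> ?R" by (intro word_cong.append word_cong.refl i)
    then show ?thesis by simp
  qed
  have len: "length v = Suc n" using reduced_length_eq[OF Suc.prems] Suc.hyps(2) by simp
  obtain i x j y where uv: "u = i # x" "v = j # y"
    using Suc.hyps(2) len by (metis Suc_length_conv)
  have ij: "i \<in> I" "j \<in> I" using uv Suc.prems reduced_lists by auto
  show ?case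
  proof (cases "i = j")
    case True
    then show ?thesis using same uv Suc by auto
  next
    case False
    obtain k where k: "M i j = enat k" using M_fin ij by blast
    have "2 \<le> M i j" using cox ij False by (auto simp: coxeter_matrix_def)
    then obtain k' where k': "k = Suc k'" using k by (cases k) (auto simp: numeral_eq_enat)
    obtain r where r: "reduced (alt_word k i j @ r)" "E (alt_word k i j @ r) = E u"
      using two_descents[OF ij False, of x y k'] Suc.prems uv k k' by auto
    have rl: "r \<in> lists I" using reduced_lists[OF r(1)] by simp
    have al: "alt_word k j i \<in> lists I" using alt_word_lists ij by metis
    have "(alt_word k i j, alt_word k j i) \<in> ?R"
      using k ij False alt_word_lists[OF ij, of k] al
      by (intro word_cong.base) (simp only: artin_rels_def mem_Collect_eq, blast, assumption+)
    then have br: "(alt_word k i j @ r, alt_word k j i @ r) \<in> ?R"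
      by (intro word_cong.append word_cong.refl rl)
    then have eq: "E (alt_word k j i @ r) = E (alt_word k i j @ r)" using artin_cong_ev by metis
    have r': "reduced (alt_word k j i @ r)"
      using reduced_transfer[OF r(1) _ eq] al rl by simp
    have "length (alt_word k i j @ r) = length u"
      using reduced_length_eq[OF r(1) Suc.prems(1) r(2)] .
    then have len2: "length (alt_word k' j i @ r) = n" "length x = n" "length y = n"
      using k' Suc.hyps(2) uv len by auto
    have 1: "(u, alt_word k i j @ r) \<in> ?R"
      using same[of i x "alt_word k' j i @ r"] r Suc.prems(1) uv k' len2(2)
      by (simp del: ev.simps)
    have 2: "(v, alt_word k j i @ r) \<in> ?R"
      using same[of j y "alt_word k' i j @ r"] r r' eq Suc.prems(2,3) uv k' len2(3)
      by (simp del: ev.simps)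
    show ?thesis using word_cong.trans[OF 1 word_cong.trans[OF br word_cong.sym[OF 2]]] .
  qed
qed

text \<open>If \<open>i # r\<close> is not reduced, Matsumoto's theorem rewrites \<open>r\<close> so
  that it starts with \<open>i\<close>, and then \<open>i i\<close> cancels. Only defining relations
  are used.\<close>

lemma cox_cong_reduced:
  assumes "u \<in> lists I"
  shows "\<exists>r. reduced r \<and> (u, r) \<in> word_cong I (coxeter_rels I M)"
  using assms
proof (induction u rule: list.induct)
  case Nil
  then show ?case using reduced_Nil word_cong.refl by blast
next
  case (Cons i u)
  let ?R = "word_cong I (coxeter_rels I M)"
  obtain r where r: "reduced r" "(u, r) \<in> ?R" using Cons by auto
  have i: "i \<in> I" "[i] \<in> lists I" using Cons by auto
  have "([i] @ u, [i] @ r) \<in> ?R" by (intro word_cong.append word_cong.refl r i)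
  then have ir: "(i # u, i # r) \<in> ?R" by simp
  show ?case
  proof (cases "reduced (i # r)")
    case True
    then show ?thesis using ir by blast
  next
    case False
    then obtain a j b where ab: "r = a @ j # b" "E (i # r) = E (a @ b)"
      using exchange_left r i by blast
    have new: "reduced (i # a @ b)" "E (i # a @ b) = E r"
      using exchange_reduced[of a j b i] ab r i by auto
    have "(r, i # a @ b) \<in> ?R" using matsumoto[of r "i # a @ b"] new r artin_cong_cox_cong by auto
    then have "([i] @ r, [i] @ i # a @ b) \<in> ?R" by (intro word_cong.append word_cong.refl i)
    moreover have "(([i] @ rev [i]) @ a @ b, [] @ a @ b) \<in> ?R"
      using reduced_lists[OF new(1)]
      by (intro word_cong.append word_cong.refl cox_cong_rev) auto
    ultimately have "(i # r, a @ b) \<in> ?R" by (auto dest: word_cong.trans)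
    then have "(i # u, a @ b) \<in> ?R" by (rule word_cong.trans[OF ir])
    then show ?thesis using reduced_ConsD[OF new(1)] by blast
  qed
qed

text \<open>Faithfulness: both words are congruent to reduced ones, and these are linked by braid
  moves once their permutations agree.\<close>

lemma cox_cong_iff:
  "(u, v) \<in> word_cong I (coxeter_rels I M) \<longleftrightarrow> u \<in> lists I \<and> v \<in> lists I \<and> E u = E v"
proof
  assume "(u, v) \<in> word_cong I (coxeter_rels I M)"
  then show "u \<in> lists I \<and> v \<in> lists I \<and> E u = E v"
    using word_cong_lists cox_cong_ev by metis
next
  let ?R = "word_cong I (coxeter_rels I M)"
  assume uv: "u \<in> lists I \<and> v \<in> lists I \<and> E u = E v"
  then obtain r t where r: "reduced r" "(u, r) \<in> ?R" and t: "reduced t" "(v, t) \<in> ?R"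
    using cox_cong_reduced by metis
  have "E r = E t" using uv cox_cong_ev r t by metis
  then have "(r, t) \<in> ?R" using matsumoto r t artin_cong_cox_cong by blast
  then show "(u, v) \<in> ?R" using r(2) t(2) word_cong.trans word_cong.sym by metis
qed

section \<open>Lengths, parabolic subgroups and longest elements of the presented group\<close>

lemma s_word_eq_iff:
  "u \<in> lists I \<Longrightarrow> v \<in> lists I \<Longrightarrow> s_word I M u = s_word I M v \<longleftrightarrow> E u = E v"
  unfolding s_word_def by (simp add: word_class_eq_iff cox_cong_iff)

lemma s_word_mult:
  "u \<in> lists I \<Longrightarrow> v \<in> lists I
    \<Longrightarrow> s_word I M u \<otimes>\<^bsub>coxeter_group I M\<^esub> s_word I M v = s_word I M (u @ v)"
  unfolding s_word_def coxeter_group_def by (rule word_class_mult)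

lemma T_word_eq_iff:
  "u \<in> lists I \<Longrightarrow> v \<in> lists I
    \<Longrightarrow> T_word I M u = T_word I M v \<longleftrightarrow> (u, v) \<in> word_cong I (artin_rels I M)"
  unfolding T_word_def by (rule word_class_eq_iff)

lemma finite_type: "finite_type I M"
proof -
  define h where "h g = {v \<in> lists I. E v = g}" for g
  have "carrier (coxeter_group I M) \<subseteq> h ` (E ` lists I)"
  proof
    fix X assume "X \<in> carrier (coxeter_group I M)"
    then obtain u where u: "u \<in> lists I" "X = word_cong I (coxeter_rels I M) `` {u}"
      unfolding coxeter_group_def by (rule presented_monoid_carrierE)
    then have "X = h (E u)" unfolding h_def using cox_cong_iff by auto
    then show "X \<in> h ` (E ` lists I)" using u by blast
  qed
  then show ?thesis unfolding finite_type_def using fin finite_subset by blast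
qed

lemma cox_length_s_word:
  assumes "reduced u"
  shows "cox_length I M (s_word I M u) = length u"
  unfolding cox_length_def
proof (rule Least_equality)
  show "\<exists>v\<in>lists I. s_word I M v = s_word I M u \<and> length v = length u"
    using assms reduced_lists by blast
  fix k assume "\<exists>v\<in>lists I. s_word I M v = s_word I M u \<and> length v = k"
  then show "length u \<le> k"
    using assms s_word_eq_iff reduced_lists reduced_le by metis
qed

lemma reduced_expression_iff:
  assumes "reduced u"
  shows "reduced_expression I M v (s_word I M u) \<longleftrightarrow> reduced v \<and> E v = E u"
proof -
  have u: "u \<in> lists I" using assms reduced_lists by blast
  show ?thesis
  proof
    assume "reduced_expression I M v (s_word I M u)"
    then have "v \<in> lists I" "E v = E u" "length v = length u"
      unfolding reduced_expression_def cox_length_s_word[OF assms] using u s_word_eq_iff by blast+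
    then show "reduced v \<and> E v = E u" using reduced_transfer[OF assms, of v] by linarith
  next
    assume v: "reduced v \<and> E v = E u"
    then have "v \<in> lists I" "length v = length u"
      using reduced_lists reduced_length_eq assms by blast+
    then show "reduced_expression I M v (s_word I M u)"
      unfolding reduced_expression_def cox_length_s_word[OF assms] using u v s_word_eq_iff by blast
  qed
qed

lemma T_elem_s_word:
  assumes "reduced u"
  shows "T_elem I M (s_word I M u) = T_word I M u"
proof -
  have "reduced_expression I M (SOME v. reduced_expression I M v (s_word I M u)) (s_word I M u)"
    by (rule someI[of _ u]) (use assms reduced_expression_iff in blast)
  then show ?thesis
    unfolding T_elem_def using reduced_expression_iff[OF assms] matsumoto assms T_word_eq_iff reduced_lists
    by metis
qed

lemma coxeter_group_monoid: "monoid (coxeter_group I M)"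
  unfolding coxeter_group_def by (rule presented_monoid_monoid)

text \<open>\<open>generate\<close> also adjoins inverses of the generators, but these are
  involutions, so words over \<open>K\<close> exhaust the subgroup.\<close>

lemma parabolic_subgroup_eq:
  assumes "K \<subseteq> I"
  shows "parabolic_subgroup I M K = s_word I M ` lists K"
proof
  interpret G: monoid "coxeter_group I M" by (rule coxeter_group_monoid)
  have one: "\<one>\<^bsub>coxeter_group I M\<^esub> = s_word I M []"
    unfolding coxeter_group_def s_word_def by (rule presented_monoid_one)
  have inv: "inv\<^bsub>coxeter_group I M\<^esub> (s_word I M [k]) = s_word I M [k]" if "k \<in> K" for k
  proof (rule G.inv_unique'[symmetric])
    have k: "[k] \<in> lists I" using that assms by auto
    show "s_word I M [k] \<in> carrier (coxeter_group I M)"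
      "s_word I M [k] \<in> carrier (coxeter_group I M)"
      unfolding s_word_def coxeter_group_def using k by (rule word_class_closed)+
    have "s_word I M [k, k] = s_word I M []" using s_word_eq_iff[of "[k, k]" "[]"] k invol by auto
    then show "s_word I M [k] \<otimes>\<^bsub>coxeter_group I M\<^esub> s_word I M [k] = \<one>\<^bsub>coxeter_group I M\<^esub>"
      "s_word I M [k] \<otimes>\<^bsub>coxeter_group I M\<^esub> s_word I M [k] = \<one>\<^bsub>coxeter_group I M\<^esub>"
      using s_word_mult[OF k k] one by auto
  qed
  show "parabolic_subgroup I M K \<subseteq> s_word I M ` lists K"
  proof
    fix x assume "x \<in> parabolic_subgroup I M K"
    then show "x \<in> s_word I M ` lists K"
      unfolding parabolic_subgroup_def
    proof (induction rule: generate.induct)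
      case one
      then show ?case using \<open>\<one>\<^bsub>coxeter_group I M\<^esub> = s_word I M []\<close> by auto
    next
      case (incl h)
      then show ?case by (auto intro!: imageI)
    next
      case (inv h)
      then show ?case using \<open>\<And>k. k \<in> K \<Longrightarrow> inv\<^bsub>coxeter_group I M\<^esub> (s_word I M [k]) = s_word I M [k]\<close>
        by (auto intro!: imageI)
    next
      case (eng h1 h2)
      then obtain u v where "u \<in> lists K" "v \<in> lists K" "h1 = s_word I M u" "h2 = s_word I M v"
        by auto
      moreover have "u \<in> lists I" "v \<in> lists I" using calculation assms by auto
      ultimately show ?case using s_word_mult[of u v] by (auto intro!: imageI)
    qed
  qed
  show "s_word I M ` lists K \<subseteq> parabolic_subgroup I M K"
  proof
    fix x assume "x \<in> s_word I M ` lists K"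
    then obtain u where u: "u \<in> lists K" "x = s_word I M u" by auto
    have "s_word I M u \<in> parabolic_subgroup I M K" using u(1)
    proof (induction u rule: list.induct)
      case Nil
      then show ?case unfolding parabolic_subgroup_def using one generate.one by metis
    next
      case (Cons k u)
      have "s_word I M (k # u) = s_word I M [k] \<otimes>\<^bsub>coxeter_group I M\<^esub> s_word I M u"
        using Cons assms s_word_mult[of "[k]" u] by auto
      then show ?case
        using Cons unfolding parabolic_subgroup_def
        by (metis (no_types, lifting) generate.eng generate.incl imageI in_lists_conv_set
            list.set_intros list.set_intros(2))
    qed
    then show "x \<in> parabolic_subgroup I M K" using u by simp
  qed
qed

text \<open>Uniqueness for \<open>THE\<close>: a competitor has a reduced word over \<open>K\<close>
  at least as long as \<open>u\<close>, and \<open>longest_length\<close> identifies the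
  two.\<close>

lemma longest_element_eq:
  assumes "K \<subseteq> I" "longest K u"
  shows "longest_element I M K = s_word I M u"
  unfolding longest_element_def parabolic_subgroup_eq[OF assms(1)]
proof (rule the_equality)
  have u: "u \<in> lists K" "reduced u" using assms(2) unfolding longest_def by auto
  have red: "\<exists>r\<in>lists K. reduced r \<and> x = s_word I M r" if "x \<in> s_word I M ` lists K" for x
  proof -
    obtain v where v: "v \<in> lists K" "x = s_word I M v" using \<open>x \<in> s_word I M ` lists K\<close> by auto
    obtain r where "r \<in> lists K" "reduced r" "E r = E v"
      using exists_reduced_in[OF assms(1) v(1)] by auto
    moreover have "v \<in> lists I" "r \<in> lists I" using v calculation assms by auto
    ultimately show ?thesis using v s_word_eq_iff by metis
  qed
  have mx: "cox_length I M x \<le> cox_length I M (s_word I M u)" if x: "x \<in> s_word I M ` lists K" for x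
  proof -
    obtain r where r: "r \<in> lists K" "reduced r" "x = s_word I M r" using red[OF x] by blast
    show ?thesis
      unfolding r(3) cox_length_s_word[OF r(2)] cox_length_s_word[OF u(2)]
      by (rule longest_length(1)[OF assms r(1,2)])
  qed
  show "s_word I M u \<in> s_word I M ` lists K \<and>
    (\<forall>v\<in>s_word I M ` lists K. cox_length I M v \<le> cox_length I M (s_word I M u))"
    by (intro conjI ballI imageI u(1) mx)
  fix w assume w: "w \<in> s_word I M ` lists K \<and>
    (\<forall>v\<in>s_word I M ` lists K. cox_length I M v \<le> cox_length I M w)"
  obtain r where r: "r \<in> lists K" "reduced r" "w = s_word I M r"
    using red[OF conjunct1[OF w]] by blast
  have "cox_length I M (s_word I M u) \<le> cox_length I M w"
    by (rule bspec[OF conjunct2[OF w] imageI[OF u(1)]])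
  then have "length u \<le> length r"
    unfolding r(3) cox_length_s_word[OF r(2)] cox_length_s_word[OF u(2)] .
  then have "E r = E u" using longest_length[OF assms r(1,2)] by simp
  then show "w = s_word I M u"
    using r(3) s_word_eq_iff[OF reduced_lists[OF r(2)] reduced_lists[OF u(2)]] by simp
qed

lemma w_rel_eq:
  assumes "J \<subseteq> I" "longest J u" "K \<subseteq> I" "longest K v"
  shows "w_rel I M J K = s_word I M (u @ v)"
  unfolding w_rel_def longest_element_eq[OF assms(1,2)] longest_element_eq[OF assms(3,4)]
  using assms reduced_lists unfolding longest_def by (intro s_word_mult) blast+

section \<open>Inversions\<close>

definition inversions :: "('p \<Rightarrow> 'p) \<Rightarrow> 'p set" where
  "inversions g = {p \<in> pos. g p \<notin> pos}"

text \<open>The new letter acts first: it inverts \<open>D i\<close>, which \<open>u\<close> cannot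
  make positive again as \<open>u @ [i]\<close> is reduced, and it transports the old
  inversions.\<close>

lemma inversions_snoc:
  assumes "reduced (u @ [i])"
  shows "inversions (E (u @ [i])) = D i \<union> s i ` inversions (E u)"
    and "D i \<inter> s i ` inversions (E u) = {}"
proof -
  have u: "u \<in> lists I" and i: "i \<in> I" using reduced_lists[OF assms] by auto
  have ss: "s i (s i p) = p" for p using invol[OF i] by (metis comp_apply id_apply)
  have Dp: "E u p \<in> pos" if p: "p \<in> D i" for p
  proof (rule ccontr)
    assume "E u p \<notin> pos"
    then obtain a j b where "u = a @ j # b" "E (u @ [i]) = E (a @ b)"
      using exchange_right[OF u i p] by blast
    then show False using reduced_le[OF assms, of "a @ b"] u by auto
  qed
  show "D i \<inter> s i ` inversions (E u) = {}"
  proof -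
    have False if "q \<in> inversions (E u)" "s i q \<in> D i" for q
      using D_neg[OF i that(2)] that(1) ss by (simp add: inversions_def)
    then show ?thesis by blast
  qed
  show "inversions (E (u @ [i])) = D i \<union> s i ` inversions (E u)"
  proof (intro equalityI subsetI)
    fix p assume p: "p \<in> inversions (E (u @ [i]))"
    show "p \<in> D i \<union> s i ` inversions (E u)"
    proof (cases "p \<in> D i")
      case False
      then have "s i p \<in> inversions (E u)"
        using p pos_D[OF i] by (simp add: inversions_def ev_append)
      then show ?thesis using ss[of p] by (metis UnI2 imageI)
    qed simp
  next
    fix p assume "p \<in> D i \<union> s i ` inversions (E u)"
    then consider "p \<in> D i" | q where "q \<in> inversions (E u)" "p = s i q" by blast
    then show "p \<in> inversions (E (u @ [i]))"
    proof cases
      case 1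
      then show ?thesis using D_pos[OF i 1] opp[OF i 1 u Dp[OF 1]] by (simp add: inversions_def ev_append)
    next
      case 2
      then have "q \<notin> D i" using Dp by (auto simp: inversions_def)
      then show ?thesis using 2 pos_D[OF i] ss by (simp add: inversions_def ev_append)
    qed
  qed
qed

text \<open>The weight stays free for two reasons: roots of type B have one or two representatives,
  and blowing up points to blocks changes the weight of an inversion.\<close>

lemma sum_inversions:
  fixes wt :: "'p \<Rightarrow> nat"
  assumes "reduced u" "\<And>i. i \<in> I \<Longrightarrow> finite (D i)" "\<And>i p. i \<in> I \<Longrightarrow> wt (s i p) = wt p"
  shows "finite (inversions (E u)) \<and> sum wt (inversions (E u)) = (\<Sum>i\<leftarrow>u. sum wt (D i))"
  using assms(1)
proof (induction u rule: rev_induct)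
  case Nil
  then show ?case by (simp add: inversions_def)
next
  case (snoc i u)
  have i: "i \<in> I" using reduced_lists[OF snoc.prems] by simp
  have IH: "finite (inversions (E u))" "sum wt (inversions (E u)) = (\<Sum>i\<leftarrow>u. sum wt (D i))"
    using snoc.IH reduced_appendD(1)[OF snoc.prems] by auto
  have "inj_on (s i) (inversions (E u))"
    by (rule inj_on_inverseI[of _ "s i"]) (use invol[OF i] in \<open>metis comp_apply id_apply\<close>)
  then have "sum wt (s i ` inversions (E u)) = sum wt (inversions (E u))"
    by (simp add: sum.reindex assms(3)[OF i])
  then show ?case
    using IH assms(2)[OF i] inversions_snoc[OF snoc.prems]
    by (simp add: sum.union_disjoint)
qed

end

section \<open>A criterion for strict parabolic homomorphisms\<close>

lemma concat_map_lists:
  "(\<And>j. j \<in> A \<Longrightarrow> f j \<in> lists B) \<Longrightarrow> u \<in> lists A \<Longrightarrow> concat (map f u) \<in> lists B"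
  by (induction u) auto

text \<open>The assumption \<open>braid\<close> concerns permutations only; its lift to the Artin
  monoid is a conclusion, \<open>artin_cong_F_cong\<close>. \<open>odd_length\<close> makes both
  sides of a braid relation equally long; for even \<open>k\<close> this is automatic.
  \<open>f_neg\<close> says that all letters of \<open>u0 @ f j\<close> are descents of it, and
  \<open>v0\<close> is a reduced word of the longest element of the domain.\<close>

locale parabolic_map =
  H: coxeter_roots I' M' s' pos' D' \<alpha>' + C: coxeter_roots I M s pos D \<alpha>
  for I' :: "'j set" and M' s' and pos' :: "'q set" and D' \<alpha>'
    and I :: "'i set" and M s and pos :: "'p set" and D \<alpha> +
  fixes f :: "'j \<Rightarrow> 'i list" and u0 :: "'i list" and v0 :: "'j list"
  assumes f_lists: "\<And>j. j \<in> I' \<Longrightarrow> f j \<in> lists I"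
    and u0_reduced: "C.reduced u0"
    and u0_neg: "\<And>k. k \<in> set u0 \<Longrightarrow> ev s u0 (\<alpha> k) \<notin> pos"
    and f_neg: "\<And>j k. j \<in> I' \<Longrightarrow> k \<in> set u0 \<union> set (f j) \<Longrightarrow> ev s (u0 @ f j) (\<alpha> k) \<notin> pos"
    and braid: "\<And>i j k. i \<in> I' \<Longrightarrow> j \<in> I' \<Longrightarrow> i \<noteq> j \<Longrightarrow> M' i j = enat k \<Longrightarrow>
      ev s (concat (map f (alt_word k i j))) = ev s (concat (map f (alt_word k j i)))"
    and odd_length: "\<And>i j k. i \<in> I' \<Longrightarrow> j \<in> I' \<Longrightarrow> i \<noteq> j \<Longrightarrow> M' i j = enat k \<Longrightarrow> odd k \<Longrightarrow>
      length (f i) = length (f j)"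
    and v0_reduced: "H.reduced v0"
    and v0_neg: "\<And>j. j \<in> I' \<Longrightarrow> ev s' v0 (\<alpha>' j) \<notin> pos'"
    and fv0_reduced: "C.reduced (concat (map f v0))"
    and fv0_neg: "\<And>k. k \<in> I \<Longrightarrow> ev s (u0 @ concat (map f v0)) (\<alpha> k) \<notin> pos"
    and support: "\<And>k. k \<in> I \<Longrightarrow> \<exists>j\<in>I'. k \<in> set (f j)"
begin

abbreviation "F u \<equiv> concat (map f u)"

lemma F_lists: "u \<in> lists I' \<Longrightarrow> F u \<in> lists I"
  by (rule concat_map_lists[OF f_lists])

lemma F_alt_length: "length (F (alt_word k i j)) = (Suc k div 2) * length (f i) + (k div 2) * length (f j)"
  by (induction k arbitrary: i j) (auto simp: algebra_simps)

text \<open>A provisional invariance, available before anything is known to be reduced. It allows to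
  replace \<open>v0\<close> by any reduced word of the same element.\<close>

lemma artin_cong_F:
  assumes "(u, v) \<in> word_cong I' (artin_rels I' M')"
  shows "length (F u) = length (F v) \<and> C.E (F u) = C.E (F v)"
  using assms
proof (induction rule: word_cong.induct)
  case (base u v)
  then obtain i j k where *: "i \<in> I'" "j \<in> I'" "i \<noteq> j" "M' i j = enat k"
    "u = alt_word k i j" "v = alt_word k j i"
    unfolding artin_rels_def by blast
  have "length (F u) = length (F v)"
  proof (cases "even k")
    case True
    then have "Suc k div 2 = k div 2" by simp
    then show ?thesis unfolding * F_alt_length by simp
  next
    case False
    then show ?thesis unfolding * F_alt_length using odd_length[OF *(1-4)] by simp
  qed
  then show ?case using braid[OF *(1-4)] * by blast
qed (auto simp: ev_append)

lemma u0_lists: "u0 \<in> lists I"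
  using C.reduced_lists u0_reduced .

lemma v0_longest: "H.longest I' v0"
  using H.longestI[OF order_refl H.reduced_lists v0_reduced v0_neg] v0_reduced by blast

text \<open>The product represents the longest element, which has a reduced word
  \<open>u0 @ r\<close>. Here \<open>r\<close> and \<open>F v0\<close> are reduced words of one
  element, hence equally long.\<close>

lemma u0v0_reduced: "C.reduced (u0 @ F v0)"
proof -
  have l: "u0 @ F v0 \<in> lists I"
    using u0_lists C.reduced_lists[OF fv0_reduced] by simp
  obtain w where w: "w \<in> lists I" "C.reduced w" "C.E w = C.E (u0 @ F v0)"
    using C.exists_reduced_in[OF order_refl l] by blast
  have "C.longest I w"
    using C.longestI[OF order_refl w(1,2)] w(3) fv0_neg by simp
  then obtain r where r: "C.reduced (u0 @ r)" "C.E (u0 @ r) = C.E w"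
    using C.longest_extends[OF order_refl _ u0_lists u0_reduced] by blast
  have "C.E r = C.E (F v0)" using r(2) w(3) C.ev_append_left_cancel[OF u0_lists] by simp
  then have "length r = length (F v0)"
    using C.reduced_length_eq[OF C.reduced_appendD(2)[OF r(1)] fv0_reduced] by blast
  then show ?thesis using C.reduced_transfer[OF r(1) l] r w by simp
qed

lemma u0_longest_word:
  assumes "H.reduced v" "H.E v = H.E v0"
  shows "C.longest I (u0 @ F v)"
proof -
  have "(v, v0) \<in> word_cong I' (artin_rels I' M')" using H.matsumoto assms v0_reduced by blast
  then have eq: "length (F v) = length (F v0)" "C.E (F v) = C.E (F v0)" using artin_cong_F by auto
  have l: "u0 @ F v \<in> lists I" using u0_lists F_lists[OF H.reduced_lists[OF assms(1)]] by simp
  have e: "C.E (u0 @ F v) = C.E (u0 @ F v0)" using eq by (simp add: ev_append)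
  have "C.reduced (u0 @ F v)" using C.reduced_transfer[OF u0v0_reduced l e] eq by simp
  then show ?thesis using C.longestI[OF order_refl l] e fv0_neg by simp
qed

lemma u0_F_reduced:
  assumes "H.reduced u"
  shows "C.reduced (u0 @ F u)"
proof -
  obtain r where r: "H.reduced (u @ r)" "H.E (u @ r) = H.E v0"
    using H.longest_extends[OF order_refl v0_longest H.reduced_lists[OF assms] assms] by blast
  have "C.reduced (u0 @ F (u @ r))" using u0_longest_word[OF r] unfolding C.longest_def by blast
  then show ?thesis using C.reduced_appendD(1)[of "u0 @ F u" "F r"] by simp
qed

lemma F_reduced: "H.reduced u \<Longrightarrow> C.reduced (F u)"
  using u0_F_reduced C.reduced_appendD(2) by blast

text \<open>Both sides of a braid relation are reduced, so are their images by
  \<open>F_reduced\<close>; as these have equal permutations, Matsumoto's theorem applies.\<close>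

lemma artin_cong_F_cong:
  assumes "(u, v) \<in> word_cong I' (artin_rels I' M')"
  shows "(F u, F v) \<in> word_cong I (artin_rels I M)"
  using assms
proof (induction rule: word_cong.induct)
  case (base u v)
  then obtain i j k where *: "i \<in> I'" "j \<in> I'" "i \<noteq> j" "M' i j = enat k"
    "u = alt_word k i j" "v = alt_word k j i"
    unfolding artin_rels_def by blast
  have "H.reduced u" "H.reduced v"
    unfolding *(5,6) using H.reduced_alt_word[of i j k] H.reduced_alt_word[of j i k] H.M_sym * by auto
  then show ?case using C.matsumoto[OF F_reduced F_reduced] braid[OF *(1-4)] * by blast
next
  case (refl u)
  then show ?case by (intro word_cong.refl F_lists)
qed (auto intro: word_cong.append word_cong.sym word_cong.trans)

section \<open>The induced homomorphism and its strict parabolicity\<close>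

definition \<Phi> :: "'j list set \<Rightarrow> 'i list set" where
  "\<Phi> X = T_word I M (F (SOME u. u \<in> X))"

lemma \<Phi>_T_word:
  assumes "u \<in> lists I'"
  shows "\<Phi> (T_word I' M' u) = T_word I M (F u)"
proof -
  define v where "v = (SOME v. v \<in> T_word I' M' u)"
  have "v \<in> T_word I' M' u"
    unfolding v_def by (rule someI[of _ u]) (simp add: T_word_def word_cong.refl assms del: in_lists_conv_set)
  then have "(u, v) \<in> word_cong I' (artin_rels I' M')" by (simp add: T_word_def)
  then have "(F v, F u) \<in> word_cong I (artin_rels I M)"
    using artin_cong_F_cong word_cong.sym by metis
  then have "T_word I M (F v) = T_word I M (F u)"
    using C.T_word_eq_iff word_cong_lists by metis
  then show ?thesis unfolding \<Phi>_def v_def .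
qed

lemma \<Phi>_hom: "\<Phi> \<in> monoid_hom (artin_monoid I' M') (artin_monoid I M)"
  unfolding monoid_hom_def hom_def
proof (intro CollectI conjI ballI funcsetI)
  fix X assume "X \<in> carrier (artin_monoid I' M')"
  then obtain u where u: "u \<in> lists I'" "X = T_word I' M' u"
    unfolding artin_monoid_def T_word_def by (rule presented_monoid_carrierE)
  show "\<Phi> X \<in> carrier (artin_monoid I M)"
    unfolding u(2) \<Phi>_T_word[OF u(1)] unfolding artin_monoid_def T_word_def
    by (rule word_class_closed[OF F_lists[OF u(1)]])
  fix Y assume "Y \<in> carrier (artin_monoid I' M')"
  then obtain v where v: "v \<in> lists I'" "Y = T_word I' M' v"
    unfolding artin_monoid_def T_word_def by (rule presented_monoid_carrierE)
  have uv: "u @ v \<in> lists I'" using u v by simp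
  have "X \<otimes>\<^bsub>artin_monoid I' M'\<^esub> Y = T_word I' M' (u @ v)"
    unfolding u(2) v(2) unfolding artin_monoid_def T_word_def by (rule word_class_mult[OF u(1) v(1)])
  moreover have "\<Phi> X \<otimes>\<^bsub>artin_monoid I M\<^esub> \<Phi> Y = T_word I M (F u @ F v)"
    unfolding u(2) v(2) \<Phi>_T_word[OF u(1)] \<Phi>_T_word[OF v(1)]
    unfolding artin_monoid_def T_word_def by (rule word_class_mult[OF F_lists[OF u(1)] F_lists[OF v(1)]])
  ultimately show "\<Phi> (X \<otimes>\<^bsub>artin_monoid I' M'\<^esub> Y) = \<Phi> X \<otimes>\<^bsub>artin_monoid I M\<^esub> \<Phi> Y"
    using \<Phi>_T_word[OF uv] by simp
next
  have "\<one>\<^bsub>artin_monoid I' M'\<^esub> = T_word I' M' []" "\<one>\<^bsub>artin_monoid I M\<^esub> = T_word I M []"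
    unfolding artin_monoid_def T_word_def by (rule presented_monoid_one)+
  then show "\<Phi> \<one>\<^bsub>artin_monoid I' M'\<^esub> = \<one>\<^bsub>artin_monoid I M\<^esub>"
    using \<Phi>_T_word[of "[]"] by simp
qed

lemma hom_support_eq: "hom_support I' M' I M \<Phi> = I"
proof -
  have "\<exists>j\<in>I'. \<exists>u\<in>lists I. T_word I M u = \<Phi> (T_word I' M' [j]) \<and> i \<in> set u" if "i \<in> I" for i
  proof -
    obtain j where j: "j \<in> I'" "i \<in> set (f j)" using support \<open>i \<in> I\<close> by blast
    then have "T_word I M (f j) = \<Phi> (T_word I' M' [j])" using \<Phi>_T_word[of "[j]"] by simp
    then show ?thesis using j f_lists by blast
  qed
  then show ?thesis unfolding hom_support_def by blast
qed

text \<open>For \<open>j\<close> in \<open>J'\<close> the element \<open>u\<close> has a reduced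
  word starting with \<open>j\<close>, so \<open>u0 @ F u\<close> may be rewritten with prefix
  \<open>u0 @ f j\<close>. That prefix is longest for its own letters, and a descent of a prefix of
  a reduced word is a descent of the whole.\<close>

lemma longest_image:
  assumes "J' \<subseteq> I'" "H.longest J' u"
  shows "C.longest (set u0 \<union> (\<Union>j\<in>J'. set (f j))) (u0 @ F u)"
proof -
  let ?y = "u0 @ F u"
  have u: "u \<in> lists J'" "H.reduced u" using assms(2) unfolding H.longest_def by auto
  have y: "C.reduced ?y" using u0_F_reduced u(2) .
  have yl: "?y \<in> lists I" by (rule C.reduced_lists[OF y])
  have neg: "\<not> C.reduced (k # ?y)" if k: "k \<in> set x" and kx: "\<And>k. k \<in> set x \<Longrightarrow> C.E x (\<alpha> k) \<notin> pos"
    and xz: "C.reduced (x @ z)" "C.E (x @ z) = C.E ?y" for k x z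
  proof
    assume r: "C.reduced (k # ?y)"
    have x: "C.reduced x" "x \<in> lists I"
      using C.reduced_appendD(1)[OF xz(1)] C.reduced_lists by blast+
    have "C.longest (set x) x" using x kx by (intro C.longestI) auto
    then have nr: "\<not> C.reduced (k # x)" using k unfolding C.longest_def by blast
    have len: "length (x @ z) = length ?y" by (rule C.reduced_length_eq[OF xz(1) y xz(2)])
    have "k \<in> I" using k x(2) by auto
    then have "C.reduced ((k # x) @ z)"
      using C.reduced_transfer[OF r, of "(k # x) @ z"] C.reduced_lists[OF xz(1)] xz(2) len
      by (simp add: ev_append)
    then show False using nr C.reduced_appendD(1) by blast
  qed
  have "\<not> C.reduced (k # ?y)" if k: "k \<in> set u0 \<union> (\<Union>j\<in>J'. set (f j))" for k
  proof (cases "k \<in> set u0")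
    case True
    then show ?thesis using neg[of k u0 "F u"] u0_neg y by blast
  next
    case False
    then obtain j where j: "j \<in> J'" "k \<in> set (f j)" using k by blast
    have jI: "j \<in> I'" using j assms(1) by blast
    have "H.reduced [j]" by (rule H.reduced_singleton[OF jI])
    then obtain r where r: "H.reduced ([j] @ r)" "H.E ([j] @ r) = H.E u"
      using H.longest_extends[OF assms, of "[j]"] j(1) by auto
    have "((j # r), u) \<in> word_cong I' (artin_rels I' M')"
      using H.matsumoto[OF r(1) u(2) r(2)] by simp
    then have "C.E (F (j # r)) = C.E (F u)" using artin_cong_F by blast
    then have "C.E ((u0 @ f j) @ F r) = C.E ?y" by (simp add: ev_append)
    moreover have "C.reduced ((u0 @ f j) @ F r)" using u0_F_reduced[OF r(1)] by simp
    moreover have "k \<in> set (u0 @ f j)" using j by simp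
    moreover have "C.E (u0 @ f j) (\<alpha> k) \<notin> pos" if "k \<in> set (u0 @ f j)" for k
      using f_neg[OF jI] that by simp
    ultimately show ?thesis using neg[of k "u0 @ f j" "F r"] by blast
  qed
  moreover have "?y \<in> lists (set u0 \<union> (\<Union>j\<in>J'. set (f j)))"
    using u(1) by auto
  ultimately show ?thesis using y unfolding C.longest_def by blast
qed

theorem strict_parabolic_\<Phi>: "strict_parabolic I' M' I M \<Phi>"
  unfolding strict_parabolic_def hom_support_eq
proof (intro conjI allI impI)
  show "coxeter_matrix I' M'" "coxeter_matrix I M" using H.cox C.cox by auto
  show "finite_type I' M'" "finite_type I M" by (rule H.finite_type C.finite_type)+
  show "\<Phi> \<in> monoid_hom (artin_monoid I' M') (artin_monoid I M)" by (rule \<Phi>_hom)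
  fix J' assume J': "J' \<subseteq> I'"
  obtain u where u: "H.longest J' u" using H.longest_exists[OF J'] by blast
  have ul: "H.reduced u" "u \<in> lists I'" using u H.reduced_lists unfolding H.longest_def by blast+
  obtain v where v: "H.reduced (u @ v)" "H.E (u @ v) = H.E v0"
    using H.longest_extends[OF order_refl v0_longest ul(2,1)] by blast
  have vl: "H.reduced v" "v \<in> lists I'" using H.reduced_appendD(2)[OF v(1)] H.reduced_lists by blast+
  have uv: "H.longest I' (u @ v)"
    using H.longestI[OF order_refl H.reduced_lists[OF v(1)] v(1)] v(2) v0_neg by simp
  \<comment> \<open>\<open>u\<close> is an involution and \<open>u @ v\<close> represents
    \<open>w_0\<close>, so the suffix \<open>v\<close> represents \<open>w_{J'} w_0\<close>.\<close>
  have "H.E (u @ u @ v) = H.E v"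
    using H.longest_invol[OF J' u] by (simp add: ev_append comp_assoc[symmetric])
  then have "w_rel I' M' J' I' = s_word I' M' v"
    unfolding H.w_rel_eq[OF J' u order_refl uv] using H.s_word_eq_iff[of "u @ u @ v" v] ul vl by simp
  then have lhs: "\<Phi> (T_elem I' M' (w_rel I' M' J' I')) = T_word I M (F v)"
    using H.T_elem_s_word[OF vl(1)] \<Phi>_T_word[OF vl(2)] by simp
  define J where "J = set u0 \<union> (\<Union>j\<in>J'. set (f j))"
  have JI: "J \<subseteq> I" unfolding J_def using u0_lists f_lists J' by auto
  have y: "C.longest J (u0 @ F u)" unfolding J_def by (rule longest_image[OF J' u])
  have w: "C.longest I ((u0 @ F u) @ F v)" using u0_longest_word[OF v] by simp
  have yl: "u0 @ F u \<in> lists I" "F v \<in> lists I" using u0_lists F_lists ul vl by auto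
  have "C.E ((u0 @ F u) @ (u0 @ F u) @ F v) = C.E (F v)"
    using C.longest_invol[OF JI y] by (simp add: ev_append[of _ "u0 @ F u"] comp_assoc[symmetric] del: append_assoc)
  then have "w_rel I M J I = s_word I M (F v)"
    unfolding C.w_rel_eq[OF JI y order_refl w]
    using C.s_word_eq_iff[of "(u0 @ F u) @ (u0 @ F u) @ F v" "F v"] yl by simp
  then have "T_elem I M (w_rel I M J I) = T_word I M (F v)"
    using C.T_elem_s_word[OF F_reduced[OF vl(1)]] by simp
  then show "\<exists>J\<subseteq>I. \<Phi> (T_elem I' M' (w_rel I' M' J' I')) = T_elem I M (w_rel I M J I)"
    using lhs JI by auto
qed

lemma exists_strict_parabolic:
  "\<exists>\<Phi>. strict_parabolic I' M' I M \<Phi> \<and> (\<forall>j\<in>I'. \<Phi> (T_word I' M' [j]) = T_word I M (f j))"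
  using strict_parabolic_\<Phi> \<Phi>_T_word[of "[_]"] by (intro exI[of _ \<Phi>]) auto

end

section \<open>Type B as a group of signed permutations\<close>

text \<open>The integers \<open>x \<ge> 0\<close> and \<open>- 1 - x\<close> stand for opposite signed basis vectors. The letter \<open>i\<close> of
  \<open>B_n\<close> acts as \<open>tr (n - i)\<close>, which does not depend on \<open>n\<close>, and \<open>B_n\<close> permutes \<open>{- n..<n}\<close>.\<close>

definition tr :: "int \<Rightarrow> int \<Rightarrow> int" where
  "tr d x = (if x = d - 1 then d else if x = d then d - 1
    else if x = - d - 1 then - d else if x = - d then - d - 1 else x)"

lemma tr_tr: "d \<ge> 0 \<Longrightarrow> tr d (tr d x) = x"
  by (auto simp: tr_def)

lemma tr_odd: "d \<ge> 0 \<Longrightarrow> tr d (- 1 - x) = - 1 - tr d x"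
  by (auto simp: tr_def)

lemma tr_commute: "d \<ge> 0 \<Longrightarrow> d + 2 \<le> e \<Longrightarrow> tr d (tr e x) = tr e (tr d x)"
  by (auto simp: tr_def)

lemma tr_braid3: "d \<ge> 1 \<Longrightarrow> tr d (tr (d + 1) (tr d x)) = tr (d + 1) (tr d (tr (d + 1) x))"
  by (auto simp: tr_def)

lemma tr_braid4: "tr 0 (tr 1 (tr 0 (tr 1 x))) = tr 1 (tr 0 (tr 1 (tr 0 x)))"
  by (auto simp: tr_def)

lemma tr_pair_power:
  assumes "d \<ge> 0" "e \<ge> 0"
    "k = (if d = e then 1 else if {d, e} = {0, 1} then 4
      else if d + 1 = e \<or> e + 1 = d then 3 else 2 :: nat)"
  shows "(tr d \<circ> tr e) ^^ k = id"
proof -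
  consider "d = e" | "d = 0" "e = 1" | "d = 1" "e = 0" | "d \<ge> 1" "e = d + 1" | "e \<ge> 1" "d = e + 1"
    | "d + 2 \<le> e" | "e + 2 \<le> d"
    using assms by linarith
  then show ?thesis
  proof cases
    case 1
    then show ?thesis using assms tr_tr by (auto simp: fun_eq_iff)
  next
    case 2
    then show ?thesis using assms(3) tr_braid4 tr_tr[of 0] tr_tr[of 1]
      by (auto simp: fun_eq_iff numeral_eq_Suc)
  next
    case 3
    then show ?thesis using assms(3) tr_braid4 tr_tr[of 0] tr_tr[of 1]
      by (auto simp: fun_eq_iff numeral_eq_Suc insert_commute)
  next
    case 4
    then have "k = 3" using assms(3) by (auto simp: doubleton_eq_iff)
    then show ?thesis using 4 tr_braid3[of d] tr_tr[of d] tr_tr[of e]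
      by (auto simp: fun_eq_iff numeral_eq_Suc)
  next
    case 5
    then have "k = 3" using assms(3) by (auto simp: doubleton_eq_iff)
    then show ?thesis using 5 tr_braid3[of e] tr_tr[of d] tr_tr[of e]
      by (auto simp: fun_eq_iff numeral_eq_Suc)
  next
    case 6
    then have "k = 2" using assms(3) by (auto simp: doubleton_eq_iff)
    then show ?thesis using 6 assms tr_commute[of d e] tr_tr[of d] tr_tr[of e]
      by (auto simp: fun_eq_iff numeral_eq_Suc)
  next
    case 7
    then have "k = 2" using assms(3) by (auto simp: doubleton_eq_iff)
    then show ?thesis using 7 assms tr_commute[of e d] tr_tr[of d] tr_tr[of e]
      by (auto simp: fun_eq_iff numeral_eq_Suc)
  qed
qed

lemma tr_values:
  "d \<ge> 0 \<Longrightarrow> tr d (d - 1) = d" "d \<ge> 0 \<Longrightarrow> tr d d = d - 1"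
  "d \<ge> 0 \<Longrightarrow> tr d (- d - 1) = - d" "d \<ge> 0 \<Longrightarrow> tr d (- 1 - d) = - d" "d \<ge> 0 \<Longrightarrow> tr d (- d) = - d - 1"
  by (simp_all add: tr_def)

text \<open>The two pairs coincide exactly for \<open>d = 0\<close>: the last letter of
  \<open>B_n\<close> has one representative of its root, every other letter has two.\<close>

definition tr_roots :: "int \<Rightarrow> (int \<times> int) set" where
  "tr_roots d = {(d - 1, d), (- d - 1, - d)}"

lemma tr_roots_swap:
  "d \<ge> 0 \<Longrightarrow> (x, y) \<in> tr_roots d \<Longrightarrow> tr d x = y \<and> tr d y = x \<and> x < y"
  by (simp add: tr_roots_def tr_def) presburger

lemma tr_less: "d \<ge> 0 \<Longrightarrow> x < y \<Longrightarrow> (x, y) \<notin> tr_roots d \<Longrightarrow> tr d x < tr d y"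
  by (auto simp: tr_roots_def tr_def)

definition tB :: "nat \<Rightarrow> nat \<Rightarrow> int \<Rightarrow> int" where
  "tB n i = tr (int n - int i)"

definition sB :: "nat \<Rightarrow> nat \<Rightarrow> int \<times> int \<Rightarrow> int \<times> int" where
  "sB n i = map_prod (tB n i) (tB n i)"

text \<open>The pairs \<open>(x, y)\<close> and \<open>(- 1 - y, - 1 - x)\<close> represent the same root.\<close>

definition posB :: "(int \<times> int) set" where
  "posB = {(x, y). x < y}"

definition DB :: "nat \<Rightarrow> nat \<Rightarrow> (int \<times> int) set" where
  "DB n i = tr_roots (int n - int i)"

definition rootB :: "nat \<Rightarrow> nat \<Rightarrow> int \<times> int" where
  "rootB n i = (int n - int i - 1, int n - int i)"

lemma ev_sB: "ev (sB n) u = map_prod (ev (tB n) u) (ev (tB n) u)"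
  by (induction u) (auto simp: sB_def map_prod_def fun_eq_iff)

lemma rootB_pos_iff:
  "ev (sB n) u (rootB n i) \<in> posB \<longleftrightarrow>
    ev (tB n) u (int n - int i - 1) < ev (tB n) u (int n - int i)"
  by (simp add: ev_sB rootB_def posB_def)

lemma ev_tB_odd:
  "u \<in> lists {1..n} \<Longrightarrow> ev (tB n) u (- 1 - x) = - 1 - ev (tB n) u x"
proof (induction u arbitrary: x)
  case (Cons i u)
  then have "ev (tB n) u (- 1 - x) = - 1 - ev (tB n) u x" "int n - int i \<ge> 0" by auto
  then show ?case
    using tr_odd[of "int n - int i" "ev (tB n) u x"] by (simp add: tB_def[of n i])
qed auto

lemma ev_tB_permutes:
  "u \<in> lists {1..n} \<Longrightarrow> ev (tB n) u permutes {- int n..int n - 1}"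
proof (induction u)
  case Nil
  then show ?case using permutes_id by (simp add: id_def)
next
  case (Cons i u)
  have "tB n i permutes {- int n..int n - 1}"
  proof (rule bij_imp_permutes)
    have i: "int n - int i \<ge> 0" "int n - int i \<le> int n - 1" using Cons by auto
    show "bij_betw (tB n i) {- int n..int n - 1} {- int n..int n - 1}"
      by (rule bij_betw_byWitness[where f' = "tB n i"]) (use i tr_tr in \<open>auto simp: tB_def\<close>, auto simp: tr_def)
    show "tB n i x = x" if "x \<notin> {- int n..int n - 1}" for x
      using that i by (auto simp: tB_def tr_def)
  qed
  moreover have "ev (tB n) u permutes {- int n..int n - 1}" using Cons by simp
  ultimately show ?case using permutes_compose by (simp del: comp_apply)
qed

lemma ev_tB_inj: "u \<in> lists {1..n} \<Longrightarrow> ev (tB n) u x = ev (tB n) u y \<longleftrightarrow> x = y"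
  by (rule inj_eq[OF permutes_inj[OF ev_tB_permutes]])

lemma cox_B_nat:
  assumes "2 \<le> n" "i \<in> {1..n}" "j \<in> {1..n}" "d = int n - int i" "e = int n - int j"
  shows "cox_B n i j = enat (if d = e then 1 else if {d, e} = {0, 1} then 4
      else if d + 1 = e \<or> e + 1 = d then 3 else 2)"
proof -
  have "1 \<le> i" "i \<le> n" "1 \<le> j" "j \<le> n" using assms(2,3) by auto
  then have iff: "i = n - 1 \<longleftrightarrow> d = 1" "i = n \<longleftrightarrow> d = 0" "j = n - 1 \<longleftrightarrow> e = 1" "j = n \<longleftrightarrow> e = 0"
    "i = j \<longleftrightarrow> d = e" "i + 1 = j \<longleftrightarrow> e + 1 = d" "j + 1 = i \<longleftrightarrow> d + 1 = e"
    using assms(1) unfolding assms(4,5) by linarith+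
  show ?thesis
    unfolding cox_B_def doubleton_eq_iff iff if_distrib[of enat]
    by (intro if_cong) (auto simp: one_enat_def numeral_eq_enat)
qed

text \<open>Oddness extends the hypothesis from the pair \<open>d - 1, d\<close> to its opposite,
  and injectivity keeps all other points off the points moved by \<open>tr e\<close>. This is the
  axiom \<open>conj\<close> for type B.\<close>

lemma tr_conj:
  assumes "d \<ge> 0" "e \<ge> 0" "\<And>x. g (- 1 - x) = - 1 - g x" "\<And>x y. g x = g y \<longleftrightarrow> x = y"
    "g (d - 1) = e - 1 \<and> g d = e \<or> g (d - 1) = - e - 1 \<and> g d = - e"
  shows "g (tr d x) = tr e (g x)"
proof -
  have m: "g (- d - 1) = - 1 - g d" "g (- d) = - 1 - g (d - 1)"
    using assms(3)[of d] assms(3)[of "d - 1"] minus_diff_commute[of 1 d]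
    by (simp_all add: algebra_simps)
  consider "x = d - 1" | "x = d" | "x = - d - 1" | "x = - d"
    | "x \<noteq> d - 1" "x \<noteq> d" "x \<noteq> - d - 1" "x \<noteq> - d" by blast
  then show ?thesis
  proof cases
    case 5
    then have "g x \<noteq> g (d - 1)" "g x \<noteq> g d" "g x \<noteq> g (- d - 1)" "g x \<noteq> g (- d)"
      using assms(4) by auto
    then have "g x \<noteq> e - 1" "g x \<noteq> e" "g x \<noteq> - e - 1" "g x \<noteq> - e"
      using assms(5) m by auto
    then show ?thesis using 5 by (simp add: tr_def)
  next
    case 1
    then show ?thesis using assms(5) tr_values[OF assms(1)] tr_values[OF assms(2)] by auto
  next
    case 2
    then show ?thesis using assms(5) tr_values[OF assms(1)] tr_values[OF assms(2)] by auto
  next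
    case 3
    then have "g (tr d x) = - 1 - g (d - 1)" "g x = - 1 - g d"
      using m by (simp_all add: tr_values assms(1,2))
    then show ?thesis using assms(5) tr_values[OF assms(2)] by auto
  next
    case 4
    then have "g (tr d x) = - 1 - g d" "g x = - 1 - g (d - 1)"
      using m by (simp_all add: tr_values assms(1,2))
    then show ?thesis using assms(5) tr_values[OF assms(2)] by auto
  qed
qed

lemma less_4_cases: "k < (4 :: nat) \<Longrightarrow> k = 0 \<or> k = 1 \<or> k = 2 \<or> k = 3"
  by auto

text \<open>These are the instances of \<open>alt_pos\<close> for alternating words with one, two
  and three letters; the last one occurs only at the bond labelled 4.\<close>

lemma tr_alt_less:
  assumes "d \<ge> 0" "e \<ge> 0" "d \<noteq> e"
  shows "tr d (e - 1) < tr d e"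
    and "d + 1 = e \<or> e + 1 = d \<Longrightarrow> tr d (tr e (d - 1)) < tr d (tr e d)"
    and "{d, e} = {0, 1} \<Longrightarrow> tr d (tr e (tr d (e - 1))) < tr d (tr e (tr d e))"
proof -
  show "tr d (e - 1) < tr d e"
    using assms by (intro tr_less) (auto simp: tr_roots_def)
  show "tr d (tr e (d - 1)) < tr d (tr e d)" if "d + 1 = e \<or> e + 1 = d"
  proof -
    have "tr e (d - 1) < tr e d" "(tr e (d - 1), tr e d) \<notin> tr_roots d"
      using that assms by (auto simp: tr_roots_def tr_def)
    then show ?thesis using tr_less[OF assms(1)] by blast
  qed
  show "tr d (tr e (tr d (e - 1))) < tr d (tr e (tr d e))" if "{d, e} = {0, 1}"
  proof -
    have "d = 0 \<and> e = 1 \<or> d = 1 \<and> e = 0" using that by (auto simp: doubleton_eq_iff)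
    then show ?thesis by (auto simp: tr_def)
  qed
qed

lemma coxeter_roots_B:
  assumes n: "2 \<le> n"
  shows "coxeter_roots {1..n} (cox_B n) (sB n) posB (DB n) (rootB n)"
proof
  show "coxeter_matrix {1..n} (cox_B n)"
    using n by (auto simp: coxeter_matrix_def cox_B_def insert_commute numeral_eq_enat)
  show "cox_B n i j \<noteq> \<infinity>" for i j
    by (auto simp: cox_B_def one_enat_def numeral_eq_enat)
  show "(sB n i \<circ> sB n j) ^^ k = id"
    if "i \<in> {1..n}" "j \<in> {1..n}" "cox_B n i j = enat k" for i j k
  proof -
    have *: "(sB n i \<circ> sB n j) ^^ l = map_prod ((tB n i \<circ> tB n j) ^^ l) ((tB n i \<circ> tB n j) ^^ l)" for l
      by (induction l) (auto simp: sB_def map_prod_def fun_eq_iff)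
    have "(tB n i \<circ> tB n j) ^^ k = id"
      unfolding tB_def using that cox_B_nat[OF n that(1,2) HOL.refl HOL.refl] by (intro tr_pair_power) auto
    then show ?thesis unfolding * by (simp add: map_prod.id)
  qed
  show "rootB n i \<in> DB n i" for i by (simp add: rootB_def DB_def tr_roots_def)
  show "p \<in> posB" if "i \<in> {1..n}" "p \<in> DB n i" for i p
    using that tr_roots_swap[of "int n - int i"] by (cases p) (auto simp: DB_def posB_def)
  show "sB n i p \<notin> posB" if "i \<in> {1..n}" "p \<in> DB n i" for i p
    using that tr_roots_swap[of "int n - int i"] by (cases p) (fastforce simp: DB_def posB_def sB_def tB_def)
  show "sB n i p \<in> posB" if "i \<in> {1..n}" "p \<in> posB" "p \<notin> DB n i" for i p
    using that tr_less[of "int n - int i"] by (cases p) (auto simp: DB_def posB_def sB_def tB_def)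
  show "ev (sB n) u (sB n i p) \<notin> posB"
    if "i \<in> {1..n}" "p \<in> DB n i" "ev (sB n) u p \<in> posB" for i p u
  proof -
    have "sB n i p = (snd p, fst p)" using that(1,2)
      tr_roots_swap[of "int n - int i"] by (cases p) (auto simp: DB_def sB_def tB_def)
    then show ?thesis using that(3) by (cases p) (auto simp: ev_sB posB_def)
  qed
  show "ev (sB n) u \<circ> sB n i = sB n j \<circ> ev (sB n) u"
    if "i \<in> {1..n}" "j \<in> {1..n}" "u \<in> lists {1..n}" "p \<in> DB n i" "ev (sB n) u p \<in> DB n j" for i j p u
  proof -
    let ?g = "ev (tB n) u" and ?d = "int n - int i" and ?e = "int n - int j"
    have m: "?g (- ?d - 1) = - 1 - ?g ?d" "?g (- ?d) = - 1 - ?g (?d - 1)"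
      using ev_tB_odd[OF that(3), of ?d] ev_tB_odd[OF that(3), of "?d - 1"]
        minus_diff_commute[of 1 ?d] by (simp_all add: algebra_simps)
    have "?g (tr ?d x) = tr ?e (?g x)" for x
    proof (rule tr_conj)
      show "?g (?d - 1) = ?e - 1 \<and> ?g ?d = ?e \<or> ?g (?d - 1) = - ?e - 1 \<and> ?g ?d = - ?e"
        using that(4,5) m by (auto simp: ev_sB DB_def tr_roots_def)
    qed (use that ev_tB_odd ev_tB_inj in auto)
    then show ?thesis by (auto simp: ev_sB sB_def tB_def fun_eq_iff)
  qed
  show "ev (sB n) (alt_word k i j) (rootB n (if even k then i else j)) \<in> posB"
    if "i \<in> {1..n}" "j \<in> {1..n}" "i \<noteq> j" "enat k < cox_B n i j" for i j k
  proof -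
    define d e where de: "d = int n - int i" "e = int n - int j"
    have pos: "d \<ge> 0" "e \<ge> 0" "d \<noteq> e" using that de by auto
    have k: "k < (if {d, e} = {0, 1} then 4 else if d + 1 = e \<or> e + 1 = d then 3 else 2)"
      using that cox_B_nat[OF n that(1,2) de] pos by (auto split: if_splits)
    have alt: "alt_word 2 i j = [i, j]" "alt_word 3 i j = [i, j, i]"
      by (simp_all add: numeral_eq_Suc)
    have "k < 4" using k by (auto split: if_splits)
    then consider "k = 0" | "k = 1" | "k = 2" | "k = 3" using less_4_cases by blast
    then show ?thesis
    proof cases
      case 1
      then show ?thesis by (simp add: rootB_def posB_def)
    next
      case 2
      then show ?thesis using tr_alt_less(1)[OF pos]
        unfolding rootB_pos_iff by (simp add: tB_def de)
    next
      case 3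
      then have "{d, e} = {0, 1} \<or> d + 1 = e \<or> e + 1 = d" using k by (auto split: if_splits)
      then have "d + 1 = e \<or> e + 1 = d" by (auto simp: doubleton_eq_iff)
      then show ?thesis using 3 tr_alt_less(2)[OF pos]
        unfolding rootB_pos_iff by (simp add: tB_def de alt)
    next
      case 4
      then have "{d, e} = {0, 1}" using k by (auto split: if_splits)
      then show ?thesis using 4 tr_alt_less(3)[OF pos]
        unfolding rootB_pos_iff by (simp add: tB_def de alt)
    qed
  qed
  have "ev (sB n) ` lists {1..n} \<subseteq> (\<lambda>g. map_prod g g) ` {g. g permutes {- int n..int n - 1}}"
    using ev_tB_permutes by (auto simp: ev_sB simp del: in_lists_conv_set)
  then show "finite (ev (sB n) ` lists {1..n})"
    by (rule finite_subset) (intro finite_imageI finite_permutations, simp)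
qed

section \<open>Lengths in type B\<close>

abbreviation "redB n \<equiv> coxeter_roots.reduced {1..n} (sB n)"

definition invB :: "(int \<Rightarrow> int) \<Rightarrow> (int \<times> int) set" where
  "invB g = {(x, y). x < y \<and> \<not> g x < g y}"

text \<open>The condition singles out the pairs fixed by passing to the other representative
  \<open>(- 1 - y, - 1 - x)\<close>. With \<open>a = 2\<close> and \<open>b = 1\<close> each root
  counts 2 in total, whence \<open>two_length_B\<close>.\<close>

definition wtB :: "nat \<Rightarrow> nat \<Rightarrow> int \<times> int \<Rightarrow> nat" where
  "wtB a b p = (if fst p + snd p = - 1 then a else b)"

lemma sum_invB:
  assumes "2 \<le> n" "redB n u"
  shows "finite (invB (ev (tB n) u))"
    and "sum (wtB a b) (invB (ev (tB n) u)) = (\<Sum>i\<leftarrow>u. if i = n then a else 2 * b)"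
proof -
  interpret B: coxeter_roots "{1..n}" "cox_B n" "sB n" posB "DB n" "rootB n"
    by (rule coxeter_roots_B[OF assms(1)])
  have inv: "B.inversions (ev (sB n) u) = invB (ev (tB n) u)"
    unfolding B.inversions_def by (auto simp: invB_def posB_def ev_sB)
  have "tr d x + tr d y = - 1 \<longleftrightarrow> x + y = - 1" if "d \<ge> 0" for d x y
  proof -
    have "tr d x = - 1 - tr d y \<longleftrightarrow> x = - 1 - y"
      using tr_odd[OF that, of y] tr_tr[OF that] by metis
    then show ?thesis by linarith
  qed
  then have wt: "wtB a b (sB n i p) = wtB a b p" if "i \<in> {1..n}" for i p
    using that by (cases p) (simp add: wtB_def sB_def tB_def)
  have fin: "finite (DB n i)" for i
    by (simp add: DB_def tr_roots_def)
  have D: "sum (wtB a b) (DB n i) = (if i = n then a else 2 * b)" if "i \<in> {1..n}" for i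
    using that by (auto simp: DB_def tr_roots_def wtB_def)
  have u: "set u \<subseteq> {1..n}" using B.reduced_lists[OF assms(2)] by auto
  have "(\<Sum>i\<leftarrow>u. sum (wtB a b) (DB n i)) = (\<Sum>i\<leftarrow>u. if i = n then a else 2 * b)"
    using D u by (intro arg_cong[of _ _ sum_list] map_cong) auto
  then show "finite (invB (ev (tB n) u))"
    "sum (wtB a b) (invB (ev (tB n) u)) = (\<Sum>i\<leftarrow>u. if i = n then a else 2 * b)"
    using B.sum_inversions[OF assms(2) fin wt] inv by auto
qed

lemma two_length_B:
  assumes "2 \<le> n" "redB n u"
  shows "2 * length u = sum (wtB 2 1) (invB (ev (tB n) u))"
proof -
  have "(\<Sum>i\<leftarrow>u. if i = n then 2 else 2 * 1) = 2 * length u"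
    by (induction u) auto
  then show ?thesis using sum_invB(2)[OF assms, of 2 1] by simp
qed

text \<open>The count is twice the minimal length of a word of this permutation, so it suffices that
  \<open>u\<close> is not longer.\<close>

lemma redBI:
  assumes "2 \<le> n" "u \<in> lists {1..n}" "2 * length u \<le> sum (wtB 2 1) (invB (ev (tB n) u))"
  shows "redB n u"
proof -
  interpret B: coxeter_roots "{1..n}" "cox_B n" "sB n" posB "DB n" "rootB n"
    by (rule coxeter_roots_B[OF assms(1)])
  obtain r where r: "redB n r" "ev (sB n) r = ev (sB n) u" using B.exists_reduced[OF assms(2)] by blast
  then have "ev (tB n) r = ev (tB n) u" by (auto simp: ev_sB fun_eq_iff)
  then have "length u \<le> length r" using two_length_B[OF assms(1) r(1)] assms(3) by simp
  then show ?thesis using B.reduced_transfer[OF r(1) assms(2)] r(2) by simp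
qed

text \<open>Minus the identity on the central \<open>2 * k\<close> points: the longest element of
  the central parabolic subgroup of type \<open>B_k\<close>.\<close>

definition mirror :: "int \<Rightarrow> int \<Rightarrow> int" where
  "mirror k x = (if - k \<le> x \<and> x < k then - 1 - x else x)"

lemma invB_mirror: "invB (mirror k) = {(x, y). - k \<le> x \<and> x < y \<and> y < k}"
  by (auto simp: invB_def mirror_def split: if_splits)

text \<open>All \<open>n^2\<close> positive roots of \<open>B_n\<close> are inverted, each with
  weight 2.\<close>

lemma sum_invB_mirror: "sum (wtB 2 1) (invB (mirror (int n))) = 2 * n\<^sup>2"
proof (induction n)
  case 0
  have "invB (mirror (int 0)) = {}" unfolding invB_mirror by auto
  then show ?case by (simp only: sum.empty) simp
next
  case (Suc n)
  let ?I = "\<lambda>k. {(x, y). - k \<le> x \<and> x < y \<and> y < (k :: int)}"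
  let ?L = "{- int n - 1} \<times> {- int n..int n - 1}" and ?R = "{- int n..int n - 1} \<times> {int n}"
  \<comment> \<open>The new pairs contain the new leftmost or the new rightmost point. The pair of
    both is its own opposite and weighs 2; the others weigh 1.\<close>
  have split: "?I (int (Suc n)) = ?I (int n) \<union> (?L \<union> (?R \<union> {(- int n - 1, int n)}))"
  proof (intro equalityI subsetI)
    fix p assume "p \<in> ?I (int (Suc n))"
    then obtain x y where p: "p = (x, y)" "- int n - 1 \<le> x" "x < y" "y \<le> int n" by auto
    show "p \<in> ?I (int n) \<union> (?L \<union> (?R \<union> {(- int n - 1, int n)}))"
      by (cases "x = - int n - 1"; cases "y = int n") (use p in auto)
  qed auto
  have "?I (int n) \<subseteq> {- int n..int n} \<times> {- int n..int n}" by auto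
  then have fin: "finite (?I (int n))" by (rule finite_subset) simp
  have L: "sum (wtB 2 1) ?L = 2 * n"
  proof -
    have "sum (wtB 2 1) ?L = (\<Sum>p\<in>?L. 1)" by (rule sum.cong) (auto simp: wtB_def)
    then show ?thesis by (simp add: card_cartesian_product)
  qed
  have R: "sum (wtB 2 1) ?R = 2 * n"
  proof -
    have "sum (wtB 2 1) ?R = (\<Sum>p\<in>?R. 1)" by (rule sum.cong) (auto simp: wtB_def)
    then show ?thesis by (simp add: card_cartesian_product)
  qed
  have "sum (wtB 2 1) (?R \<union> {(- int n - 1, int n)}) = 2 * n + 2"
    using R by (subst sum.union_disjoint) (auto simp: wtB_def)
  then have "sum (wtB 2 1) (?L \<union> (?R \<union> {(- int n - 1, int n)})) = 2 * n + (2 * n + 2)"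
    using L by (subst sum.union_disjoint) auto
  then have "sum (wtB 2 1) (?I (int (Suc n))) = sum (wtB 2 1) (?I (int n)) + (2 * n + (2 * n + 2))"
    unfolding split using fin by (subst sum.union_disjoint) auto
  then show ?case using Suc by (simp add: invB_mirror power2_eq_square algebra_simps)
qed

lemma redB_mirrorI:
  assumes "2 \<le> n" "u \<in> lists {1..n}" "ev (tB n) u = mirror (int n)" "length u = n\<^sup>2"
  shows "redB n u"
  using redBI[OF assms(1,2)] assms(3,4) sum_invB_mirror by simp

lemma mirror_rootB:
  "i \<in> {1..n} \<Longrightarrow> ev (tB n) u = mirror (int n) \<Longrightarrow> ev (sB n) u (rootB n i) \<notin> posB"
  unfolding rootB_pos_iff by (simp add: mirror_def)

text \<open>The sign change of a single basis vector, which is the reflection represented by a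
  palindrome word.\<close>

definition flip :: "int \<Rightarrow> int \<Rightarrow> int" where
  "flip k x = (if x = k then - 1 - k else if x = - 1 - k then k else x)"

lemma palindrome_word_Suc:
  assumes "m < n"
  shows "palindrome_word m n = m # palindrome_word (Suc m) n @ [m]"
  using assms by (simp add: palindrome_word_def upt_conv_Cons)

lemma tr_flip_tr:
  assumes "d \<ge> 1"
  shows "tr d (flip (d - 1) (tr d x)) = flip d x"
proof -
  consider "x = d - 1" | "x = d" | "x = - d - 1" | "x = - d"
    | "x \<noteq> d - 1" "x \<noteq> d" "x \<noteq> - d - 1" "x \<noteq> - d" by blast
  then show ?thesis
    by cases (use assms in \<open>simp_all add: tr_values\<close>, simp_all add: flip_def tr_def)
qed

lemma ev_palindrome_word:
  assumes "m \<le> n"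
  shows "ev (tB n) (palindrome_word m n) = flip (int n - int m)"
  using assms
proof (induction m rule: inc_induct)
  case base
  show ?case by (auto simp: palindrome_word_def tB_def tr_def flip_def fun_eq_iff)
next
  case (step m)
  define d where "d = int n - int m"
  have "d \<ge> 1" "int n - int (Suc m) = d - 1" using step.hyps by (simp_all add: d_def)
  then show ?case
    unfolding palindrome_word_Suc[OF step.hyps(2)]
    by (simp add: ev_append step.IH tB_def[of n m] fun_eq_iff tr_flip_tr \<open>int n - int (Suc m) = d - 1\<close> d_def[symmetric] del: of_nat_Suc)
qed

lemma set_palindrome_word: "m \<le> n \<Longrightarrow> set (palindrome_word m n) = {m..n}"
  by (auto simp: palindrome_word_def)

lemma length_palindrome_word: "m \<le> n \<Longrightarrow> length (palindrome_word m n) = 2 * (n - m) + 1"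
  by (simp add: palindrome_word_def)

text \<open>The product of the sign changes of the central basis vectors, a word of the longest
  element for the letters \<open>j, ..., n\<close>. The factors are ordered so that a larger
  \<open>j\<close> gives a prefix.\<close>

definition mirror_word :: "nat \<Rightarrow> nat \<Rightarrow> nat list" where
  "mirror_word j n = concat (map (\<lambda>i. palindrome_word i n) (rev [j..<Suc n]))"

lemma mirror_word_Suc:
  "j \<le> n \<Longrightarrow> mirror_word j n = mirror_word (Suc j) n @ palindrome_word j n"
  by (simp add: mirror_word_def upt_conv_Cons del: upt_Suc)

lemma mirror_word_props:
  assumes "j \<le> Suc n"
  shows "ev (tB n) (mirror_word j n) = mirror (int (Suc n) - int j)
    \<and> length (mirror_word j n) = (Suc n - j)\<^sup>2 \<and> set (mirror_word j n) = {j..n}"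
  using assms
proof (induction j rule: inc_induct)
  case base
  show ?case by (auto simp: mirror_word_def mirror_def fun_eq_iff)
next
  case (step j)
  define d where "d = n - j"
  have d: "n = j + d" "Suc n - j = Suc d" "Suc n - Suc j = d" using step.hyps by (simp_all add: d_def)
  have "mirror (int d) \<circ> flip (int d) = mirror (int d + 1)"
    by (auto simp: mirror_def flip_def fun_eq_iff)
  then show ?case
    unfolding mirror_word_Suc[OF less_Suc_eq_le[THEN iffD1, OF step.hyps(2)]]
    using step.IH ev_palindrome_word[of j n] length_palindrome_word[of j n] set_palindrome_word[of j n] d
    by (auto simp: ev_append power2_eq_square add.commute)
qed

section \<open>Embedding signed permutations outside a central block\<close>

text \<open>Points outside the central \<open>2 * k\<close> points move inwards by \<open>k\<close>,
  undergo \<open>g\<close>, and move outwards again. The sign of the image decides on which side, so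
  points may cross the block.\<close>

definition stretch :: "int \<Rightarrow> (int \<Rightarrow> int) \<Rightarrow> int \<Rightarrow> int" where
  "stretch k g x = (if - k \<le> x \<and> x < k then x
    else let y = g (if k \<le> x then x - k else x + k) in if 0 \<le> y then y + k else y - k)"

lemma stretch_comp: "k \<ge> 0 \<Longrightarrow> stretch k (g \<circ> h) = stretch k g \<circ> stretch k h"
  by (auto simp: stretch_def Let_def fun_eq_iff)

lemma stretch_id: "k \<ge> 0 \<Longrightarrow> stretch k id = id"
  by (auto simp: stretch_def Let_def fun_eq_iff)

lemma stretch_power: "k \<ge> 0 \<Longrightarrow> stretch k (g ^^ l) = stretch k g ^^ l"
  by (induction l) (auto simp: stretch_id stretch_comp)

lemma stretch_tr:
  assumes "k \<ge> 0" "d \<ge> 1"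
  shows "stretch k (tr d) = tr (d + k)"
proof
  fix x
  consider "- k \<le> x" "x < k" | "k \<le> x" | "x < - k" by linarith
  then show "stretch k (tr d) x = tr (d + k) x"
  proof cases
    case 1
    then show ?thesis using assms by (simp add: stretch_def tr_def)
  next
    case 2
    then have "0 \<le> tr d (x - k)" using assms by (simp add: tr_def)
    then show ?thesis using 2 assms by (simp add: stretch_def tr_def Let_def)
  next
    case 3
    then have "tr d (x + k) < 0" using assms by (simp add: tr_def)
    then show ?thesis using 3 assms by (simp add: stretch_def tr_def Let_def)
  qed
qed

text \<open>\<open>tr 0\<close> exchanges the two points next to the centre; with the block inserted
  they become \<open>k\<close> and \<open>- 1 - k\<close>. This is why the last generator is sent to
  a palindrome.\<close>

lemma stretch_tr_0: "k \<ge> 0 \<Longrightarrow> stretch k (tr 0) = flip k"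
  by (auto simp: stretch_def tr_def flip_def Let_def fun_eq_iff)

text \<open>The identity \<open>u_0 f(w_0) = w_0\<close> for permutations, with \<open>k\<close> the
  half size of the inserted block.\<close>

lemma mirror_stretch:
  "k \<ge> 0 \<Longrightarrow> l \<ge> 0 \<Longrightarrow> mirror k \<circ> stretch k (mirror l) = mirror (k + l)"
  by (auto simp: stretch_def mirror_def Let_def fun_eq_iff)

definition stretch_word :: "nat \<Rightarrow> nat \<Rightarrow> nat \<Rightarrow> nat list" where
  "stretch_word m n i = (if i < m then [i] else palindrome_word m n)"

lemma stretch_word_lists: "1 \<le> m \<Longrightarrow> m \<le> n \<Longrightarrow> i \<in> {1..m} \<Longrightarrow> stretch_word m n i \<in> lists {1..n}"
  by (auto simp: stretch_word_def set_palindrome_word)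

lemma ev_stretch_word:
  assumes "m \<le> n" "u \<in> lists {1..m}"
  shows "ev (tB n) (concat (map (stretch_word m n) u)) = stretch (int n - int m) (ev (tB m) u)"
  using assms(2)
proof (induction u rule: list.induct)
  case Nil
  have "stretch (int n - int m) id = id" using assms(1) by (intro stretch_id) simp
  then show ?case by (simp only: list.map concat.simps ev.simps)
next
  case (Cons i u)
  have "ev (tB n) (stretch_word m n i) = stretch (int n - int m) (tB m i)"
  proof (cases "i < m")
    case True
    then show ?thesis using assms(1) Cons.prems
      by (simp add: stretch_word_def tB_def[of _ i] stretch_tr)
  next
    case False
    then have "i = m" using Cons.prems by simp
    then show ?thesis using assms(1)
      by (simp add: stretch_word_def ev_palindrome_word tB_def[of m] stretch_tr_0)
  qed
  moreover have "ev (tB n) (concat (map (stretch_word m n) u)) = stretch (int n - int m) (ev (tB m) u)"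
    using Cons by simp
  moreover have "int n - int m \<ge> 0" using assms(1) by simp
  ultimately show ?case by (simp only: list.map concat.simps ev.simps ev_append stretch_comp)
qed

lemma upt_split: "i \<le> j \<Longrightarrow> j \<le> k \<Longrightarrow> [i..<k] = [i..<j] @ [j..<k]"
  using upt_add_eq_append[of i j "k - j"] by (metis le_add_diff_inverse)

lemma concat_stretch_word_palindrome:
  assumes "i \<le> m" "m \<le> n"
  shows "concat (map (stretch_word m n) (palindrome_word i m)) = palindrome_word i n"
proof -
  have id: "concat (map (stretch_word m n) xs) = xs" if "\<forall>x\<in>set xs. x < m" for xs
    using that by (induction xs) (simp_all add: stretch_word_def)
  have "concat (map (stretch_word m n) (palindrome_word i m))
      = [i..<m] @ palindrome_word m n @ rev [i..<m]"
    unfolding palindrome_word_def[of i m] by (simp add: id) (simp add: stretch_word_def)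
  moreover have "[i..<n] = [i..<m] @ [m..<n]" by (rule upt_split[OF assms])
  ultimately show ?thesis unfolding palindrome_word_def by simp
qed

text \<open>An equality of words: substituting the palindrome for the letter \<open>m\<close>
  prolongs each palindrome up to \<open>n\<close>. The conditions on \<open>u0\<close> and
  \<open>v0\<close> thereby reduce to facts on one mirror word.\<close>

lemma concat_stretch_word_mirror:
  assumes "m \<le> n"
  shows "mirror_word (Suc m) n @ concat (map (stretch_word m n) (mirror_word 1 m)) = mirror_word 1 n"
proof -
  have "concat (map (stretch_word m n) (concat (map (\<lambda>i. palindrome_word i m) xs)))
      = concat (map (\<lambda>i. palindrome_word i n) xs)" if "set xs \<subseteq> {..m}" for xs
    using that by (induction xs) (auto simp: concat_stretch_word_palindrome assms)
  from this[of "rev [1..<Suc m]"] have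
    "concat (map (stretch_word m n) (mirror_word 1 m)) = concat (map (\<lambda>i. palindrome_word i n) (rev [1..<Suc m]))"
    unfolding mirror_word_def by (simp add: subset_iff del: upt_Suc)
  moreover have "[1..<Suc n] = [1..<Suc m] @ [Suc m..<Suc n]"
    using assms by (intro upt_split) auto
  ultimately show ?thesis unfolding mirror_word_def by (simp del: upt_Suc)
qed

lemma mirror_word_lists: "1 \<le> j \<Longrightarrow> j \<le> Suc n \<Longrightarrow> mirror_word j n \<in> lists {1..n}"
  using mirror_word_props[of j n] by auto

text \<open>For \<open>j = 1\<close> the length \<open>n^2\<close> equals the number of positive
  roots; the other words are prefixes of that one.\<close>

lemma redB_mirror_word:
  assumes "2 \<le> n" "1 \<le> j" "j \<le> Suc n"
  shows "redB n (mirror_word j n)"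
proof -
  interpret B: coxeter_roots "{1..n}" "cox_B n" "sB n" posB "DB n" "rootB n"
    by (rule coxeter_roots_B[OF assms(1)])
  have r: "redB n (mirror_word 1 n)"
    using mirror_word_props[of 1 n] mirror_word_lists[of 1 n] by (intro redB_mirrorI assms(1)) auto
  have "[1..<Suc n] = [1..<j] @ [j..<Suc n]"
    using assms by (intro upt_split) auto
  then have "mirror_word 1 n = mirror_word j n @ concat (map (\<lambda>i. palindrome_word i n) (rev [1..<j]))"
    by (simp add: mirror_word_def del: upt_Suc)
  then show ?thesis using r B.reduced_appendD(1) by metis
qed

lemma mirror_word_neg:
  assumes "2 \<le> n" "j \<le> Suc n" "i \<in> {j..n}"
  shows "ev (sB n) (mirror_word j n) (rootB n i) \<notin> posB"
  unfolding rootB_pos_iff using mirror_word_props[OF assms(2)] assms(3) by (auto simp: mirror_def)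

theorem stretch_strict_parabolic:
  assumes "2 \<le> m" "m \<le> n"
  shows "\<exists>\<Phi>. strict_parabolic {1..m} (cox_B m) {1..n} (cox_B n) \<Phi> \<and>
    (\<forall>i\<in>{1..m}. \<Phi> (T_word {1..m} (cox_B m) [i]) = T_word {1..n} (cox_B n) (stretch_word m n i))"
proof -
  have n: "2 \<le> n" using assms by simp
  define k where "k = int n - int m"
  have k: "k \<ge> 0" using assms by (simp add: k_def)
  \<comment> \<open>The longest element of the central block of \<open>2 * k\<close> points, which
    the image of \<open>B_m\<close> leaves in place.\<close>
  let ?u0 = "mirror_word (Suc m) n"
  have u0: "ev (tB n) ?u0 = mirror k" "set ?u0 = {Suc m..n}"
    using mirror_word_props[of "Suc m" n] assms by (auto simp: k_def)
  interpret BM: coxeter_roots "{1..m}" "cox_B m" "sB m" posB "DB m" "rootB m"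
    by (rule coxeter_roots_B[OF assms(1)])
  interpret BN: coxeter_roots "{1..n}" "cox_B n" "sB n" posB "DB n" "rootB n"
    by (rule coxeter_roots_B[OF n])
  have total: "?u0 @ concat (map (stretch_word m n) (mirror_word 1 m)) = mirror_word 1 n"
    by (rule concat_stretch_word_mirror[OF assms(2)])
  interpret parabolic_map "{1..m}" "cox_B m" "sB m" posB "DB m" "rootB m"
    "{1..n}" "cox_B n" "sB n" posB "DB n" "rootB n" "stretch_word m n" ?u0 "mirror_word 1 m"
  proof unfold_locales
    show "stretch_word m n j \<in> lists {1..n}" if "j \<in> {1..m}" for j
      using assms by (intro stretch_word_lists that) auto
    show "redB n ?u0" using assms by (intro redB_mirror_word n) auto
    show "ev (sB n) ?u0 (rootB n i) \<notin> posB" if "i \<in> set ?u0" for i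
      using that u0(2) assms by (intro mirror_word_neg n) auto
    show "ev (sB n) (?u0 @ stretch_word m n j) (rootB n i) \<notin> posB"
      if j: "j \<in> {1..m}" and i: "i \<in> set ?u0 \<union> set (stretch_word m n j)" for j i
    proof -
      define e where "e = int n - int i"
      have *: "ev (tB n) (?u0 @ stretch_word m n j) x
          = mirror k (if j < m then tr (int n - int j) x else flip k x)" for x
        using j assms u0(1)
        by (auto simp: ev_append stretch_word_def ev_palindrome_word k_def tB_def[of n j])
      show ?thesis
      proof (cases "j < m")
        case True
        define d where "d = int n - int j"
        have d: "d > k" using True by (simp add: d_def k_def)
        \<comment> \<open>Either the letter \<open>j\<close> itself, or a letter of
          \<open>u0\<close>, which acts inside the central block and hence away from
          \<open>tr d\<close>.\<close>
        consider "e = d" | "0 \<le> e" "e < k"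
          using i u0(2) True by (auto simp: stretch_word_def d_def e_def k_def)
        then have "\<not> mirror k (tr d (e - 1)) < mirror k (tr d e)"
        proof cases
          case 1
          then show ?thesis using d k by (simp add: tr_values mirror_def)
        next
          case 2
          then have "tr d (e - 1) = e - 1" "tr d e = e" using d by (simp_all add: tr_def)
          then show ?thesis using 2 by (simp add: mirror_def)
        qed
        then show ?thesis unfolding rootB_pos_iff * e_def d_def using True by simp
      next
        case False
        then have "0 \<le> e \<and> e \<le> k"
          using i u0(2) j assms by (auto simp: stretch_word_def set_palindrome_word e_def k_def)
        then have "\<not> mirror k (flip k (e - 1)) < mirror k (flip k e)"
          using k by (cases "e = k") (simp_all add: mirror_def flip_def)
        then show ?thesis unfolding rootB_pos_iff * e_def using False by simp
      qed
    qed
    show "ev (sB n) (concat (map (stretch_word m n) (alt_word l i j)))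
        = ev (sB n) (concat (map (stretch_word m n) (alt_word l j i)))"
      if "i \<in> {1..m}" "j \<in> {1..m}" "i \<noteq> j" "cox_B m i j = enat l" for i j l
    proof -
      have "(alt_word l i j, alt_word l j i) \<in> word_cong {1..m} (coxeter_rels {1..m} (cox_B m))"
        using BM.cox_cong_braid[OF that(1,2,4)] .
      then have "ev (sB m) (alt_word l i j) = ev (sB m) (alt_word l j i)" by (rule BM.cox_cong_ev)
      then have "ev (tB m) (alt_word l i j) = ev (tB m) (alt_word l j i)"
        by (auto simp: ev_sB fun_eq_iff)
      then show ?thesis
        unfolding ev_sB ev_stretch_word[OF assms(2) alt_word_lists[OF that(1,2)]]
          ev_stretch_word[OF assms(2) alt_word_lists[OF that(2,1)]] by simp
    qed
    show "length (stretch_word m n i) = length (stretch_word m n j)"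
      if "i \<in> {1..m}" "j \<in> {1..m}" "i \<noteq> j" "cox_B m i j = enat l" "odd l" for i j l
    proof -
      \<comment> \<open>3 is the only odd label, and it does not involve the letter
        \<open>m\<close>, the only letter with a longer image.\<close>
      have "l = 3" using that
        by (auto simp: cox_B_def one_enat_def numeral_eq_enat split: if_splits)
      then have "i < m \<and> j < m" using that
        by (auto simp: cox_B_def one_enat_def numeral_eq_enat doubleton_eq_iff split: if_splits)
      then show ?thesis by (simp add: stretch_word_def)
    qed
    show "redB m (mirror_word 1 m)" by (intro redB_mirror_word assms(1)) auto
    show "ev (sB m) (mirror_word 1 m) (rootB m j) \<notin> posB" if "j \<in> {1..m}" for j
      using that by (intro mirror_word_neg assms(1)) auto
    show "redB n (concat (map (stretch_word m n) (mirror_word 1 m)))"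
      by (rule BN.reduced_appendD(2)[of ?u0], unfold total, intro redB_mirror_word n) auto
    show "ev (sB n) (?u0 @ concat (map (stretch_word m n) (mirror_word 1 m))) (rootB n i) \<notin> posB"
      if "i \<in> {1..n}" for i
      unfolding total using that by (intro mirror_word_neg n) auto
    show "\<exists>j\<in>{1..m}. i \<in> set (stretch_word m n j)" if "i \<in> {1..n}" for i
      using that assms set_palindrome_word[OF assms(2)]
      by (intro bexI[of _ "min i m"]) (auto simp: stretch_word_def)
  qed
  show ?thesis by (rule exists_strict_parabolic)
qed

section \<open>Dihedral groups\<close>

text \<open>\<open>x \<in> {0..<2 * r}\<close> stands for the root at angle \<open>\<pi> * x / r\<close>; other integers are fixed.\<close>

definition sI :: "nat \<Rightarrow> nat \<Rightarrow> int \<Rightarrow> int" where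
  "sI r i x = (if 0 \<le> x \<and> x < 2 * int r
    then ((if i = 1 then int r else int r - 2) - x) mod (2 * int r) else x)"

text \<open>The simple roots are the two ends of the half circle \<open>posI r\<close> of positive
  roots.\<close>

definition rootI :: "nat \<Rightarrow> nat \<Rightarrow> int" where
  "rootI r i = (if i = 1 then 0 else int r - 1)"

definition posI :: "nat \<Rightarrow> int set" where
  "posI r = {0..<int r}"

lemma alt_word_double: "alt_word (2 * k) i j = concat (replicate k [i, j])"
  by (induction k) auto

lemma sI_linear:
  assumes "2 \<le> r"
  shows "sI r i x = (let c = (if i = 1 then int r else int r - 2) in
    if 0 \<le> x \<and> x \<le> c then c - x else if c < x \<and> x < 2 * int r then c + 2 * int r - x else x)"
proof -
  define c where "c = (if i = 1 then int r else int r - 2)"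
  have c: "0 \<le> c" "c < 2 * int r" using assms by (simp_all add: c_def)
  have "(c - x) mod (2 * int r) = (if x \<le> c then c - x else c + 2 * int r - x)"
    if "0 \<le> x" "x < 2 * int r"
  proof (cases "x \<le> c")
    case True
    then show ?thesis using that c by simp
  next
    case False
    then have "(c - x + 2 * int r) mod (2 * int r) = c - x + 2 * int r"
      using that c by (intro mod_pos_pos_trivial) auto
    then show ?thesis using False by simp
  qed
  then show ?thesis using c unfolding sI_def c_def[symmetric] Let_def by auto
qed

lemma sI_range: "2 \<le> r \<Longrightarrow> 0 \<le> x \<Longrightarrow> x < 2 * int r \<Longrightarrow> 0 \<le> sI r i x \<and> sI r i x < 2 * int r"
  by (simp add: sI_def)

lemma sI_sI:
  assumes "2 \<le> r"
  shows "sI r i (sI r i x) = x"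
proof -
  define c where "c = (if i = 1 then int r else int r - 2)"
  have c: "0 \<le> c" "c < 2 * int r" using assms by (simp_all add: c_def)
  have "sI r i y = (if 0 \<le> y \<and> y \<le> c then c - y
      else if c < y \<and> y < 2 * int r then c + 2 * int r - y else y)" for y
    using sI_linear[OF assms] unfolding c_def Let_def .
  then show ?thesis using c by auto
qed

lemma ev_sI_range:
  "2 \<le> r \<Longrightarrow> 0 \<le> x \<Longrightarrow> x < 2 * int r \<Longrightarrow> 0 \<le> ev (sI r) u x \<and> ev (sI r) u x < 2 * int r"
  by (induction u) (auto simp: sI_range)

text \<open>Both products of the two reflections rotate the \<open>2 * r\<close> roots by two steps,
  in opposite directions.\<close>

lemma sI_rotation:
  assumes "2 \<le> r" "0 \<le> x" "x < 2 * int r"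
  shows "((sI r 1 \<circ> sI r 2) ^^ k) x = (x + 2 * int k) mod (2 * int r)"
    and "((sI r 2 \<circ> sI r 1) ^^ k) x = (x - 2 * int k) mod (2 * int r)"
proof -
  have 1: "sI r 1 (sI r 2 y) = (y + 2) mod (2 * int r)" and 2: "sI r 2 (sI r 1 y) = (y - 2) mod (2 * int r)"
    if "0 \<le> y" "y < 2 * int r" for y
    using that sI_range[OF assms(1) that, of 1] sI_range[OF assms(1) that, of 2]
    by (simp_all add: sI_def mod_diff_right_eq add.commute)
  have mod_range: "0 \<le> y mod (2 * int r)" "y mod (2 * int r) < 2 * int r" for y
    using assms(1) by simp_all
  show "((sI r 1 \<circ> sI r 2) ^^ k) x = (x + 2 * int k) mod (2 * int r)"
  proof (induction k)
    case (Suc k)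
    have "((sI r 1 \<circ> sI r 2) ^^ Suc k) x = sI r 1 (sI r 2 ((x + 2 * int k) mod (2 * int r)))"
      by (simp only: funpow.simps comp_apply Suc)
    also have "\<dots> = ((x + 2 * int k) mod (2 * int r) + 2) mod (2 * int r)"
      by (rule 1[OF mod_range])
    also have "\<dots> = (x + 2 * int k + 2) mod (2 * int r)" by (rule mod_add_left_eq)
    also have "\<dots> = (x + 2 * int (Suc k)) mod (2 * int r)" by (simp add: algebra_simps)
    finally show ?case .
  qed (use assms in simp)
  show "((sI r 2 \<circ> sI r 1) ^^ k) x = (x - 2 * int k) mod (2 * int r)"
  proof (induction k)
    case (Suc k)
    have "((sI r 2 \<circ> sI r 1) ^^ Suc k) x = sI r 2 (sI r 1 ((x - 2 * int k) mod (2 * int r)))"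
      by (simp only: funpow.simps comp_apply Suc)
    also have "\<dots> = ((x - 2 * int k) mod (2 * int r) - 2) mod (2 * int r)"
      by (rule 2[OF mod_range])
    also have "\<dots> = (x - 2 * int k - 2) mod (2 * int r)" by (rule mod_diff_left_eq)
    also have "\<dots> = (x - 2 * int (Suc k)) mod (2 * int r)" by (simp add: algebra_simps)
    finally show ?case .
  qed (use assms in simp)
qed

lemma sI_outside: "\<not> (0 \<le> x \<and> x < 2 * int r) \<Longrightarrow> ev (sI r) u x = x"
  by (induction u) (auto simp: sI_def)

lemma sI_power_outside: "\<not> (0 \<le> x \<and> x < 2 * int r) \<Longrightarrow> ((sI r i \<circ> sI r j) ^^ k) x = x"
  using sI_outside[of x r "concat (replicate k [i, j])"] by (simp add: ev_replicate_pair)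

text \<open>The reflection in the root at position \<open>a\<close>: orientation reversing, and
  sending \<open>a\<close> to its opposite \<open>a + r\<close>. Its equivariance
  \<open>ev_reflI\<close> yields the axiom \<open>conj\<close>.\<close>

definition reflI :: "nat \<Rightarrow> int \<Rightarrow> int \<Rightarrow> int" where
  "reflI r a x = (2 * a + int r - x) mod (2 * int r)"

lemma ev_reflI:
  assumes "2 \<le> r" "0 \<le> a" "a < 2 * int r" "0 \<le> x" "x < 2 * int r"
  shows "ev (sI r) u (reflI r a x) = reflI r (ev (sI r) u a) (ev (sI r) u x)"
proof (induction u)
  case (Cons i u)
  let ?c = "if i = 1 then int r else int r - 2"
  have step: "sI r i (reflI r b y) = reflI r (sI r i b) (sI r i y)"
    if "0 \<le> b" "b < 2 * int r" "0 \<le> y" "y < 2 * int r" for b y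
  proof -
    have "0 \<le> reflI r b y \<and> reflI r b y < 2 * int r" using assms(1) by (simp add: reflI_def)
    then have "sI r i (reflI r b y) = (?c - (2 * b + int r - y) mod (2 * int r)) mod (2 * int r)"
      unfolding reflI_def by (simp only: sI_def if_True simp_thms)
    also have "\<dots> = (?c - (2 * b + int r - y)) mod (2 * int r)" by (rule mod_diff_right_eq)
    also have "\<dots> = (2 * (?c - b) + int r - (?c - y)) mod (2 * int r)"
      by (simp add: mod_eq_dvd_iff algebra_simps)
    also have "\<dots> = (2 * ((?c - b) mod (2 * int r)) + int r - (?c - y) mod (2 * int r)) mod (2 * int r)"
      by (intro mod_diff_cong mod_add_cong mod_mult_cong) simp_all
    also have "\<dots> = reflI r (sI r i b) (sI r i y)" using that by (simp add: sI_def reflI_def)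
    finally show ?thesis .
  qed
  have "ev (sI r) u a \<ge> 0 \<and> ev (sI r) u a < 2 * int r" "ev (sI r) u x \<ge> 0 \<and> ev (sI r) u x < 2 * int r"
    using ev_sI_range assms by auto
  then show ?case using Cons step by simp
qed simp

lemma sI_reflI:
  "2 \<le> r \<Longrightarrow> 0 \<le> x \<Longrightarrow> x < 2 * int r \<Longrightarrow> i = 1 \<or> i = 2 \<Longrightarrow> sI r i x = reflI r (rootI r i) x"
proof -
  assume a: "2 \<le> r" "0 \<le> x" "x < 2 * int r" "i = 1 \<or> i = 2"
  have "(int r - 2 - x) mod (2 * int r) = (2 * (int r - 1) + int r - x) mod (2 * int r)"
    by (simp add: mod_eq_dvd_iff algebra_simps)
  then show ?thesis using a by (auto simp: sI_def reflI_def rootI_def)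
qed

text \<open>As \<open>k\<close> grows, the alternating words enumerate the positive roots one by
  one, from either end of the half circle; this gives \<open>alt_pos\<close>.\<close>

lemma ev_sI_alt_root:
  assumes "2 \<le> r" "k < r"
  shows "ev (sI r) (alt_word k 1 2) (rootI r (if even k then 1 else 2)) = int k
    \<and> ev (sI r) (alt_word k 2 1) (rootI r (if even k then 2 else 1)) = int r - 1 - int k"
  using assms(2)
proof (induction k)
  case (Suc k)
  have "sI r 1 (int r - 1 - int k) = int (Suc k)" "sI r 2 (int k) = int r - 1 - int (Suc k)"
    using assms(1) Suc.prems by (simp_all add: sI_linear Let_def)
  then show ?case using Suc by (simp split: if_splits)
qed (simp add: rootI_def)

definition negI :: "nat \<Rightarrow> int \<Rightarrow> int" where
  "negI r x = (if 0 \<le> x \<and> x < int r then x + int r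
    else if int r \<le> x \<and> x < 2 * int r then x - int r else x)"

lemma ev_negI: "2 \<le> r \<Longrightarrow> ev (sI r) u (negI r x) = negI r (ev (sI r) u x)"
proof (induction u)
  case (Cons i u)
  have "sI r i (negI r y) = negI r (sI r i y)" for y
    using Cons.prems by (simp add: sI_linear Let_def negI_def)
  then show ?case using Cons by simp
qed simp

lemma ev_sI_permutes:
  assumes "2 \<le> r"
  shows "ev (sI r) u permutes {0..<2 * int r}"
proof (induction u)
  case Nil
  then show ?case using permutes_id by (simp add: id_def)
next
  case (Cons i u)
  have "sI r i permutes {0..<2 * int r}"
  proof (rule bij_imp_permutes)
    show "bij_betw (sI r i) {0..<2 * int r} {0..<2 * int r}"
      by (rule bij_betw_byWitness[where f' = "sI r i"]) (use sI_sI sI_range assms in auto)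
    show "sI r i x = x" if "x \<notin> {0..<2 * int r}" for x
      using that by (auto simp: sI_def)
  qed
  then show ?case using permutes_compose[OF Cons] by (simp del: comp_apply)
qed

lemma coxeter_roots_I2:
  assumes r: "2 \<le> r"
  shows "coxeter_roots {1, 2} (cox_I2 (enat r)) (sI r) (posI r) (\<lambda>i. {rootI r i}) (rootI r)"
proof
  show "coxeter_matrix {1, 2} (cox_I2 (enat r))"
    using r by (auto simp: coxeter_matrix_def cox_I2_def numeral_eq_enat)
  show "cox_I2 (enat r) i j \<noteq> \<infinity>" for i j
    by (simp add: cox_I2_def one_enat_def)
  show "(sI r i \<circ> sI r j) ^^ k = id"
    if "i \<in> {1, 2}" "j \<in> {1, 2}" "cox_I2 (enat r) i j = enat k" for i j k
  proof (cases "i = j")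
    case True
    then have "k = 1" using that by (simp add: cox_I2_def one_enat_def)
    then show ?thesis using True sI_sI[OF r] by (simp add: fun_eq_iff)
  next
    case False
    then have k: "k = r" using that by (simp add: cox_I2_def)
    have "((sI r i \<circ> sI r j) ^^ k) x = x" for x
    proof (cases "0 \<le> x \<and> x < 2 * int r")
      case True
      moreover have "(x - 2 * int r) mod (2 * int r) = x mod (2 * int r)"
        by (simp add: mod_eq_dvd_iff)
      ultimately show ?thesis using that False sI_rotation[OF r, of x k] k by auto
    next
      case False
      then show ?thesis by (rule sI_power_outside)
    qed
    then show ?thesis by (simp add: fun_eq_iff)
  qed
  show "rootI r i \<in> {rootI r i}" for i by simp
  show "p \<in> posI r" if "p \<in> {rootI r i}" for i p
    using that r by (auto simp: rootI_def posI_def)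
  have s_root: "sI r i (rootI r i) = negI r (rootI r i)" if "i \<in> {1, 2}" for i
    using that r by (auto simp: rootI_def negI_def sI_linear Let_def)
  have neg: "negI r x \<notin> posI r" if "x \<in> posI r" for x
    using that by (simp add: negI_def posI_def)
  show "sI r i p \<notin> posI r" if "i \<in> {1, 2}" "p \<in> {rootI r i}" for i p
    using that s_root neg[of "rootI r i"] r by (auto simp: rootI_def posI_def)
  show "sI r i p \<in> posI r" if "i \<in> {1, 2}" "p \<in> posI r" "p \<notin> {rootI r i}" for i p
    using that r by (auto simp: rootI_def posI_def sI_linear Let_def)
  show "ev (sI r) u (sI r i p) \<notin> posI r"
    if "i \<in> {1, 2}" "p \<in> {rootI r i}" "ev (sI r) u p \<in> posI r" for i p u
    using that s_root ev_negI[OF r] neg by simp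
  show "ev (sI r) u \<circ> sI r i = sI r j \<circ> ev (sI r) u"
    if "i \<in> {1, 2}" "j \<in> {1, 2}" "p \<in> {rootI r i}" "ev (sI r) u p \<in> {rootI r j}" for i j p u
  proof
    fix x
    show "(ev (sI r) u \<circ> sI r i) x = (sI r j \<circ> ev (sI r) u) x"
    proof (cases "0 \<le> x \<and> x < 2 * int r")
      case True
      have "0 \<le> rootI r i" "rootI r i < 2 * int r" using r by (auto simp: rootI_def)
      then have "ev (sI r) u (reflI r (rootI r i) x) = reflI r (rootI r j) (ev (sI r) u x)"
        using ev_reflI[OF r, of "rootI r i" x u] True that by simp
      moreover have "0 \<le> ev (sI r) u x \<and> ev (sI r) u x < 2 * int r"
        using ev_sI_range r True by blast
      ultimately show ?thesis
        using sI_reflI[OF r, of x i] sI_reflI[OF r, of "ev (sI r) u x" j] True that by auto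
    next
      case False
      then show ?thesis using sI_outside[of x r u] sI_outside[of x r "[i]"] sI_outside[of x r "[j]"] by simp
    qed
  qed
  show "ev (sI r) (alt_word k i j) (rootI r (if even k then i else j)) \<in> posI r"
    if "i \<in> {1, 2}" "j \<in> {1, 2}" "i \<noteq> j" "enat k < cox_I2 (enat r) i j" for i j k
  proof -
    have k: "k < r" using that by (simp add: cox_I2_def)
    have "i = 1 \<and> j = 2 \<or> i = 2 \<and> j = 1" using that by auto
    then show ?thesis using ev_sI_alt_root[OF r k] k by (auto simp: posI_def)
  qed
  have "ev (sI r) ` lists {1, 2} \<subseteq> {g. g permutes {0..<2 * int r}}"
    using ev_sI_permutes[OF r] by blast
  then show "finite (ev (sI r) ` lists {1, 2})"
    by (rule finite_subset) (intro finite_permutations, simp)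
qed

section \<open>Alternating products along a path\<close>

text \<open>The product of the commuting \<open>tr a\<close>, \<open>tr (a + 2)\<close>, ... with
  indices below \<open>m\<close>. For \<open>a = 0\<close> and \<open>a = 1\<close> the exchanged
  pairs are the two classes of alternate edges of the path \<open>- m, ..., m - 1\<close>; the edge
  across the centre belongs to \<open>a = 0\<close>.\<close>

definition path_swap :: "int \<Rightarrow> int \<Rightarrow> int \<Rightarrow> int" where
  "path_swap m a x = (if 0 \<le> x
    then if m \<le> x \<or> x < a - 1 then x else if even (x - a) then x - 1 else if x + 1 < m then x + 1 else x
    else if x < - m \<or> - a < x then x else if even (x - a) then if - m \<le> x - 1 then x - 1 else x else x + 1)"

lemma path_swap_step:
  assumes "0 \<le> a" "a + 2 \<le> m"
  shows "tr a \<circ> path_swap m (a + 2) = path_swap m a"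
proof
  fix x
  have par: "even (x - (a + 2)) \<longleftrightarrow> even (x - a)" by simp
  consider "x = a - 1" | "x = a" | "x = - a - 1" | "x = - a" | "- a < x" "x < a - 1"
    | "a + 1 \<le> x" "odd (x - a)" | "a + 2 \<le> x" "even (x - a)" | "x = a + 1" "even (x - a)"
    | "x \<le> - a - 2" "even (x - a)" | "x \<le> - a - 3" "odd (x - a)" | "x = - a - 2" "odd (x - a)"
    by linarith
  then show "(tr a \<circ> path_swap m (a + 2)) x = path_swap m a x"
  proof cases
    case 6
    then have "path_swap m (a + 2) x = path_swap m a x \<and> a + 1 \<le> path_swap m a x"
      unfolding path_swap_def par using assms by simp
    then show ?thesis using assms by (simp add: tr_def)
  next
    case 7
    then have "path_swap m (a + 2) x = path_swap m a x \<and> a + 1 \<le> path_swap m a x"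
      unfolding path_swap_def par using assms by simp
    then show ?thesis using assms by (simp add: tr_def)
  next
    case 9
    then have "path_swap m (a + 2) x = path_swap m a x \<and> path_swap m a x \<le> - a - 2"
      unfolding path_swap_def par using assms by simp
    then show ?thesis using assms by (simp add: tr_def)
  next
    case 10
    then have "path_swap m (a + 2) x = path_swap m a x \<and> path_swap m a x \<le> - a - 2"
      unfolding path_swap_def par using assms by simp
    then show ?thesis using assms by (simp add: tr_def)
  qed (use assms in \<open>simp_all add: path_swap_def tr_def\<close>)
qed

lemma ev_down2_word: "l \<le> m \<Longrightarrow> ev (tB m) (down2_word l) = path_swap (int m) (int m - int l)"
proof (induction l rule: down2_word.induct)
  case 1
  have "path_swap (int m) (int m) x = x" for x
  proof (cases "x = int m - 1 \<or> x = - int m")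
    case False
    then show ?thesis by (simp add: path_swap_def)
  qed (auto simp: path_swap_def)
  then show ?case by (simp add: fun_eq_iff)
next
  case 2
  have "tr (int m - 1) x = path_swap (int m) (int m - 1) x" for x
  proof (cases "x = int m - 1 \<or> x = int m - 2 \<or> x = - int m \<or> x = 1 - int m")
    case False
    then show ?thesis by (simp add: path_swap_def tr_def)
  qed (use 2 in \<open>auto simp: path_swap_def tr_def\<close>)
  then show ?case by (simp add: tB_def fun_eq_iff)
next
  case (3 k)
  have "ev (tB m) (down2_word (Suc (Suc k))) = tr (int m - int (Suc (Suc k))) \<circ> path_swap (int m) (int m - int k)"
    using 3 by (simp add: tB_def[of m "Suc (Suc k)"])
  also have "int m - int k = (int m - int (Suc (Suc k))) + 2" by simp
  also have "tr (int m - int (Suc (Suc k))) \<circ> path_swap (int m) ((int m - int (Suc (Suc k))) + 2)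
      = path_swap (int m) (int m - int (Suc (Suc k)))"
    using 3 by (intro path_swap_step) auto
  finally show ?case .
qed

text \<open>Reflecting the integers at both ends of the interval \<open>{- m..<m}\<close> turns the two swaps
  into translations by \<open>\<plusminus>1\<close>, so that their product becomes a translation by \<open>\<plusminus>2\<close>.\<close>

definition fold_path :: "int \<Rightarrow> int \<Rightarrow> int" where
  "fold_path m z = (if m \<le> z then 2 * m - 1 - z else if z < - m then - 2 * m - 1 - z else z)"

text \<open>The bound \<open>3 * m\<close> is where a second reflection would be needed. It is
  sufficient: up to \<open>m\<close> double steps from a point of the path move at most
  \<open>2 * m\<close> away.\<close>

lemma path_swap_fold:
  assumes "2 \<le> m" "- 3 * m \<le> z" "z < 3 * m" "a = 0 \<or> a = 1"
  shows "even (z - a) \<Longrightarrow> - 3 * m \<le> z - 1 \<Longrightarrow> path_swap m a (fold_path m z) = fold_path m (z - 1)"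
    and "odd (z - a) \<Longrightarrow> z + 1 < 3 * m \<Longrightarrow> path_swap m a (fold_path m z) = fold_path m (z + 1)"
proof -
  consider "m \<le> z" | "z < - m" | "- m \<le> z" "z < m" by linarith
  note cases = this
  show "path_swap m a (fold_path m z) = fold_path m (z - 1)" if "even (z - a)" "- 3 * m \<le> z - 1"
    using cases
  proof cases
    case 1
    then have "odd (2 * m - 1 - z - a)" using that by simp
    then show ?thesis using 1 assms by (auto simp: path_swap_def fold_path_def)
  next
    case 2
    then have "odd (- 2 * m - 1 - z - a)" using that by simp
    then show ?thesis using 2 assms that by (auto simp: path_swap_def fold_path_def)
  next
    case 3
    then show ?thesis using assms that by (auto simp: path_swap_def fold_path_def)
  qed
  show "path_swap m a (fold_path m z) = fold_path m (z + 1)" if "odd (z - a)" "z + 1 < 3 * m"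
    using cases
  proof cases
    case 1
    then have "even (2 * m - 1 - z - a)" using that by simp
    then show ?thesis using 1 assms that by (auto simp: path_swap_def fold_path_def)
  next
    case 2
    then have "even (- 2 * m - 1 - z - a)" using that by simp
    then show ?thesis using 2 assms by (auto simp: path_swap_def fold_path_def)
  next
    case 3
    then show ?thesis using assms that by (auto simp: path_swap_def fold_path_def)
  qed
qed

lemma path_swap_power:
  assumes m: "2 \<le> m" and a: "a = 0 \<and> b = 1 \<or> a = 1 \<and> b = 0" and x: "- int m \<le> x" "x < int m" and "k \<le> m"
  shows "((path_swap (int m) a \<circ> path_swap (int m) b) ^^ k) x
    = fold_path (int m) (if even (x - b) then x - 2 * int k else x + 2 * int k)"
  using \<open>k \<le> m\<close>
proof (induction k)
  case 0
  then show ?case using x by (simp add: fold_path_def)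
next
  case (Suc k)
  define z where "z = (if even (x - b) then x - 2 * int k else x + 2 * int k)"
  have z: "- 3 * int m \<le> z" "z < 3 * int m" "even (z - b) \<longleftrightarrow> even (x - b)"
    using x Suc.prems by (auto simp: z_def)
  have IH: "((path_swap (int m) a \<circ> path_swap (int m) b) ^^ Suc k) x
      = path_swap (int m) a (path_swap (int m) b (fold_path (int m) z))"
    unfolding z_def by (simp only: funpow.simps comp_apply Suc.IH[OF Suc_leD[OF Suc.prems]])
  have ab: "even (y - a) \<longleftrightarrow> odd (y - b)" for y using a by auto
  show ?case
  proof (cases "even (x - b)")
    case True
    then have zz: "- 3 * int m \<le> z - 2" "z < 3 * int m" using x Suc.prems by (auto simp: z_def)
    have "path_swap (int m) b (fold_path (int m) z) = fold_path (int m) (z - 1)"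
      by (rule path_swap_fold(1)) (use m a z zz True in auto)
    moreover have "path_swap (int m) a (fold_path (int m) (z - 1)) = fold_path (int m) (z - 1 - 1)"
      by (rule path_swap_fold(1)) (use m a z zz True ab[of "z - 1"] in auto)
    ultimately show ?thesis unfolding IH using True by (simp add: z_def algebra_simps)
  next
    case False
    then have zz: "z + 2 < 3 * int m" "- 3 * int m \<le> z" using x Suc.prems by (auto simp: z_def)
    have "path_swap (int m) b (fold_path (int m) z) = fold_path (int m) (z + 1)"
      by (rule path_swap_fold(2)) (use m a z zz False in auto)
    moreover have "path_swap (int m) a (fold_path (int m) (z + 1)) = fold_path (int m) (z + 1 + 1)"
      by (rule path_swap_fold(2)) (use m a z zz False ab[of "z + 1"] in auto)
    ultimately show ?thesis unfolding IH using False by (simp add: z_def algebra_simps)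
  qed
qed

text \<open>Translation by \<open>2 * m\<close> and by \<open>- 2 * m\<close> both fold to
  \<open>- 1 - x\<close>. So the two orders of multiplication agree, which is the braid relation of
  length \<open>2 * m\<close>.\<close>

lemma path_swap_full_power:
  assumes "2 \<le> m" "a = 0 \<and> b = 1 \<or> a = 1 \<and> b = 0"
  shows "(path_swap (int m) a \<circ> path_swap (int m) b) ^^ m = mirror (int m)"
proof
  fix x
  show "((path_swap (int m) a \<circ> path_swap (int m) b) ^^ m) x = mirror (int m) x"
  proof (cases "- int m \<le> x \<and> x < int m")
    case True
    then show ?thesis
      using path_swap_power[OF assms, of x m] by (auto simp: mirror_def fold_path_def)
  next
    case False
    then have fixed: "path_swap (int m) a x = x" "path_swap (int m) b x = x"
      by (auto simp: path_swap_def)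
    have "((path_swap (int m) a \<circ> path_swap (int m) b) ^^ k) x = x" for k
      by (induction k) (use fixed in auto)
    then show ?thesis using False by (auto simp: mirror_def)
  qed
qed

lemma set_down2_word: "set (down2_word l) = {i. 1 \<le> i \<and> i \<le> l \<and> even (l - i)}"
proof (induction l rule: down2_word.induct)
  case (3 k)
  have "{i. 1 \<le> i \<and> i \<le> Suc (Suc k) \<and> even (Suc (Suc k) - i)}
      = insert (Suc (Suc k)) {i. 1 \<le> i \<and> i \<le> k \<and> even (k - i)}"
    by (auto simp: le_Suc_eq Suc_diff_le)
  then show ?case using 3 by simp
qed (auto simp: le_Suc_eq)

lemma length_down2_word: "length (down2_word l) = Suc l div 2"
  by (induction l rule: down2_word.induct) auto

section \<open>The dihedral homomorphism\<close>

definition dihedral_word :: "nat \<Rightarrow> nat \<Rightarrow> nat \<Rightarrow> nat list" where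
  "dihedral_word m n i = (if i = 1 then palindrome_word m n @ down2_word (m - 2) else down2_word (m - 1))"

text \<open>Part (a) factors through (b): for \<open>m = n\<close> the images are the two products
  of alternate letters, and stretching replaces the letter \<open>m\<close> by the
  palindrome.\<close>

lemma dihedral_word_eq:
  assumes "2 \<le> m"
  shows "dihedral_word m n i = concat (map (stretch_word m n) (down2_word (if i = 1 then m else m - 1)))"
proof -
  have id: "concat (map (stretch_word m n) xs) = xs" if "\<forall>x\<in>set xs. x < m" for xs
    using that by (induction xs) (simp_all add: stretch_word_def)
  obtain l where m: "m = Suc (Suc l)" using assms nat_le_iff_add[of 2 m] by auto
  have "concat (map (stretch_word m n) (down2_word l)) = down2_word l"
    "concat (map (stretch_word m n) (down2_word (Suc l))) = down2_word (Suc l)"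
    by (intro id; auto simp: set_down2_word m)+
  then show ?thesis by (simp add: dihedral_word_def m stretch_word_def)
qed

lemma ev_dihedral_word:
  assumes "2 \<le> m" "m \<le> n"
  shows "ev (tB n) (dihedral_word m n i)
    = stretch (int n - int m) (path_swap (int m) (if i = 1 then 0 else 1))"
proof -
  have "down2_word (if i = 1 then m else m - 1) \<in> lists {1..m}"
    by (auto simp: set_down2_word)
  then show ?thesis
    unfolding dihedral_word_eq[OF assms(1)] ev_stretch_word[OF assms(2) \<open>_ \<in> _\<close>]
    using assms by (simp add: ev_down2_word)
qed

theorem dihedral_strict_parabolic:
  assumes "2 \<le> m" "m \<le> n"
  shows "\<exists>\<Phi>. strict_parabolic {1, 2} (cox_I2 (enat (2 * m))) {1..n} (cox_B n) \<Phi> \<and>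
    (\<forall>i\<in>{1, 2}. \<Phi> (T_word {1, 2} (cox_I2 (enat (2 * m))) [i]) = T_word {1..n} (cox_B n) (dihedral_word m n i))"
proof -
  have n: "2 \<le> n" and r: "2 \<le> 2 * m" using assms by simp_all
  define k where "k = int n - int m"
  have k: "k \<ge> 0" using assms by (simp add: k_def)
  let ?u0 = "mirror_word (Suc m) n" and ?f = "dihedral_word m n"
  have u0: "ev (tB n) ?u0 = mirror k" "set ?u0 = {Suc m..n}" "length ?u0 = (n - m)\<^sup>2"
    using mirror_word_props[of "Suc m" n] assms by (auto simp: k_def)
  interpret I2: coxeter_roots "{1, 2}" "cox_I2 (enat (2 * m))" "sI (2 * m)" "posI (2 * m)"
    "\<lambda>i. {rootI (2 * m) i}" "rootI (2 * m)"
    by (rule coxeter_roots_I2[OF r])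
  interpret BN: coxeter_roots "{1..n}" "cox_B n" "sB n" posB "DB n" "rootB n"
    by (rule coxeter_roots_B[OF n])
  have f_set: "set (?f 1) = {m..n} \<union> {i. 1 \<le> i \<and> i \<le> m - 2 \<and> even (m - 2 - i)}"
    "set (?f 2) = {i. 1 \<le> i \<and> i \<le> m - 1 \<and> even (m - 1 - i)}"
    using assms by (simp_all add: dihedral_word_def set_palindrome_word set_down2_word)
  have f_lists: "?f i \<in> lists {1..n}" if "i \<in> {1, 2}" for i
    using that f_set assms by auto
  have f_ev: "ev (tB n) (?f i) = stretch k (path_swap (int m) (if i = 1 then 0 else 1))" for i
    using ev_dihedral_word[OF assms] by (simp add: k_def)
  have alt: "ev (tB n) (concat (map ?f (alt_word (2 * m) i j))) = stretch k (mirror (int m))"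
    if "i \<in> {1, 2}" "j \<in> {1, 2}" "i \<noteq> j" for i j
  proof -
    have "ev (tB n) (concat (map ?f (concat (replicate l [i, j]))))
        = (ev (tB n) (?f i) \<circ> ev (tB n) (?f j)) ^^ l" for l
      by (induction l) (auto simp: ev_append comp_assoc)
    moreover have "(path_swap (int m) (if i = 1 then 0 else 1) \<circ> path_swap (int m) (if j = 1 then 0 else 1)) ^^ m
        = mirror (int m)"
      using that by (intro path_swap_full_power assms(1)) auto
    ultimately show ?thesis
      by (simp only: alt_word_double f_ev stretch_comp[OF k, symmetric] stretch_power[OF k, symmetric])
  qed
  let ?v0 = "alt_word (2 * m) 1 (2 :: nat)"
  have total_ev: "ev (tB n) (?u0 @ concat (map ?f ?v0)) = mirror (int n)"
    using alt[of 1 2] mirror_stretch[OF k, of "int m"] u0(1) by (simp add: ev_append k_def)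
  have "concat (map ?f ?v0) \<in> lists {1..n}"
    by (rule concat_map_lists[of "{1, 2}", OF f_lists], assumption, rule alt_word_lists) auto
  then have total_lists: "?u0 @ concat (map ?f ?v0) \<in> lists {1..n}"
    using mirror_word_lists[of "Suc m" n] assms(2) by simp
  have total_red: "redB n (?u0 @ concat (map ?f ?v0))"
  proof (rule redB_mirrorI[OF n total_lists total_ev])
    \<comment> \<open>With \<open>(n - m)^2\<close> letters from \<open>u0\<close> and
      \<open>m\<close> copies of this sum, the total is \<open>n^2\<close>, the number of positive
      roots.\<close>
    have "length (?f 1) + length (?f 2) = 2 * (n - m) + m"
      using assms by (simp add: dihedral_word_def length_palindrome_word length_down2_word)
    moreover have "length (concat (map ?f (concat (replicate l [1, 2])))) = l * (length (?f 1) + length (?f 2))" for l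
      by (induction l) auto
    ultimately have "length (?u0 @ concat (map ?f ?v0)) = (n - m)\<^sup>2 + m * (2 * (n - m) + m)"
      unfolding alt_word_double using u0(3) by simp
    also have "\<dots> = ((n - m) + m)\<^sup>2" by (simp add: power2_eq_square algebra_simps)
    finally show "length (?u0 @ concat (map ?f ?v0)) = n\<^sup>2" using assms(2) by simp
  qed
  have v0: "ev (sI (2 * m)) ?v0 = (sI (2 * m) 1 \<circ> sI (2 * m) 2) ^^ m"
    unfolding alt_word_double by (rule ev_replicate_pair)
  interpret parabolic_map "{1, 2}" "cox_I2 (enat (2 * m))" "sI (2 * m)" "posI (2 * m)"
    "\<lambda>i. {rootI (2 * m) i}" "rootI (2 * m)"
    "{1..n}" "cox_B n" "sB n" posB "DB n" "rootB n" ?f ?u0 ?v0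
  proof unfold_locales
    show "?f j \<in> lists {1..n}" if "j \<in> {1, 2}" for j using f_lists that .
    show "redB n ?u0" using assms by (intro redB_mirror_word n) auto
    show "ev (sB n) ?u0 (rootB n i) \<notin> posB" if "i \<in> set ?u0" for i
      using that u0(2) assms by (intro mirror_word_neg n) auto
    show "ev (sB n) (?u0 @ ?f j) (rootB n i) \<notin> posB"
      if j: "j \<in> {1, 2}" and i: "i \<in> set ?u0 \<union> set (?f j)" for j i
    proof -
      define a where "a = (if j = 1 then 0 else 1 :: int)"
      define e where "e = int n - int i"
      have ev: "ev (tB n) (?u0 @ ?f j) x = mirror k (stretch k (path_swap (int m) a) x)" for x
        by (simp add: ev_append u0(1) f_ev a_def)
      \<comment> \<open>Letters above \<open>m\<close> lie in the central block. The others lie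
        \<open>d\<close> steps beyond it, with the parity for which \<open>path_swap\<close>
        exchanges \<open>d - 1\<close> and \<open>d\<close>.\<close>
      have "0 \<le> e \<and> e < k \<or> (\<exists>d. e = k + d \<and> a \<le> d \<and> d < int m \<and> even (d - a))"
      proof (cases "m < i")
        case True
        then show ?thesis using i j u0(2) f_set assms by (auto simp: e_def k_def)
      next
        case False
        have "j = 1 \<or> j = 2" using j by auto
        then have "a \<le> int m - int i \<and> int m - int i < int m \<and> even (int m - int i - a)"
        proof
          assume "j = 1"
          then have "i = m \<or> 1 \<le> i \<and> i \<le> m - 2 \<and> even (m - 2 - i)"
            using i u0(2) f_set(1) False by auto
          then show ?thesis using \<open>j = 1\<close> assms by (auto simp: a_def)
        next
          assume "j = 2"
          then have "1 \<le> i \<and> i \<le> m - 1 \<and> even (m - 1 - i)"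
            using i u0(2) f_set(2) False by auto
          then show ?thesis using \<open>j = 2\<close> assms by (auto simp: a_def)
        qed
        then show ?thesis by (intro disjI2 exI[of _ "int m - int i"]) (simp add: e_def k_def)
      qed
      then have "\<not> mirror k (stretch k (path_swap (int m) a) (e - 1))
          < mirror k (stretch k (path_swap (int m) a) e)"
      proof
        assume "0 \<le> e \<and> e < k"
        then show ?thesis by (simp add: stretch_def mirror_def)
      next
        assume "\<exists>d. e = k + d \<and> a \<le> d \<and> d < int m \<and> even (d - a)"
        then obtain d where d: "e = k + d" "a \<le> d" "d < int m" "even (d - a)" by blast
        have a01: "a = 0 \<or> a = 1" by (simp add: a_def)
        show ?thesis
        proof (cases "d = 0")
          \<comment> \<open>The edge across the centre: after stretching, \<open>e - 1\<close> lies
            in the fixed block unless \<open>k = 0\<close>.\<close>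
          case True
          then have "a = 0" using d a01 by auto
          then have "path_swap (int m) a 0 = - 1" "path_swap (int m) a (- 1) = 0"
            using assms by (simp_all add: path_swap_def)
          then show ?thesis using True d k by (simp add: stretch_def mirror_def Let_def)
        next
          case False
          then have d1: "d \<ge> 1" using d a01 by auto
          have "path_swap (int m) a d = d - 1" using d d1 by (simp add: path_swap_def)
          moreover have "path_swap (int m) a (d - 1) = d" using d d1 by (simp add: path_swap_def)
          ultimately show ?thesis using d d1 k by (simp add: stretch_def mirror_def)
        qed
      qed
      then show ?thesis unfolding rootB_pos_iff ev e_def .
    qed
    show "ev (sB n) (concat (map ?f (alt_word l i j))) = ev (sB n) (concat (map ?f (alt_word l j i)))"
      if "i \<in> {1, 2}" "j \<in> {1, 2}" "i \<noteq> j" "cox_I2 (enat (2 * m)) i j = enat l" for i j l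
    proof -
      have "l = 2 * m" using that by (simp add: cox_I2_def)
      then show ?thesis
        unfolding ev_sB using alt[OF that(1-3)] alt[OF that(2,1)] that(3) by simp
    qed
    show "length (?f i) = length (?f j)"
      if "i \<in> {1, 2}" "j \<in> {1, 2}" "i \<noteq> j" "cox_I2 (enat (2 * m)) i j = enat l" "odd l" for i j l
      using that by (auto simp: cox_I2_def)
    show "I2.reduced ?v0"
      by (rule I2.reduced_alt_word) (auto simp: cox_I2_def)
    show "ev (sI (2 * m)) ?v0 (rootI (2 * m) j) \<notin> posI (2 * m)" if "j \<in> {1, 2}" for j
    proof -
      have "0 \<le> rootI (2 * m) j" "rootI (2 * m) j < int (2 * m)"
        using that assms by (auto simp: rootI_def)
      then show ?thesis
        unfolding v0 using sI_rotation(1)[OF r, of "rootI (2 * m) j" m]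
        by (simp add: posI_def)
    qed
    show "redB n (concat (map ?f ?v0))"
      by (rule BN.reduced_appendD(2)[OF total_red])
    show "ev (sB n) (?u0 @ concat (map ?f ?v0)) (rootB n i) \<notin> posB" if "i \<in> {1..n}" for i
      by (rule mirror_rootB[OF that total_ev])
    show "\<exists>j\<in>{1, 2}. i \<in> set (?f j)" if "i \<in> {1..n}" for i
    proof (cases "i < m \<and> odd (m - i)")
      case True
      then have "i \<in> set (?f 2)" using that unfolding f_set by (auto simp: even_diff_nat)
      then show ?thesis by blast
    next
      case False
      have "i \<in> set (?f 1)"
      proof (cases "m \<le> i")
        case True
        then show ?thesis using that unfolding f_set by simp
      next
        case i: False
        then obtain c where "m = i + 2 * c"
          using False by (metis evenE le_add_diff_inverse not_le_imp_less less_imp_le)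
        moreover have "c \<ge> 1" using i calculation by simp
        ultimately show ?thesis using that unfolding f_set by simp
      qed
      then show ?thesis by blast
    qed
  qed
  show ?thesis by (rule exists_strict_parabolic)
qed

section \<open>Longest elements of standard parabolic subgroups in type B\<close>

text \<open>Only the letter \<open>i\<close> with \<open>n - i\<close> equal to \<open>|c|\<close>
  exchanges points across the cut between \<open>c - 1\<close> and \<open>c\<close>.\<close>

lemma ev_tB_preserves_ge:
  assumes "u \<in> lists {1..n}" "\<And>i. i \<in> set u \<Longrightarrow> int n - int i \<noteq> \<bar>c\<bar>"
  shows "c \<le> ev (tB n) u x \<longleftrightarrow> c \<le> x"
  using assms
proof (induction u rule: list.induct)
  case (Cons i u)
  have "c \<le> tr d y \<longleftrightarrow> c \<le> y" if "d \<ge> 0" "d \<noteq> \<bar>c\<bar>" for d y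
    using that by (auto simp: tr_def)
  from this[of "int n - int i"] show ?case using Cons by (simp add: tB_def[of n i])
qed simp

text \<open>Strict decrease from the left end bounds the value from above, strict decrease towards
  the right end bounds it from below, and the bounds meet.\<close>

lemma decreasing_interval:
  fixes g :: "int \<Rightarrow> int"
  assumes "\<And>x. a \<le> x \<Longrightarrow> x \<le> b \<Longrightarrow> a \<le> g x \<and> g x \<le> b"
    and "\<And>x. a < x \<Longrightarrow> x \<le> b \<Longrightarrow> g x < g (x - 1)"
    and "a \<le> x" "x \<le> b"
  shows "g x = a + b - x"
proof -
  have le: "a + int j \<le> b \<Longrightarrow> g (a + int j) \<le> b - int j" for j
  proof (induction j)
    case (Suc j)
    then show ?case using assms(2)[of "a + int (Suc j)"] by (simp add: algebra_simps)
  qed (use assms(1) in simp)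
  have ge: "a \<le> b - int j \<Longrightarrow> a + int j \<le> g (b - int j)" for j
  proof (induction j)
    case (Suc j)
    then show ?case using assms(2)[of "b - int j"] by (simp add: algebra_simps)
  qed (use assms(1) in simp)
  show ?thesis using le[of "nat (x - a)"] ge[of "nat (b - x)"] assms(3,4) by simp
qed

text \<open>No letter crosses either end, so the interval is preserved, and the descents make the
  map decreasing on it. The absolute value appears because the cuts at \<open>c\<close> and
  \<open>- c\<close> belong to one letter. The case \<open>a = b\<close> yields fixed
  points.\<close>

lemma ev_tB_reversal:
  assumes u: "u \<in> lists {1..n}"
    and desc: "\<And>c. a < c \<Longrightarrow> c \<le> b \<Longrightarrow> \<bar>c\<bar> \<le> int n - 1 \<and> ev (sB n) u (rootB n (nat (int n - \<bar>c\<bar>))) \<notin> posB"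
    and bound: "\<And>i. i \<in> set u \<Longrightarrow> int n - int i \<noteq> \<bar>a\<bar> \<and> int n - int i \<noteq> \<bar>b + 1\<bar>"
    and x: "a \<le> x" "x \<le> b"
  shows "ev (tB n) u x = a + b - x"
proof (rule decreasing_interval[OF _ _ x])
  show "a \<le> ev (tB n) u x \<and> ev (tB n) u x \<le> b" if "a \<le> x" "x \<le> b" for x
    using ev_tB_preserves_ge[OF u, of a x] ev_tB_preserves_ge[OF u, of "b + 1" x] bound that by auto
  show "ev (tB n) u c < ev (tB n) u (c - 1)" if c: "a < c" "c \<le> b" for c
  proof -
    let ?d = "\<bar>c\<bar>"
    have "\<not> ev (tB n) u (?d - 1) < ev (tB n) u ?d"
    proof -
      have "int n - int (nat (int n - ?d)) = ?d" using desc[OF c] by simp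
      then show ?thesis using conjunct2[OF desc[OF c]] unfolding rootB_pos_iff by metis
    qed
    moreover have "ev (tB n) u (?d - 1) \<noteq> ev (tB n) u ?d" using ev_tB_inj[OF u] by simp
    ultimately have lt: "ev (tB n) u ?d < ev (tB n) u (?d - 1)" by simp
    show ?thesis
    proof (cases "c \<ge> 0")
      case True
      then show ?thesis using lt by simp
    next
      case False
      then have "c = - 1 - (?d - 1)" "c - 1 = - 1 - ?d" by simp_all
      then show ?thesis using lt ev_tB_odd[OF u, of "?d - 1"] ev_tB_odd[OF u, of ?d] by simp
    qed
  qed
qed

section \<open>Blowing up points to blocks\<close>

text \<open>\<open>g\<close> permutes the blocks rigidly: the position \<open>x mod m\<close> inside
  the block is kept.\<close>

definition blow :: "int \<Rightarrow> (int \<Rightarrow> int) \<Rightarrow> int \<Rightarrow> int" where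
  "blow m g x = m * g (x div m) + x mod m"

definition block_rev :: "int \<Rightarrow> int \<Rightarrow> int" where
  "block_rev m x = m * (x div m) + (m - 1 - x mod m)"

lemma block_cases:
  assumes "0 < (m :: int)"
  obtains q r where "x = m * q + r" "0 \<le> r" "r < m"
  using assms by (metis mult_div_mod_eq pos_mod_bound pos_mod_sign)

lemma blow_block: "0 \<le> r \<Longrightarrow> r < m \<Longrightarrow> blow m g (m * q + r) = m * g q + r"
  by (simp add: blow_def)

lemma block_rev_block: "0 \<le> r \<Longrightarrow> r < m \<Longrightarrow> block_rev m (m * q + r) = m * q + (m - 1 - r)"
  by (simp add: block_rev_def)

lemma blow_comp: "0 < m \<Longrightarrow> blow m (g \<circ> h) = blow m g \<circ> blow m h"
  by (simp add: blow_def fun_eq_iff)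

lemma blow_id: "0 < m \<Longrightarrow> blow m id = id"
  by (simp add: blow_def fun_eq_iff)

lemma block_le_iff:
  assumes "0 \<le> r" "r < m" "0 \<le> r'" "r' < (m :: int)"
  shows "m * q + r < m * q' + r' \<longleftrightarrow> q < q' \<or> q = q' \<and> r < r'"
proof -
  have *: "m * a + b < m * a' + b'" if "a < a'" "0 \<le> b'" "b < m" for a a' b b'
  proof -
    have "m * (a + 1) \<le> m * a'" using that assms by (intro mult_left_mono) auto
    then show ?thesis using that by (simp add: algebra_simps)
  qed
  consider "q < q'" | "q = q'" | "q' < q" by linarith
  then show ?thesis
    by cases (use *[of q q' r' r] *[of q' q r r'] assms in auto)
qed

lemma block_range_iff:
  assumes "0 \<le> r" "r < (m :: int)"
  shows "m * q + r < m * k \<longleftrightarrow> q < k" "m * k \<le> m * q + r \<longleftrightarrow> k \<le> q"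
  using block_le_iff[OF assms, of 0 q k] assms by auto

lemma blow_odd:
  assumes "0 < m" "\<And>x. g (- 1 - x) = - 1 - g x"
  shows "blow m g (- 1 - x) = - 1 - blow m g x"
proof -
  obtain q r where x: "x = m * q + r" "0 \<le> r" "r < m" by (rule block_cases[OF assms(1)])
  have e: "- 1 - x = m * (- 1 - q) + (m - 1 - r)" by (simp add: x algebra_simps)
  have "blow m g (- 1 - x) = m * g (- 1 - q) + (m - 1 - r)"
    unfolding e using x by (intro blow_block) auto
  then show ?thesis unfolding x(1) blow_block[OF x(2,3)] assms(2) by (simp add: algebra_simps)
qed

text \<open>All \<open>m^2\<close> pairs between two blocks weigh at least 1. If the blocks are
  opposite, the \<open>m\<close> pairs of opposite points weigh 2, which explains the new weights
  \<open>m^2 + m\<close> and \<open>m^2\<close>.\<close>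

lemma sum_antidiagonal:
  fixes m :: nat
  assumes "0 < m"
  shows "(\<Sum>p\<in>{0..<int m} \<times> {0..<int m}. wtB 2 1 (int m * q + fst p, int m * q' + snd p))
    = wtB (m\<^sup>2 + m) (m\<^sup>2) (q, q')"
proof -
  let ?A = "{0..<int m}"
  have iff: "int m * q + r + (int m * q' + r') = - 1 \<longleftrightarrow> q + q' = - 1 \<and> r' = int m - 1 - r"
    if "r \<in> ?A" "r' \<in> ?A" for r r'
  proof
    assume a: "int m * q + r + (int m * q' + r') = - 1"
    then have "int m * (q + q' + 1) = int m - 1 - r - r'" by (simp add: algebra_simps)
    moreover have "- int m < int m - 1 - r - r'" "int m - 1 - r - r' < int m" using that by auto
    ultimately have "int m * (- 1) < int m * (q + q' + 1)" "int m * (q + q' + 1) < int m * 1" by simp_all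
    then have "q + q' + 1 = 0" by (simp only: mult_less_cancel_left_pos assms of_nat_0_less_iff)
    then show "q + q' = - 1 \<and> r' = int m - 1 - r" using \<open>int m * (q + q' + 1) = _\<close> by simp
  next
    assume a: "q + q' = - 1 \<and> r' = int m - 1 - r"
    have "int m * q + r + (int m * q' + r') = int m * (q + q') + (r + r')" by (simp add: algebra_simps)
    also have "\<dots> = - 1" using a by simp
    finally show "int m * q + r + (int m * q' + r') = - 1" .
  qed
  have "(\<Sum>p\<in>?A \<times> ?A. wtB 2 1 (int m * q + fst p, int m * q' + snd p))
      = (\<Sum>r\<in>?A. \<Sum>r'\<in>?A. wtB 2 1 (int m * q + r, int m * q' + r'))"
    by (simp add: sum.cartesian_product case_prod_beta)
  also have "\<dots> = (\<Sum>r\<in>?A. \<Sum>r'\<in>?A. 1 + (if q + q' = - 1 then if r' = int m - 1 - r then 1 else 0 else 0))"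
    by (intro sum.cong HOL.refl) (simp add: wtB_def iff del: One_nat_def)
  also have "\<dots> = (\<Sum>r\<in>?A. m + (if q + q' = - 1 then 1 else 0))"
  proof (intro sum.cong HOL.refl)
    fix r assume "r \<in> ?A"
    then have "int m - 1 - r \<in> ?A" by auto
    then have "(\<Sum>r'\<in>?A. if r' = int m - 1 - r then 1 else (0 :: nat)) = 1"
      by (subst sum.delta) auto
    then show "(\<Sum>r'\<in>?A. 1 + (if q + q' = - 1 then if r' = int m - 1 - r then 1 else 0 else 0))
        = m + (if q + q' = - 1 then 1 else 0)"
      by (simp add: sum.distrib del: One_nat_def plus_1_eq_Suc)
  qed
  also have "\<dots> = wtB (m\<^sup>2 + m) (m\<^sup>2) (q, q')"
    by (simp add: wtB_def power2_eq_square)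
  finally show ?thesis .
qed

text \<open>Points of one block keep their order, so an inversion of the blown up map is an
  arbitrary pair of points from two inverted blocks.\<close>

lemma sum_invB_blow:
  fixes m :: nat
  assumes "0 < m" "\<And>x y. g x = g y \<longleftrightarrow> x = y" "finite (invB g)"
  shows "sum (wtB 2 1) (invB (blow (int m) g)) = sum (wtB (m\<^sup>2 + m) (m\<^sup>2)) (invB g)"
proof -
  let ?A = "{0..<int m}"
  define h where "h = (\<lambda>(p, r). (int m * fst p + fst r, int m * snd p + snd r) :: int \<times> int)"
  have m: "0 < int m" using assms(1) by simp
  have inj: "inj_on h (invB g \<times> (?A \<times> ?A))"
  proof (rule inj_onI)
    fix x y assume xy: "x \<in> invB g \<times> (?A \<times> ?A)" "y \<in> invB g \<times> (?A \<times> ?A)" "h x = h y"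
    obtain a b r t where x: "x = ((a, b), (r, t))" by (metis surj_pair)
    obtain a' b' r' t' where y: "y = ((a', b'), (r', t'))" by (metis surj_pair)
    have "int m * a + r = int m * a' + r'" "int m * b + t = int m * b' + t'"
      using xy(3) by (simp_all add: h_def x y)
    then have "(int m * a + r) div int m = (int m * a' + r') div int m"
      "(int m * a + r) mod int m = (int m * a' + r') mod int m"
      "(int m * b + t) div int m = (int m * b' + t') div int m"
      "(int m * b + t) mod int m = (int m * b' + t') mod int m" by simp_all
    then show "x = y" using xy(1,2) by (simp add: x y)
  qed
  have img: "invB (blow (int m) g) = h ` (invB g \<times> (?A \<times> ?A))"
  proof (intro equalityI subsetI)
    fix p assume p: "p \<in> invB (blow (int m) g)"
    obtain x y where xy: "p = (x, y)" by (metis surj_pair)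
    obtain q r where x: "x = int m * q + r" "0 \<le> r" "r < int m" by (rule block_cases[OF m])
    obtain q' r' where y: "y = int m * q' + r'" "0 \<le> r'" "r' < int m" by (rule block_cases[OF m])
    have "x < y" "\<not> blow (int m) g x < blow (int m) g y" using p by (auto simp: invB_def xy)
    then have "q < q' \<and> \<not> g q < g q'"
      using assms(2)[of q q'] unfolding x(1) y(1) blow_block[OF x(2,3)] blow_block[OF y(2,3)]
        block_le_iff[OF x(2,3) y(2,3)] by auto
    then have "((q, q'), (r, r')) \<in> invB g \<times> (?A \<times> ?A)" using x y by (simp add: invB_def)
    moreover have "p = h ((q, q'), (r, r'))" by (simp add: h_def xy x y)
    ultimately show "p \<in> h ` (invB g \<times> (?A \<times> ?A))" by blast
  next
    fix p assume "p \<in> h ` (invB g \<times> (?A \<times> ?A))"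
    then obtain q q' r r' where *: "(q, q') \<in> invB g" "r \<in> ?A" "r' \<in> ?A"
      "p = (int m * q + r, int m * q' + r')"
      by (auto simp: h_def)
    then have r: "0 \<le> r" "r < int m" "0 \<le> r'" "r' < int m" by auto
    have "q < q'" "\<not> g q < g q'" "g q \<noteq> g q'" using *(1) assms(2)[of q q'] by (auto simp: invB_def)
    then show "p \<in> invB (blow (int m) g)"
      using r by (simp add: *(4) invB_def blow_block block_le_iff)
  qed
  have "sum (wtB 2 1) (invB (blow (int m) g)) = (\<Sum>x\<in>invB g \<times> (?A \<times> ?A). wtB 2 1 (h x))"
    unfolding img using sum.reindex[OF inj, of "wtB 2 1"] by simp
  also have "\<dots> = (\<Sum>p\<in>invB g. \<Sum>r\<in>?A \<times> ?A. wtB 2 1 (h (p, r)))"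
    by (simp only: sum.cartesian_product) (rule sum.cong, auto)
  also have "\<dots> = sum (wtB (m\<^sup>2 + m) (m\<^sup>2)) (invB g)"
    by (intro sum.cong HOL.refl) (simp only: h_def split_conv sum_antidiagonal[OF assms(1)] prod.collapse)
  finally show ?thesis .
qed

section \<open>The block homomorphism\<close>

context
  fixes m n N :: nat
  assumes m: "2 \<le> m" and n: "2 \<le> n" and N_eq: "N = m * n"
begin

text \<open>The bound \<open>k <= N\<close> lets one formula serve all generators: for
  \<open>i = n\<close> it cuts the interval off at the last letter. \<open>block_sets\<close>
  recovers the intervals of the theorem.\<close>

definition "block_cent i = {k. (i - 1) * m < k \<and> k < (i + 1) * m \<and> k \<le> N}"

definition "block_off i = block_cent i - {i * m}"

text \<open>The letters acting inside single blocks; \<open>u0\<close> will be longest for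
  them.\<close>

definition "block_inner = {k \<in> {1..N}. \<not> m dvd k}"

lemma two_le_N: "2 \<le> N"
  using m n mult_le_mono[of 2 m 1 n] by (simp add: N_eq)

lemma int_N: "int N = int m * int n"
  by (simp add: N_eq)

interpretation BN: coxeter_roots "{1..N}" "cox_B N" "sB N" posB "DB N" "rootB N"
  by (rule coxeter_roots_B[OF two_le_N])

interpretation Bn: coxeter_roots "{1..n}" "cox_B n" "sB n" posB "DB n" "rootB n"
  by (rule coxeter_roots_B[OF n])

lemma m_pos: "0 < int m"
  using m by simp

text \<open>The position of the letter \<open>i * m\<close>: the cut between the two blocks that the
  image of \<open>T'_i\<close> exchanges.\<close>

definition "cent i = int m * (int n - int i)"

lemma cent_bounds:
  assumes "i \<in> {1..n}"
  shows "0 \<le> cent i" "cent i + int m \<le> int N" "cent i = 0 \<or> int m \<le> cent i"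
proof -
  define d where "d = int n - int i"
  have d: "0 \<le> d" "d + 1 \<le> int n" "d = 0 \<or> 1 \<le> d" using assms by (auto simp: d_def)
  show "0 \<le> cent i" using d(1) by (simp add: cent_def d_def)
  show "cent i + int m \<le> int N"
    using mult_left_mono[OF d(2), of "int m"] by (simp add: cent_def d_def int_N algebra_simps)
  show "cent i = 0 \<or> int m \<le> cent i"
    using d(3) mult_left_mono[of 1 d "int m"] by (auto simp: cent_def d_def)
qed

lemma block_cent_iff:
  assumes i: "i \<in> {1..n}" and "k \<le> N" and e: "e = int N - int k"
  shows "k \<in> block_cent i \<longleftrightarrow> cent i - int m < e \<and> e < cent i + int m"
proof -
  have "(i - 1) * m < k \<longleftrightarrow> int ((i - 1) * m) < int k" by (simp only: of_nat_less_iff)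
  also have "int ((i - 1) * m) = (int i - 1) * int m" using i by (simp add: of_nat_diff)
  finally have 1: "(i - 1) * m < k \<longleftrightarrow> (int i - 1) * int m < int k" .
  have "k < (i + 1) * m \<longleftrightarrow> int k < int ((i + 1) * m)" by (simp only: of_nat_less_iff)
  also have "int ((i + 1) * m) = (int i + 1) * int m" by (simp add: algebra_simps)
  finally have 2: "k < (i + 1) * m \<longleftrightarrow> int k < (int i + 1) * int m" .
  show ?thesis
    unfolding block_cent_def mem_Collect_eq 1 2 e int_N cent_def using assms(2)
    by (auto simp: algebra_simps)
qed

lemma block_cent_subset: "block_cent i \<subseteq> {1..N}"
  by (auto simp: block_cent_def)

lemma block_off_iff:
  assumes i: "i \<in> {1..n}" and "k \<le> N" and e: "e = int N - int k"
  shows "k \<in> block_off i \<longleftrightarrow> k \<in> block_cent i \<and> e \<noteq> cent i"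
proof -
  have "k = i * m \<longleftrightarrow> int k = int (i * m)" by (simp only: of_nat_eq_iff)
  then have "k = i * m \<longleftrightarrow> e = cent i" by (auto simp: e int_N cent_def algebra_simps)
  then show ?thesis by (auto simp: block_off_def)
qed

lemma index_abs:
  assumes "\<bar>c\<bar> \<le> int N - 1"
  shows "nat (int N - \<bar>c\<bar>) \<in> {1..N}" "\<bar>c\<bar> = int N - int (nat (int N - \<bar>c\<bar>))"
  using assms by (auto simp: nat_le_iff)

lemma block_inner_ev:
  assumes u: "BN.longest block_inner u" and x: "- int N \<le> x" "x < int N"
  shows "ev (tB N) u x = block_rev (int m) x"
proof -
  have sub: "block_inner \<subseteq> {1..N}" by (auto simp: block_inner_def)
  have ul: "u \<in> lists block_inner" "u \<in> lists {1..N}"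
    using u BN.reduced_lists unfolding BN.longest_def by blast+
  obtain q r where q: "x = int m * q + r" "0 \<le> r" "r < int m" by (rule block_cases[OF m_pos])
  have qn: "- int n \<le> q" "q < int n"
    using x block_range_iff(1)[OF q(2,3), of q "int n"] block_range_iff(2)[OF q(2,3), of "- int n" q]
    unfolding q(1) int_N by simp_all
  have inner: "k \<in> block_inner \<longleftrightarrow> k \<in> {1..N} \<and> \<not> int m dvd int N - int k" for k
    by (simp add: block_inner_def int_N dvd_diff_right_iff int_dvd_int_iff)
  have "ev (tB N) u x = int m * q + (int m * q + int m - 1) - x"
  proof (rule ev_tB_reversal[OF ul(2)])
    show "\<bar>c\<bar> \<le> int N - 1 \<and> ev (sB N) u (rootB N (nat (int N - \<bar>c\<bar>))) \<notin> posB"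
      if c: "int m * q < c" "c \<le> int m * q + int m - 1" for c
    proof
      define t where "t = c - int m * q"
      have t: "c = int m * q + t" "0 < t" "t < int m" using c by (simp_all add: t_def)
      have "c < int m * int n" "int m * (- int n) \<le> c"
        using block_range_iff(1)[of t "int m" q "int n"] block_range_iff(2)[of t "int m" "- int n" q] t qn
        by simp_all
      moreover have nd: "\<not> int m dvd c"
        using t zdvd_not_zless[of t "int m"] by (simp add: dvd_add_right_iff)
      moreover have "c \<noteq> int m * (- int n)" using nd by (metis dvd_triv_left)
      ultimately show c: "\<bar>c\<bar> \<le> int N - 1" unfolding int_N by simp
      have "nat (int N - \<bar>c\<bar>) \<in> block_inner"
        unfolding inner using index_abs[OF c] nd by (metis dvd_abs_iff)
      then show "ev (sB N) u (rootB N (nat (int N - \<bar>c\<bar>))) \<notin> posB"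
        by (rule BN.longestD[OF sub u])
    qed
    show "int N - int k \<noteq> \<bar>int m * q\<bar> \<and> int N - int k \<noteq> \<bar>int m * q + int m - 1 + 1\<bar>"
      if "k \<in> set u" for k
    proof -
      have "\<not> int m dvd int N - int k" using that ul(1) inner by auto
      moreover have "int m dvd \<bar>int m * q\<bar>" "int m dvd \<bar>int m * q + int m - 1 + 1\<bar>" by simp_all
      ultimately show ?thesis by metis
    qed
    show "int m * q \<le> x" "x \<le> int m * q + int m - 1" using q by simp_all
  qed
  then show ?thesis unfolding q(1) block_rev_block[OF q(2,3)] by simp
qed

text \<open>Fixed points are claimed only for \<open>0 <= x\<close>, since the opposite interval
  moves as well; \<open>block_swap_ev\<close> treats negative points by oddness.\<close>

lemma block_cent_ev:
  assumes i: "i \<in> {1..n}" and u: "BN.longest (block_cent i) u"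
  shows "cent i - int m \<le> x \<Longrightarrow> x < cent i + int m \<Longrightarrow> ev (tB N) u x = 2 * cent i - 1 - x"
    and "0 \<le> x \<Longrightarrow> \<not> (cent i - int m \<le> x \<and> x < cent i + int m) \<Longrightarrow> ev (tB N) u x = x"
proof -
  have ul: "u \<in> lists (block_cent i)" "u \<in> lists {1..N}"
    using u BN.reduced_lists unfolding BN.longest_def by blast+
  have cent: "cent i - int m < int N - int k \<and> int N - int k < cent i + int m" if "k \<in> set u" for k
    using block_cent_iff[OF i _ HOL.refl, of k] ul that by auto
  note P = cent_bounds[OF i] m_pos
  show "ev (tB N) u x = 2 * cent i - 1 - x" if x: "cent i - int m \<le> x" "x < cent i + int m"
  proof -
    have "ev (tB N) u x = (cent i - int m) + (cent i + int m - 1) - x"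
    proof (rule ev_tB_reversal[OF ul(2)])
      show "\<bar>c\<bar> \<le> int N - 1 \<and> ev (sB N) u (rootB N (nat (int N - \<bar>c\<bar>))) \<notin> posB"
        if c: "cent i - int m < c" "c \<le> cent i + int m - 1" for c
      proof
        show cN: "\<bar>c\<bar> \<le> int N - 1" using c P by linarith
        have "cent i - int m < \<bar>c\<bar>" "\<bar>c\<bar> < cent i + int m"
          using c P by linarith+
        then have "nat (int N - \<bar>c\<bar>) \<in> block_cent i"
          using block_cent_iff[OF i _ index_abs(2)[OF cN]] index_abs(1)[OF cN] by simp
        then show "ev (sB N) u (rootB N (nat (int N - \<bar>c\<bar>))) \<notin> posB"
          by (rule BN.longestD[OF block_cent_subset u])
      qed
      show "int N - int k \<noteq> \<bar>cent i - int m\<bar> \<and> int N - int k \<noteq> \<bar>cent i + int m - 1 + 1\<bar>"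
        if "k \<in> set u" for k
        using cent[OF that] P by linarith
      show "cent i - int m \<le> x" "x \<le> cent i + int m - 1" using x by simp_all
    qed
    then show ?thesis by simp
  qed
  show "ev (tB N) u x = x" if x: "0 \<le> x" "\<not> (cent i - int m \<le> x \<and> x < cent i + int m)"
  proof -
    \<comment> \<open>Reversal of the one-point interval \<open>[x, x]\<close>.\<close>
    have "ev (tB N) u x = x + x - x"
    proof (rule ev_tB_reversal[OF ul(2)])
      show "int N - int k \<noteq> \<bar>x\<bar> \<and> int N - int k \<noteq> \<bar>x + 1\<bar>" if "k \<in> set u" for k
        using cent[OF that] x by linarith
    qed auto
    then show ?thesis by simp
  qed
qed

lemma block_off_ev:
  assumes i: "i \<in> {1..n}" and u: "BN.longest (block_off i) u"
  shows "cent i - int m \<le> x \<Longrightarrow> x < cent i + int m \<Longrightarrow> ev (tB N) u x = block_rev (int m) x"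
    and "0 \<le> x \<Longrightarrow> \<not> (cent i - int m \<le> x \<and> x < cent i + int m) \<Longrightarrow> ev (tB N) u x = x"
proof -
  have sub: "block_off i \<subseteq> {1..N}" using block_cent_subset by (auto simp: block_off_def)
  have ul: "u \<in> lists (block_off i)" "u \<in> lists {1..N}"
    using u BN.reduced_lists unfolding BN.longest_def by blast+
  have off: "cent i - int m < int N - int k \<and> int N - int k < cent i + int m \<and> int N - int k \<noteq> cent i"
    if "k \<in> set u" for k
    using block_cent_iff[OF i _ HOL.refl, of k] block_off_iff[OF i _ HOL.refl, of k] ul that by auto
  note P = cent_bounds[OF i] m_pos
  show "ev (tB N) u x = block_rev (int m) x" if x: "cent i - int m \<le> x" "x < cent i + int m"
  proof -
    obtain q r where q: "x = int m * q + r" "0 \<le> r" "r < int m" by (rule block_cases[OF m_pos])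
    define d where "d = int n - int i"
    have cd: "cent i - int m = int m * (d - 1)" "cent i + int m = int m * (d + 1)" "cent i = int m * d"
      by (simp_all add: cent_def d_def algebra_simps)
    have "d - 1 \<le> q" "q < d + 1" using x block_range_iff[OF q(2,3)] unfolding q(1) cd(1,2) by simp_all
    then have "q = d - 1 \<or> q = d" by linarith
    then obtain Q where Q: "Q = int m * q" "Q = cent i - int m \<or> Q = cent i" using cd by auto
    have "ev (tB N) u x = Q + (Q + int m - 1) - x"
    proof (rule ev_tB_reversal[OF ul(2)])
      show "\<bar>c\<bar> \<le> int N - 1 \<and> ev (sB N) u (rootB N (nat (int N - \<bar>c\<bar>))) \<notin> posB"
        if c: "Q < c" "c \<le> Q + int m - 1" for c
      proof
        show cN: "\<bar>c\<bar> \<le> int N - 1" using c P Q(2) by linarith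
        have "cent i - int m < \<bar>c\<bar>" "\<bar>c\<bar> < cent i + int m" "\<bar>c\<bar> \<noteq> cent i"
          using c P Q(2) by linarith+
        then have "nat (int N - \<bar>c\<bar>) \<in> block_off i"
          using block_cent_iff[OF i _ index_abs(2)[OF cN]] block_off_iff[OF i _ index_abs(2)[OF cN]]
            index_abs(1)[OF cN] by simp
        then show "ev (sB N) u (rootB N (nat (int N - \<bar>c\<bar>))) \<notin> posB"
          by (rule BN.longestD[OF sub u])
      qed
      show "int N - int k \<noteq> \<bar>Q\<bar> \<and> int N - int k \<noteq> \<bar>Q + int m - 1 + 1\<bar>"
        if "k \<in> set u" for k
        using off[OF that] P Q(2) by linarith
      show "Q \<le> x" "x \<le> Q + int m - 1" using q Q(1) by simp_all
    qed
    then show ?thesis unfolding q(1) block_rev_block[OF q(2,3)] Q(1) by simp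
  qed
  show "ev (tB N) u x = x" if x: "0 \<le> x" "\<not> (cent i - int m \<le> x \<and> x < cent i + int m)"
  proof -
    have "ev (tB N) u x = x + x - x"
    proof (rule ev_tB_reversal[OF ul(2)])
      show "int N - int k \<noteq> \<bar>x\<bar> \<and> int N - int k \<noteq> \<bar>x + 1\<bar>" if "k \<in> set u" for k
        using off[OF that] x by linarith
    qed auto
    then show ?thesis by simp
  qed
qed

text \<open>First \<open>v\<close> reverses the union of two adjacent blocks, then \<open>u\<close>
  reverses each block separately: the blocks are exchanged and their inner order is
  restored.\<close>

lemma block_swap_ev:
  assumes i: "i \<in> {1..n}" and u: "BN.longest (block_off i) u" and v: "BN.longest (block_cent i) v"
  shows "ev (tB N) (u @ v) = blow (int m) (tB n i)"
proof
  define D where "D = int n - int i"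
  have D0: "0 \<le> D" using i by (simp add: D_def)
  have "u \<in> lists {1..N}" "v \<in> lists {1..N}"
    using u v BN.reduced_lists unfolding BN.longest_def by blast+
  then have uv: "u @ v \<in> lists {1..N}" by simp
  have pos: "ev (tB N) (u @ v) x = blow (int m) (tB n i) x" if x: "0 \<le> x" for x
  proof -
    obtain q r where q: "x = int m * q + r" "0 \<le> r" "r < int m" by (rule block_cases[OF m_pos])
    have q0: "0 \<le> q" using x block_range_iff(2)[OF q(2,3), of 0 q] unfolding q(1) by simp
    have rhs: "blow (int m) (tB n i) x = int m * tr D q + r"
      unfolding q(1) blow_block[OF q(2,3)] by (simp add: tB_def D_def)
    have cD: "cent i - int m = int m * (D - 1)" "cent i + int m = int m * (D + 1)" "cent i = int m * D"
      by (simp_all add: cent_def D_def algebra_simps)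
    have iff: "cent i - int m \<le> x \<and> x < cent i + int m \<longleftrightarrow> q = D - 1 \<or> q = D"
      unfolding q(1) cD(1,2) block_range_iff[OF q(2,3)] by auto
    show ?thesis
    proof (cases "q = D - 1 \<or> q = D")
      case True
      then have xr: "cent i - int m \<le> x" "x < cent i + int m" using iff by auto
      define p where "p = (if q = D then D - 1 else D)"
      have v_ev: "ev (tB N) v x = int m * p + (int m - 1 - r)"
        using block_cent_ev(1)[OF i v xr] True
        by (auto simp: q(1) p_def cD(3) algebra_simps)
      have r': "0 \<le> int m - 1 - r" "int m - 1 - r < int m" using q by simp_all
      have "D - 1 \<le> p" "p < D + 1" by (simp_all add: p_def)
      then have "ev (tB N) u (int m * p + (int m - 1 - r)) = block_rev (int m) (int m * p + (int m - 1 - r))"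
        by (intro block_off_ev(1)[OF i u]; unfold cD(1,2) block_range_iff[OF r'])
      also have "\<dots> = int m * p + r" unfolding block_rev_block[OF r'] by simp
      finally have "ev (tB N) (u @ v) x = int m * p + r" by (simp add: ev_append v_ev)
      moreover have "tr D q = p" using True D0 by (auto simp: p_def tr_values)
      ultimately show ?thesis using rhs by simp
    next
      case False
      then have nr: "\<not> (cent i - int m \<le> x \<and> x < cent i + int m)" using iff by simp
      have "ev (tB N) (u @ v) x = x"
        using block_cent_ev(2)[OF i v x nr] block_off_ev(2)[OF i u x nr]
        by (simp add: ev_append)
      moreover have "tr D q = q" using False D0 q0 by (simp add: tr_def)
      ultimately show ?thesis using rhs q(1) by simp
    qed
  qed
  fix x
  show "ev (tB N) (u @ v) x = blow (int m) (tB n i) x"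
  proof (cases "0 \<le> x")
    case True
    then show ?thesis by (rule pos)
  next
    case False
    define y where "y = - 1 - x"
    have y: "0 \<le> y" "x = - 1 - y" using False by (simp_all add: y_def)
    have "tB n i (- 1 - z) = - 1 - tB n i z" for z
      using tr_odd[OF D0] by (simp add: tB_def D_def)
    then have "blow (int m) (tB n i) (- 1 - y) = - 1 - blow (int m) (tB n i) y"
      by (rule blow_odd[OF m_pos])
    then show ?thesis unfolding y(2) ev_tB_odd[OF uv] pos[OF y(1)] by simp
  qed
qed

lemma exists_block_word:
  assumes i: "i \<in> {1..n}"
  shows "\<exists>w\<in>lists (block_cent i). redB N w \<and> ev (tB N) w = blow (int m) (tB n i) \<and>
    T_elem {1..N} (cox_B N) (w_rel {1..N} (cox_B N) (block_off i) (block_cent i)) = T_word {1..N} (cox_B N) w"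
proof -
  have sub: "block_off i \<subseteq> {1..N}" using block_cent_subset by (auto simp: block_off_def)
  obtain u where u: "BN.longest (block_off i) u" using BN.longest_exists[OF sub] by blast
  obtain v where v: "BN.longest (block_cent i) v" using BN.longest_exists[OF block_cent_subset] by blast
  have "u \<in> lists (block_off i)" "v \<in> lists (block_cent i)"
    using u v unfolding BN.longest_def by blast+
  then have uv: "u @ v \<in> lists (block_cent i)" by (auto simp: block_off_def)
  then obtain w where w: "w \<in> lists (block_cent i)" "redB N w" "ev (sB N) w = ev (sB N) (u @ v)"
    using BN.exists_reduced_in[OF block_cent_subset] by blast
  have "ev (tB N) w = ev (tB N) (u @ v)" using w(3) by (auto simp: ev_sB fun_eq_iff)
  then have "ev (tB N) w = blow (int m) (tB n i)" using block_swap_ev[OF i u v] by simp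
  moreover have "u @ v \<in> lists {1..N}" using uv block_cent_subset[of i] lists_mono by blast
  then have "s_word {1..N} (cox_B N) (u @ v) = s_word {1..N} (cox_B N) w"
    using BN.s_word_eq_iff BN.reduced_lists[OF w(2)] w(3) by metis
  then have "T_elem {1..N} (cox_B N) (w_rel {1..N} (cox_B N) (block_off i) (block_cent i)) = T_word {1..N} (cox_B N) w"
    unfolding BN.w_rel_eq[OF sub u block_cent_subset v] using BN.T_elem_s_word[OF w(2)] by simp
  ultimately show ?thesis using w by blast
qed

lemma two_length_block_word:
  assumes i: "i \<in> {1..n}" and w: "redB N w" "ev (tB N) w = blow (int m) (tB n i)"
  shows "2 * length w = (if i = n then m\<^sup>2 + m else 2 * m\<^sup>2)"
proof -
  have ti: "ev (tB n) [i] = tB n i" by simp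
  have red: "redB n [i]" by (rule Bn.reduced_singleton[OF i])
  have il: "[i] \<in> lists {1..n}" using i by simp
  have "2 * length w = sum (wtB 2 1) (invB (blow (int m) (tB n i)))"
    using two_length_B[OF two_le_N w(1)] w(2) by simp
  also have "\<dots> = sum (wtB (m\<^sup>2 + m) (m\<^sup>2)) (invB (tB n i))"
    using m ev_tB_inj[OF il] sum_invB(1)[OF n red] unfolding ti by (intro sum_invB_blow) auto
  also have "\<dots> = (if i = n then m\<^sup>2 + m else 2 * m\<^sup>2)"
    using sum_invB(2)[OF n red] unfolding ti by simp
  finally show ?thesis .
qed

lemma ev_block_word:
  assumes f: "\<And>i. i \<in> {1..n} \<Longrightarrow> ev (tB N) (f i) = blow (int m) (tB n i)" and u: "u \<in> lists {1..n}"
  shows "ev (tB N) (concat (map f u)) = blow (int m) (ev (tB n) u)"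
  using u
proof (induction u rule: list.induct)
  case Nil
  show ?case by (simp only: list.map concat.simps ev.simps blow_id[OF m_pos])
next
  case (Cons i u)
  have "ev (tB N) (f i) = blow (int m) (tB n i)" using f Cons.prems by simp
  moreover have "ev (tB N) (concat (map f u)) = blow (int m) (ev (tB n) u)" using Cons by simp
  ultimately show ?case
    by (simp only: list.map concat.simps ev.simps ev_append blow_comp[OF m_pos])
qed

theorem block_strict_parabolic:
  "\<exists>\<Phi>. strict_parabolic {1..n} (cox_B n) {1..N} (cox_B N) \<Phi> \<and>
    (\<forall>i\<in>{1..n}. \<Phi> (T_word {1..n} (cox_B n) [i]) =
      T_elem {1..N} (cox_B N) (w_rel {1..N} (cox_B N) (block_off i) (block_cent i)))"
proof -
  obtain f where f: "\<And>i. i \<in> {1..n} \<Longrightarrow> f i \<in> lists (block_cent i)" "\<And>i. i \<in> {1..n} \<Longrightarrow> redB N (f i)"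
    "\<And>i. i \<in> {1..n} \<Longrightarrow> ev (tB N) (f i) = blow (int m) (tB n i)"
    "\<And>i. i \<in> {1..n} \<Longrightarrow> T_elem {1..N} (cox_B N) (w_rel {1..N} (cox_B N) (block_off i) (block_cent i))
      = T_word {1..N} (cox_B N) (f i)"
  proof -
    let ?P = "\<lambda>i w. w \<in> lists (block_cent i) \<and> redB N w \<and> ev (tB N) w = blow (int m) (tB n i) \<and>
      T_elem {1..N} (cox_B N) (w_rel {1..N} (cox_B N) (block_off i) (block_cent i)) = T_word {1..N} (cox_B N) w"
    have "\<forall>i\<in>{1..n}. \<exists>w. ?P i w" using exists_block_word by blast
    then obtain f where "\<forall>i\<in>{1..n}. ?P i (f i)" by (rule bchoice[THEN exE])
    then show thesis using that[of f] by blast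
  qed
  have inner_sub: "block_inner \<subseteq> {1..N}" by (auto simp: block_inner_def)
  obtain u0 where u0: "BN.longest block_inner u0" using BN.longest_exists[OF inner_sub] by blast
  then have u0': "redB N u0" "set u0 \<subseteq> block_inner" unfolding BN.longest_def by auto
  have f_lists: "f i \<in> lists {1..N}" if "i \<in> {1..n}" for i
    using BN.reduced_lists[OF f(2)[OF that]] .
  have odd2: "2 * length (f i) = (if i = n then m\<^sup>2 + m else 2 * m\<^sup>2)" if "i \<in> {1..n}" for i
    by (rule two_length_block_word[OF that f(2,3)[OF that]])
  have ev_F: "ev (tB N) (concat (map f u)) = blow (int m) (ev (tB n) u)" if "u \<in> lists {1..n}" for u
    by (rule ev_block_word[OF f(3) that])
  have ev_u0: "ev (tB N) (u0 @ w) x = block_rev (int m) (ev (tB N) w x)"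
    if "w \<in> lists {1..N}" "- int N \<le> x" "x < int N" for w x
  proof -
    have "ev (tB N) w x \<in> {- int N..int N - 1}"
      using permutes_in_image[OF ev_tB_permutes[OF that(1)], of x] that by simp
    then show ?thesis using block_inner_ev[OF u0, of "ev (tB N) w x"] by (simp add: ev_append)
  qed
  let ?v0 = "mirror_word 1 n"
  have v0: "?v0 \<in> lists {1..n}" "ev (tB n) ?v0 = mirror (int n)"
    using mirror_word_lists[of 1 n] mirror_word_props[of 1 n] by simp_all
  have v0_red: "redB n ?v0" by (intro redB_mirror_word n) auto
  have fv0_lists: "concat (map f ?v0) \<in> lists {1..N}"
    by (rule concat_map_lists[OF f_lists v0(1)])
  interpret parabolic_map "{1..n}" "cox_B n" "sB n" posB "DB n" "rootB n"
    "{1..N}" "cox_B N" "sB N" posB "DB N" "rootB N" f u0 ?v0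
  proof unfold_locales
    show "f j \<in> lists {1..N}" if "j \<in> {1..n}" for j by (rule f_lists[OF that])
    show "redB N u0" by (rule u0'(1))
    show "ev (sB N) u0 (rootB N k) \<notin> posB" if "k \<in> set u0" for k
      using BN.longestD[OF inner_sub u0] that u0'(2) by blast
    show "ev (sB N) (u0 @ f j) (rootB N k) \<notin> posB"
      if j: "j \<in> {1..n}" and k: "k \<in> set u0 \<union> set (f j)" for j k
    proof -
      define e where "e = int N - int k"
      define d where "d = int n - int j"
      have d: "0 \<le> d" using j by (simp add: d_def)
      have "k \<in> block_inner \<union> block_cent j" using k u0'(2) f(1)[OF j] by auto
      then have kN: "k \<in> {1..N}" using inner_sub block_cent_subset by blast
      have e: "0 \<le> e" "e < int N" using kN by (auto simp: e_def)
      have ev: "ev (tB N) (u0 @ f j) x = block_rev (int m) (blow (int m) (tr d) x)"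
        if "- int N \<le> x" "x < int N" for x
        using ev_u0[OF f_lists[OF j] that] f(3)[OF j] by (simp add: tB_def d_def)
      obtain q r where q: "e = int m * q + r" "0 \<le> r" "r < int m" by (rule block_cases[OF m_pos])
      \<comment> \<open>Inside a block \<open>e - 1\<close> and \<open>e\<close> stay neighbours
        until \<open>block_rev\<close> reverses them. At a block boundary the letter must come from
        \<open>f j\<close>, and the only such boundary is the one between the exchanged
        blocks.\<close>
      have "\<not> block_rev (int m) (blow (int m) (tr d) (e - 1)) < block_rev (int m) (blow (int m) (tr d) e)"
      proof (cases "r = 0")
        case False
        then have r: "0 \<le> r - 1" "r - 1 < int m" using q by simp_all
        have e1: "e - 1 = int m * q + (r - 1)" using q by simp
        show ?thesis
          unfolding e1 unfolding q(1)
          by (simp add: blow_block[OF r] blow_block[OF q(2,3)] block_rev_block[OF r] block_rev_block[OF q(2,3)])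
      next
        case True
        have "int m dvd e" by (simp add: q(1) True)
        then have "k \<notin> block_inner"
          using kN by (simp add: block_inner_def e_def int_N dvd_diff_right_iff int_dvd_int_iff)
        then have "k \<in> block_cent j" using \<open>k \<in> block_inner \<union> block_cent j\<close> by blast
        then have "cent j - int m < e" "e < cent j + int m"
          using block_cent_iff[OF j _ e_def] kN by auto
        moreover have "cent j - int m = int m * (d - 1)" "cent j + int m = int m * (d + 1)"
          by (simp_all add: cent_def d_def algebra_simps)
        ultimately have "int m * (d - 1) < int m * q" "int m * q < int m * (d + 1)"
          using q(1) True by simp_all
        then have "d - 1 < q" "q < d + 1"
          using mult_less_cancel_left_pos[OF m_pos] by blast+
        then have qd: "q = d" by simp
        have e1: "e - 1 = int m * (d - 1) + (int m - 1)" "e = int m * d + 0"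
          using q(1) True qd by (simp_all add: algebra_simps)
        have r: "0 \<le> int m - 1" "int m - 1 < int m" "0 \<le> (0 :: int)" "0 < int m" using m_pos by simp_all
        have "block_rev (int m) (blow (int m) (tr d) (e - 1)) = int m * d"
          unfolding e1(1) blow_block[OF r(1,2)] block_rev_block[OF r(1,2)] tr_values(1)[OF d] by simp
        moreover have "block_rev (int m) (blow (int m) (tr d) e) = int m * d - 1"
          unfolding e1(2) blow_block[OF r(3,4)] block_rev_block[OF r(3,4)] tr_values(2)[OF d]
          by (simp add: algebra_simps)
        ultimately show ?thesis by simp
      qed
      then show ?thesis unfolding rootB_pos_iff e_def[symmetric] using ev[of "e - 1"] ev[of e] e by simp
    qed
    show "ev (sB N) (concat (map f (alt_word l i j))) = ev (sB N) (concat (map f (alt_word l j i)))"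
      if "i \<in> {1..n}" "j \<in> {1..n}" "i \<noteq> j" "cox_B n i j = enat l" for i j l
    proof -
      have "ev (sB n) (alt_word l i j) = ev (sB n) (alt_word l j i)"
        by (rule Bn.cox_cong_ev[OF Bn.cox_cong_braid[OF that(1,2,4)]])
      then have "ev (tB n) (alt_word l i j) = ev (tB n) (alt_word l j i)"
        by (auto simp: ev_sB fun_eq_iff)
      then show ?thesis
        unfolding ev_sB ev_F[OF alt_word_lists[OF that(1,2)]] ev_F[OF alt_word_lists[OF that(2,1)]] by simp
    qed
    show "length (f i) = length (f j)"
      if "i \<in> {1..n}" "j \<in> {1..n}" "i \<noteq> j" "cox_B n i j = enat l" "odd l" for i j l
    proof -
      have "l = 3" using that
        by (auto simp: cox_B_def one_enat_def numeral_eq_enat split: if_splits)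
      then have "i \<noteq> n \<and> j \<noteq> n" using that
        by (auto simp: cox_B_def one_enat_def numeral_eq_enat doubleton_eq_iff split: if_splits)
      then show ?thesis using odd2[OF that(1)] odd2[OF that(2)] by simp
    qed
    show "redB n ?v0" by (rule v0_red)
    show "ev (sB n) ?v0 (rootB n j) \<notin> posB" if "j \<in> {1..n}" for j
      by (rule mirror_rootB[OF that v0(2)])
    show "redB N (concat (map f ?v0))"
    proof (rule redBI[OF two_le_N fv0_lists])
      \<comment> \<open>Letters of \<open>v0\<close> contribute exactly as in
        \<open>sum_invB\<close> with \<open>a = m^2 + m\<close> and \<open>b = m^2\<close>, so
        \<open>sum_invB_blow\<close> turns twice the length into the inversion count of the
        image.\<close>
      have "2 * length (concat (map f u)) = (\<Sum>i\<leftarrow>u. if i = n then m\<^sup>2 + m else 2 * m\<^sup>2)"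
        if "u \<in> lists {1..n}" for u
        using that
      proof (induction u rule: list.induct)
        case (Cons i u)
        then show ?case using odd2[of i] by simp
      qed simp
      from this[OF v0(1)] have "2 * length (concat (map f ?v0)) = sum (wtB (m\<^sup>2 + m) (m\<^sup>2)) (invB (ev (tB n) ?v0))"
        using sum_invB(2)[OF n v0_red] by simp
      also have "\<dots> = sum (wtB 2 1) (invB (blow (int m) (ev (tB n) ?v0)))"
        using m ev_tB_inj[OF v0(1)] sum_invB(1)[OF n v0_red] by (intro sum_invB_blow[symmetric]) auto
      finally show "2 * length (concat (map f ?v0)) \<le> sum (wtB 2 1) (invB (ev (tB N) (concat (map f ?v0))))"
        using ev_F[OF v0(1)] by simp
    qed
    show "ev (sB N) (u0 @ concat (map f ?v0)) (rootB N k) \<notin> posB" if k: "k \<in> {1..N}" for k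
    proof -
      \<comment> \<open>The blown up mirror moves every block rigidly to the opposite place;
        reversing each block then completes the mirror of all points.\<close>
      have "ev (tB N) (u0 @ concat (map f ?v0)) x = - 1 - x" if x: "- int N \<le> x" "x < int N" for x
      proof -
        obtain q r where q: "x = int m * q + r" "0 \<le> r" "r < int m" by (rule block_cases[OF m_pos])
        have N': "- int N = int m * (- int n)" by (simp add: int_N)
        have "- int n \<le> q \<and> q < int n"
          using x unfolding N' unfolding int_N q(1) block_range_iff[OF q(2,3)] by simp
        then have mir: "mirror (int n) q = - 1 - q" by (simp add: mirror_def)
        have "ev (tB N) (u0 @ concat (map f ?v0)) x = block_rev (int m) (blow (int m) (mirror (int n)) x)"
          using ev_u0[OF fv0_lists x] ev_F[OF v0(1)] v0(2) by simp
        also have "\<dots> = - 1 - x"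
          unfolding q(1) blow_block[OF q(2,3)] mir block_rev_block[OF q(2,3)] by (simp add: algebra_simps)
        finally show ?thesis .
      qed
      from this[of "int N - int k - 1"] this[of "int N - int k"] show ?thesis
        unfolding rootB_pos_iff using k by auto
    qed
    show "\<exists>j\<in>{1..n}. k \<in> set (f j)" if k: "k \<in> {1..N}" for k
    proof -
      define e where "e = int N - int k"
      have e: "0 \<le> e" "e < int N" using k by (auto simp: e_def)
      obtain q r where q: "e = int m * q + r" "0 \<le> r" "r < int m" by (rule block_cases[OF m_pos])
      have qn: "0 \<le> q" "q < int n"
        using e block_range_iff(2)[OF q(2,3), of 0 q] block_range_iff(1)[OF q(2,3), of q "int n"]
        unfolding int_N q(1) by simp_all
      define j where "j = nat (int n - q)"
      have j: "j \<in> {1..n}" "int n - int j = q" using qn by (auto simp: j_def nat_le_iff)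
      have "k \<in> set (f j)"
      proof (rule ccontr)
        \<comment> \<open>Without \<open>k\<close> no letter of \<open>f j\<close> crosses the cut
          at \<open>e\<close>, yet \<open>f j\<close> carries block \<open>q - 1\<close> onto block
          \<open>q\<close> and thereby a point below \<open>e\<close> to \<open>e\<close>.\<close>
        assume nk: "k \<notin> set (f j)"
        have "int N - int l \<noteq> \<bar>e\<bar>" if "l \<in> set (f j)" for l
        proof
          assume "int N - int l = \<bar>e\<bar>"
          then have "int l = int k" using e(1) unfolding e_def by linarith
          then show False using nk that by simp
        qed
        then have pres: "e \<le> ev (tB N) (f j) x \<longleftrightarrow> e \<le> x" for x
          by (rule ev_tB_preserves_ge[OF f_lists[OF j(1)]])
        have "ev (tB N) (f j) (int m * (q - 1) + r) = int m * q + r"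
          unfolding f(3)[OF j(1)] blow_block[OF q(2,3)] tB_def j(2) tr_values(1)[OF qn(1)] ..
        then have "e \<le> int m * (q - 1) + r" using pres[of "int m * (q - 1) + r"] q(1) by simp
        then show False using m_pos unfolding q(1) by (simp add: algebra_simps)
      qed
      then show ?thesis using j(1) by blast
    qed
  qed
  show ?thesis using exists_strict_parabolic f(4) by auto
qed

end

section \<open>The three families\<close>

lemma interval_cut:
  fixes a m l :: nat
  assumes "2 \<le> m"
  shows "a + m + m \<le> l \<Longrightarrow> {k. a < k \<and> k < a + m + m \<and> k \<le> l} = {a + 1..a + m + m - 1}"
    and "a + m + m \<le> l \<Longrightarrow> {k. a < k \<and> k < a + m + m \<and> k \<le> l} - {a + m}
      = {a + 1..a + m - 1} \<union> {a + m + 1..a + m + m - 1}"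
    and "{k. a < k \<and> k < a + m + m \<and> k \<le> a + m} = {a + 1..a + m}"
    and "{k. a < k \<and> k < a + m + m \<and> k \<le> a + m} - {a + m} = {a + 1..a + m - 1}"
  using assms by auto

lemma block_sets:
  fixes m n i :: nat
  assumes "2 \<le> m" "2 \<le> n"
  shows "i \<in> {1..n - 1} \<Longrightarrow> block_cent m (m * n) i = {(i - 1) * m + 1..(i + 1) * m - 1}"
    and "i \<in> {1..n - 1} \<Longrightarrow> block_off m (m * n) i
      = {(i - 1) * m + 1..i * m - 1} \<union> {i * m + 1..(i + 1) * m - 1}"
    and "block_cent m (m * n) n = {(n - 1) * m + 1..n * m}"
    and "block_off m (m * n) n = {(n - 1) * m + 1..n * m - 1}"
proof -
  have step: "j * m = (j - 1) * m + m" "(j + 1) * m = (j - 1) * m + m + m" if "1 \<le> j" for j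
    using that by (cases j; simp)+
  have "(i - 1) * m + m + m \<le> m * n" "1 \<le> i" if "i \<in> {1..n - 1}"
  proof -
    show i: "1 \<le> i" using that by simp
    have "i + 1 \<le> n" using that assms by auto
    then have "(i + 1) * m \<le> n * m" by (rule mult_le_mono1)
    then show "(i - 1) * m + m + m \<le> m * n" by (simp only: step(2)[OF i] mult.commute[of n m])
  qed
  note i = this
  note defs = block_off_def[OF assms HOL.refl] block_cent_def[OF assms HOL.refl]
  show "block_cent m (m * n) i = {(i - 1) * m + 1..(i + 1) * m - 1}" if "i \<in> {1..n - 1}"
    unfolding defs step[OF i(2)[OF that]] by (rule interval_cut(1)[OF assms(1) i(1)[OF that]])
  show "block_off m (m * n) i = {(i - 1) * m + 1..i * m - 1} \<union> {i * m + 1..(i + 1) * m - 1}"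
    if "i \<in> {1..n - 1}"
    unfolding defs step[OF i(2)[OF that]] by (rule interval_cut(2)[OF assms(1) i(1)[OF that]])
  have n: "1 \<le> n" using assms by simp
  have mn: "m * n = (n - 1) * m + m" using step(1)[OF n] by (simp only: mult.commute[of m n])
  show "block_cent m (m * n) n = {(n - 1) * m + 1..n * m}"
    unfolding defs unfolding mn step[OF n] by (rule interval_cut(3)[OF assms(1)])
  show "block_off m (m * n) n = {(n - 1) * m + 1..n * m - 1}"
    unfolding defs unfolding mn step[OF n] by (rule interval_cut(4)[OF assms(1)])
qed

theorem theorem1p5:
  "(\<forall>m n :: nat. 2 \<le> m \<and> m \<le> n \<longrightarrow>
      (\<exists>\<Phi>. strict_parabolic {1, 2} (cox_I2 (enat (2 * m))) {1..n} (cox_B n) \<Phi> \<and>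
         \<Phi> (T_word {1, 2} (cox_I2 (enat (2 * m))) [1]) =
           T_word {1..n} (cox_B n) (palindrome_word m n @ down2_word (m - 2)) \<and>
         \<Phi> (T_word {1, 2} (cox_I2 (enat (2 * m))) [2]) =
           T_word {1..n} (cox_B n) (down2_word (m - 1)))) \<and>
   (\<forall>m n :: nat. 2 \<le> m \<and> m \<le> n \<longrightarrow>
      (\<exists>\<Phi>. strict_parabolic {1..m} (cox_B m) {1..n} (cox_B n) \<Phi> \<and>
         (\<forall>i\<in>{1..m - 1}. \<Phi> (T_word {1..m} (cox_B m) [i]) = T_word {1..n} (cox_B n) [i]) \<and>
         \<Phi> (T_word {1..m} (cox_B m) [m]) = T_word {1..n} (cox_B n) (palindrome_word m n))) \<and>
   (\<forall>m n :: nat. 2 \<le> m \<and> 2 \<le> n \<longrightarrow>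
      (\<exists>\<Phi>. strict_parabolic {1..n} (cox_B n) {1..m * n} (cox_B (m * n)) \<Phi> \<and>
         (\<forall>i\<in>{1..n - 1}. \<Phi> (T_word {1..n} (cox_B n) [i]) =
            T_elem {1..m * n} (cox_B (m * n))
              (w_rel {1..m * n} (cox_B (m * n))
                 ({(i - 1) * m + 1..i * m - 1} \<union> {i * m + 1..(i + 1) * m - 1})
                 {(i - 1) * m + 1..(i + 1) * m - 1})) \<and>
         \<Phi> (T_word {1..n} (cox_B n) [n]) =
            T_elem {1..m * n} (cox_B (m * n))
              (w_rel {1..m * n} (cox_B (m * n))
                 {(n - 1) * m + 1..n * m - 1}
                 {(n - 1) * m + 1..n * m})))"
proof (intro conjI allI impI)
  fix m n :: nat
  assume mn: "2 \<le> m \<and> m \<le> n"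
  then have m: "2 \<le> m" "m \<le> n" by auto
  show "\<exists>\<Phi>. strict_parabolic {1, 2} (cox_I2 (enat (2 * m))) {1..n} (cox_B n) \<Phi> \<and>
      \<Phi> (T_word {1, 2} (cox_I2 (enat (2 * m))) [1]) =
        T_word {1..n} (cox_B n) (palindrome_word m n @ down2_word (m - 2)) \<and>
      \<Phi> (T_word {1, 2} (cox_I2 (enat (2 * m))) [2]) =
        T_word {1..n} (cox_B n) (down2_word (m - 1))"
    using dihedral_strict_parabolic[OF m] by (simp add: dihedral_word_def)
  obtain \<Phi> where \<Phi>: "strict_parabolic {1..m} (cox_B m) {1..n} (cox_B n) \<Phi>"
    "\<And>i. i \<in> {1..m} \<Longrightarrow> \<Phi> (T_word {1..m} (cox_B m) [i]) = T_word {1..n} (cox_B n) (stretch_word m n i)"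
    using stretch_strict_parabolic[OF m] by blast
  have "\<Phi> (T_word {1..m} (cox_B m) [i]) = T_word {1..n} (cox_B n) [i]" if "i \<in> {1..m - 1}" for i
  proof -
    have "i \<in> {1..m}" "i < m" using that m by auto
    then show ?thesis using \<Phi>(2)[of i] by (simp add: stretch_word_def)
  qed
  moreover have "\<Phi> (T_word {1..m} (cox_B m) [m]) = T_word {1..n} (cox_B n) (palindrome_word m n)"
    using \<Phi>(2)[of m] m by (auto simp: stretch_word_def)
  ultimately show "\<exists>\<Phi>. strict_parabolic {1..m} (cox_B m) {1..n} (cox_B n) \<Phi> \<and>
      (\<forall>i\<in>{1..m - 1}. \<Phi> (T_word {1..m} (cox_B m) [i]) = T_word {1..n} (cox_B n) [i]) \<and>
      \<Phi> (T_word {1..m} (cox_B m) [m]) = T_word {1..n} (cox_B n) (palindrome_word m n)"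
    using \<Phi>(1) by blast
next
  fix m n :: nat
  assume "2 \<le> m \<and> 2 \<le> n"
  then have m: "2 \<le> m" "2 \<le> n" by auto
  let ?T = "\<lambda>J K. T_elem {1..m * n} (cox_B (m * n)) (w_rel {1..m * n} (cox_B (m * n)) J K)"
  obtain \<Phi> where \<Phi>: "strict_parabolic {1..n} (cox_B n) {1..m * n} (cox_B (m * n)) \<Phi>"
    "\<And>i. i \<in> {1..n} \<Longrightarrow> \<Phi> (T_word {1..n} (cox_B n) [i]) = ?T (block_off m (m * n) i) (block_cent m (m * n) i)"
    using block_strict_parabolic[OF m HOL.refl] by blast
  have "\<Phi> (T_word {1..n} (cox_B n) [i]) =
      ?T ({(i - 1) * m + 1..i * m - 1} \<union> {i * m + 1..(i + 1) * m - 1}) {(i - 1) * m + 1..(i + 1) * m - 1}"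
    if i: "i \<in> {1..n - 1}" for i
  proof -
    have "i \<in> {1..n}" using i by auto
    then show ?thesis
      by (simp only: \<Phi>(2) block_sets(1)[OF m i] block_sets(2)[OF m i])
  qed
  moreover have "\<Phi> (T_word {1..n} (cox_B n) [n]) = ?T {(n - 1) * m + 1..n * m - 1} {(n - 1) * m + 1..n * m}"
  proof -
    have "n \<in> {1..n}" using m by auto
    then show ?thesis by (simp only: \<Phi>(2) block_sets(3,4)[OF m])
  qed
  ultimately show "\<exists>\<Phi>. strict_parabolic {1..n} (cox_B n) {1..m * n} (cox_B (m * n)) \<Phi> \<and>
      (\<forall>i\<in>{1..n - 1}. \<Phi> (T_word {1..n} (cox_B n) [i]) =
        ?T ({(i - 1) * m + 1..i * m - 1} \<union> {i * m + 1..(i + 1) * m - 1}) {(i - 1) * m + 1..(i + 1) * m - 1}) \<and>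
      \<Phi> (T_word {1..n} (cox_B n) [n]) = ?T {(n - 1) * m + 1..n * m - 1} {(n - 1) * m + 1..n * m}"
    using \<Phi>(1) by blast
qed

end
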